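(* Let $M$ be a compact connected oriented manifold with a transversely oriented foliation $\mathcal{F}$, and let $g$ be a Riemannian metric on $M$ which is bundle-like for $\mathcal{F}$. Assume that the basic Albanese map $A_{\mathcal{F}}:M\to Alb(M,\mathcal{F})$ is a submersion, and let $F$ be a fiber of $A_{\mathcal{F}}$. Then the restricted metric $g_F=g|_F$ on $F$ is bundle-like for the restricted foliation $\mathcal{F}|_F$ (the foliation of $F$ by the leaves of $\mathcal{F}$ contained in $F$).
   Context: Manifolds are smooth and without boundary; foliations are regular. $\Gamma(\mathcal{F})$ denotes the vector fields tangent to the leaves of $\mathcal{F}$, and $N\mathcal{F}=TM/T\mathcal{F}$. A metric $g$ is bundle-like for $\mathcal{F}$ if the induced metric $g_{N\mathcal{F}}$ on $N\mathcal{F}$ satisfies $\mathcal{L}_Xg_{N\mathcal{F}}=0$ for all $X\in\Gamma(\mathcal{F})$. $\mathcal{F}$ is transversely oriented if $N\mathcal{F}$ is oriented. Basic forms: $\Omega^k(M,\mathcal{F})=\{\alpha\in\Omega^k(M): i_X\alpha=0,\ i_Xd\alpha=0\ \forall X\in\Gamma(\mathcal{F})\}$, with cohomology $H^*(M/\mathcal{F})$; $H^1(M/\mathcal{F})$ injects into $H^1(M,\mathbb{R})$, and $H^1(M/\mathcal{F},\mathbb{Q}):=H^1(M/\mathcal{F})\cap H^1(M,\mathbb{Q})$, where $H^1(M,\mathbb{Q})$ consists of de Rham classes with rational integrals over $H_1(M,\mathbb{Z})$. A basic form is basic harmonic if it is annihilated by the basic Laplacian $d\delta_b+\delta_bd$,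 where $\delta_b$ is the formal adjoint of $d$ on basic forms with respect to the $L^2$ inner product; every class in $H^1(M/\mathcal{F})$ has a unique basic harmonic representative. Basic Albanese map: choose basic harmonic 1-forms $\omega_1,\dots,\omega_k$ whose classes form a basis of $H^1(M/\mathcal{F},\mathbb{Q})$. Let $\tilde M$ be the universal covering of $M$, viewed as homotopy classes of paths $\gamma$ from a fixed base point. The vectors $\left(\int_\sigma\omega_i\right)_{i=1,\dots,k}$, $\sigma\in H_1(M,\mathbb{Z})$, form a lattice $\Lambda_{\mathcal{F}}\subset\mathbb{R}^k$, and the map $\tilde M\to\mathbb{R}^k$, $[\gamma]\mapsto\left(\int_\gamma\omega_i\right)_{i=1,\dots,k}$, descends to $A_{\mathcal{F}}:M\to Alb(M,\mathcal{F}):=\mathbb{R}^k/\Lambda_{\mathcal{F}}$. Every leaf of $\mathcal{F}$ is contained in a fiber of $A_{\mathcal{F}}$. If $A_{\mathcal{F}}$ is a submersion, it is a fiber bundle by Ehresmann's theorem. *)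

theory Defs
  imports
    "HOL-Analysis.Analysis"
    "HOL-Homology.Homology"
    "Jordan_Normal_Form.Determinant"
begin

section \<open>Smooth functions of n real variables\<close>

text \<open>Real n-space is the library's \<^const>\<open>Euclidean_space\<close>: sequences vanishing from index n on.
  In particular \<open>Rn m \<subseteq> Rn n\<close> for \<open>m \<le> n\<close>, as the subspace where the last \<open>n - m\<close> coordinates
  vanish; slice charts use this.\<close>

abbreviation Rn :: "nat \<Rightarrow> (nat \<Rightarrow> real) set" where
  "Rn n \<equiv> topspace (Euclidean_space n)"

definition partial_deriv :: "nat \<Rightarrow> ((nat \<Rightarrow> real) \<Rightarrow> real) \<Rightarrow> (nat \<Rightarrow> real) \<Rightarrow> real" where
  "partial_deriv i f x = deriv (\<lambda>t. f (x(i := t))) (x i)"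

definition iterated_partial :: "nat list \<Rightarrow> ((nat \<Rightarrow> real) \<Rightarrow> real) \<Rightarrow> (nat \<Rightarrow> real) \<Rightarrow> real" where
  "iterated_partial is f = foldr partial_deriv is f"

text \<open>To be used for sets \<open>U\<close> that are open in \<open>Rn n\<close>.\<close>

definition smooth_on :: "nat \<Rightarrow> (nat \<Rightarrow> real) set \<Rightarrow> ((nat \<Rightarrow> real) \<Rightarrow> real) \<Rightarrow> bool" where
  "smooth_on n U f \<longleftrightarrow>
     (\<forall>is. set is \<subseteq> {..<n} \<longrightarrow>
        continuous_on U (iterated_partial is f) \<and>
        (\<forall>i<n. \<forall>x\<in>U. (\<lambda>t. iterated_partial is f (x(i := t))) differentiable (at (x i))))"


section \<open>Smooth manifolds\<close>

text \<open>The topology of a manifold is the one induced by its atlas. A chart is a pair of its domain and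
  its coordinate map, whose values outside the domain are irrelevant.\<close>

type_synonym 'a chart = "'a set \<times> ('a \<Rightarrow> nat \<Rightarrow> real)"

record 'a mfd =
  points :: "'a set"
  mdim :: nat
  atlas :: "'a chart set"

definition mtop :: "'a mfd \<Rightarrow> 'a topology" where
  "mtop M = topology (\<lambda>U. U \<subseteq> points M \<and>
     (\<forall>(D, \<phi>)\<in>atlas M. openin (Euclidean_space (mdim M)) (\<phi> ` (U \<inter> D))))"

definition smooth_transition :: "nat \<Rightarrow> 'a chart \<Rightarrow> 'a chart \<Rightarrow> bool" where
  "smooth_transition n c c' \<longleftrightarrow>
     openin (Euclidean_space n) (snd c ` (fst c \<inter> fst c')) \<and>
     (\<forall>i<n. smooth_on n (snd c ` (fst c \<inter> fst c')) (\<lambda>x. snd c' (inv_into (fst c) (snd c) x) i))"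

definition smooth_manifold :: "'a mfd \<Rightarrow> bool" where
  "smooth_manifold M \<longleftrightarrow>
     (\<forall>(D, \<phi>)\<in>atlas M. D \<subseteq> points M \<and> inj_on \<phi> D \<and> openin (Euclidean_space (mdim M)) (\<phi> ` D)) \<and>
     \<Union> (fst ` atlas M) = points M \<and>
     (\<forall>c\<in>atlas M. \<forall>c'\<in>atlas M. smooth_transition (mdim M) c c') \<and>
     Hausdorff_space (mtop M) \<and> second_countable (mtop M)"

definition max_atlas :: "'a mfd \<Rightarrow> 'a chart set" where
  "max_atlas M = {(D, \<phi>). D \<subseteq> points M \<and> inj_on \<phi> D \<and>
      openin (Euclidean_space (mdim M)) (\<phi> ` D) \<and>
      (\<forall>c\<in>atlas M. smooth_transition (mdim M) c (D, \<phi>) \<and> smooth_transition (mdim M) (D, \<phi>) c)}"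

definition smooth_fun_on :: "'a mfd \<Rightarrow> 'a set \<Rightarrow> ('a \<Rightarrow> real) \<Rightarrow> bool" where
  "smooth_fun_on M U f \<longleftrightarrow>
     (\<forall>(D, \<phi>)\<in>atlas M. smooth_on (mdim M) (\<phi> ` (U \<inter> D)) (f \<circ> inv_into D \<phi>))"

definition smooth_near :: "'a mfd \<Rightarrow> 'a \<Rightarrow> ('a \<Rightarrow> real) \<Rightarrow> bool" where
  "smooth_near M p f \<longleftrightarrow> (\<exists>U. openin (mtop M) U \<and> p \<in> U \<and> smooth_fun_on M U f)"

definition smooth_map :: "'a mfd \<Rightarrow> 'b mfd \<Rightarrow> ('a \<Rightarrow> 'b) \<Rightarrow> bool" where
  "smooth_map M N f \<longleftrightarrow> continuous_map (mtop M) (mtop N) f \<and>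
     (\<forall>(D, \<phi>)\<in>atlas M. \<forall>(E, \<psi>)\<in>atlas N. \<forall>i<mdim N.
        smooth_on (mdim M) (\<phi> ` {p\<in>D. f p \<in> E}) (\<lambda>x. \<psi> (f (inv_into D \<phi> x)) i))"


section \<open>Tangent vectors and vector fields\<close>

text \<open>A tangent vector at \<open>p\<close> is a linear combination of the coordinate derivations of a chart at \<open>p\<close>,
  acting on functions smooth near \<open>p\<close>. It is set to 0 on all other functions, so that equality of
  tangent vectors is equality of HOL functions.\<close>

type_synonym 'a tvec = "('a \<Rightarrow> real) \<Rightarrow> real"
type_synonym 'a vfield = "'a \<Rightarrow> 'a tvec"

definition coord_vec :: "'a mfd \<Rightarrow> 'a chart \<Rightarrow> 'a \<Rightarrow> nat \<Rightarrow> 'a tvec" where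
  "coord_vec M c p i = (\<lambda>f. if smooth_near M p f
      then partial_deriv i (f \<circ> inv_into (fst c) (snd c)) (snd c p) else 0)"

definition tangent_space :: "'a mfd \<Rightarrow> 'a \<Rightarrow> 'a tvec set" where
  "tangent_space M p = {v. \<exists>c\<in>atlas M. p \<in> fst c \<and>
      (\<exists>a. v = (\<lambda>f. \<Sum>i<mdim M. a i * coord_vec M c p i f))}"

definition differential :: "'a mfd \<Rightarrow> 'b mfd \<Rightarrow> ('a \<Rightarrow> 'b) \<Rightarrow> 'a \<Rightarrow> 'a tvec \<Rightarrow> 'b tvec" where
  "differential M N f p v = (\<lambda>h. if smooth_near N (f p) h then v (h \<circ> f) else 0)"

definition immersion :: "'a mfd \<Rightarrow> 'b mfd \<Rightarrow> ('a \<Rightarrow> 'b) \<Rightarrow> bool" where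
  "immersion M N f \<longleftrightarrow> smooth_map M N f \<and>
     (\<forall>p\<in>points M. inj_on (differential M N f p) (tangent_space M p))"

definition submersion :: "'a mfd \<Rightarrow> 'b mfd \<Rightarrow> ('a \<Rightarrow> 'b) \<Rightarrow> bool" where
  "submersion M N f \<longleftrightarrow> smooth_map M N f \<and>
     (\<forall>p\<in>points M. differential M N f p ` tangent_space M p = tangent_space N (f p))"

definition vector_field_on :: "'a mfd \<Rightarrow> 'a set \<Rightarrow> 'a vfield \<Rightarrow> bool" where
  "vector_field_on M U X \<longleftrightarrow> (\<forall>p\<in>U. X p \<in> tangent_space M p) \<and>
     (\<forall>(D, \<phi>)\<in>atlas M. \<forall>i<mdim M. smooth_fun_on M (U \<inter> D) (\<lambda>p. X p (\<lambda>q. \<phi> q i)))"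

abbreviation vector_field :: "'a mfd \<Rightarrow> 'a vfield \<Rightarrow> bool" where
  "vector_field M X \<equiv> vector_field_on M (points M) X"

definition lie_bracket :: "'a mfd \<Rightarrow> 'a vfield \<Rightarrow> 'a vfield \<Rightarrow> 'a vfield" where
  "lie_bracket M X Y p = (\<lambda>f. if smooth_near M p f
      then X p (\<lambda>q. Y q f) - Y p (\<lambda>q. X q f) else 0)"


section \<open>Submanifolds\<close>

text \<open>The embedded submanifold structure of dimension \<open>m\<close> on a subset \<open>S\<close>, given by the slice charts
  of \<open>M\<close>.\<close>

definition submanifold :: "'a mfd \<Rightarrow> 'a set \<Rightarrow> nat \<Rightarrow> 'a mfd" where
  "submanifold M S m = \<lparr>points = S, mdim = m,
     atlas = {(D \<inter> S, \<phi>) | D \<phi>. (D, \<phi>) \<in> max_atlas M \<and> \<phi> ` (D \<inter> S) = \<phi> ` D \<inter> Rn m}\<rparr>"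


section \<open>Foliations\<close>

text \<open>A foliation is the collection of its leaves, each leaf being a connected immersed submanifold
  with its own manifold structure. In a flat chart (onto a box) every leaf is a countable, possibly
  empty, union of slices on which the last \<open>n - p\<close> coordinates are constant.\<close>

definition flat_chart :: "'a mfd \<Rightarrow> nat \<Rightarrow> 'a mfd set \<Rightarrow> 'a chart \<Rightarrow> bool" where
  "flat_chart M p \<F> c \<longleftrightarrow> c \<in> max_atlas M \<and>
     (\<exists>a b. snd c ` fst c = {x \<in> Rn (mdim M). \<forall>i<mdim M. a i < x i \<and> x i < b i}) \<and>
     (\<forall>L\<in>\<F>. \<exists>C. countable C \<and>
        snd c ` (fst c \<inter> points L) =
          (\<Union>z\<in>C. {x \<in> snd c ` fst c. \<forall>i\<in>{p..<mdim M}. x i = z i}))"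

definition foliation :: "'a mfd \<Rightarrow> nat \<Rightarrow> 'a mfd set \<Rightarrow> bool" where
  "foliation M p \<F> \<longleftrightarrow>
     (\<forall>L\<in>\<F>. smooth_manifold L \<and> mdim L = p \<and> points L \<noteq> {} \<and> connected_space (mtop L) \<and>
        points L \<subseteq> points M \<and> immersion L M (\<lambda>x. x)) \<and>
     (\<forall>L\<in>\<F>. \<forall>L'\<in>\<F>. L \<noteq> L' \<longrightarrow> points L \<inter> points L' = {}) \<and>
     (\<Union>L\<in>\<F>. points L) = points M \<and>
     (\<forall>x\<in>points M. \<exists>c. x \<in> fst c \<and> flat_chart M p \<F> c)"

definition fol_tangent :: "'a mfd \<Rightarrow> 'a mfd set \<Rightarrow> 'a \<Rightarrow> 'a tvec set" where
  "fol_tangent M \<F> p =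
     {differential L M (\<lambda>x. x) p v | L v. L \<in> \<F> \<and> p \<in> points L \<and> v \<in> tangent_space L p}"

definition fol_sections :: "'a mfd \<Rightarrow> 'a mfd set \<Rightarrow> 'a vfield set" where
  "fol_sections M \<F> = {X. vector_field M X \<and> (\<forall>p\<in>points M. X p \<in> fol_tangent M \<F> p)}"

definition restrict_foliation :: "'a mfd set \<Rightarrow> 'a set \<Rightarrow> 'a mfd set" where
  "restrict_foliation \<F> S = {L\<in>\<F>. points L \<subseteq> S}"


section \<open>Orientations\<close>

text \<open>For a subbundle \<open>E\<close> of the tangent bundle, an orientation of the quotient bundle \<open>TM/E\<close> of rank
  \<open>r\<close> is given by the set \<open>ori p\<close> of positively oriented ordered bases at each point, where bases of
  the quotient are given by representatives in the tangent space. It has to contain continuous local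
  frames.\<close>

definition quotient_basis :: "'a mfd \<Rightarrow> ('a \<Rightarrow> 'a tvec set) \<Rightarrow> nat \<Rightarrow> 'a \<Rightarrow> 'a tvec list \<Rightarrow> bool" where
  "quotient_basis M E r p vs \<longleftrightarrow> length vs = r \<and> set vs \<subseteq> tangent_space M p \<and>
     (\<forall>v\<in>tangent_space M p. \<exists>!a. (\<forall>i\<ge>r. a i = (0::real)) \<and>
        (\<lambda>f. v f - (\<Sum>i<r. a i * (vs ! i) f)) \<in> E p)"

definition quotient_orientation ::
  "'a mfd \<Rightarrow> ('a \<Rightarrow> 'a tvec set) \<Rightarrow> nat \<Rightarrow> ('a \<Rightarrow> 'a tvec list set) \<Rightarrow> bool" where
  "quotient_orientation M E r ori \<longleftrightarrow>
     (\<forall>p\<in>points M. ori p \<noteq> {} \<and>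
        (\<forall>vs\<in>ori p. quotient_basis M E r p vs \<and>
           (\<forall>ws. ws \<in> ori p \<longleftrightarrow> quotient_basis M E r p ws \<and>
              (\<exists>A\<in>carrier_mat r r. Determinant.det A > (0::real) \<and>
                 (\<forall>j<r. (\<lambda>f. (ws ! j) f - (\<Sum>i<r. A $$ (i, j) * (vs ! i) f)) \<in> E p)))) \<and>
        (\<exists>U Xs. openin (mtop M) U \<and> p \<in> U \<and> (\<forall>X\<in>set Xs. vector_field_on M U X) \<and>
           (\<forall>q\<in>U. map (\<lambda>X. X q) Xs \<in> ori q)))"

definition orientation :: "'a mfd \<Rightarrow> ('a \<Rightarrow> 'a tvec list set) \<Rightarrow> bool" where
  "orientation M ori \<longleftrightarrow> quotient_orientation M (\<lambda>p. {\<lambda>f. 0}) (mdim M) ori"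

definition transverse_orientation ::
  "'a mfd \<Rightarrow> nat \<Rightarrow> 'a mfd set \<Rightarrow> ('a \<Rightarrow> 'a tvec list set) \<Rightarrow> bool" where
  "transverse_orientation M p \<F> ori \<longleftrightarrow>
     quotient_orientation M (fol_tangent M \<F>) (mdim M - p) ori"


section \<open>Riemannian metrics\<close>

type_synonym 'a metric = "'a \<Rightarrow> 'a tvec \<Rightarrow> 'a tvec \<Rightarrow> real"

definition riemannian_metric :: "'a mfd \<Rightarrow> 'a metric \<Rightarrow> bool" where
  "riemannian_metric M g \<longleftrightarrow>
     (\<forall>p\<in>points M.
        (\<forall>u\<in>tangent_space M p. \<forall>v\<in>tangent_space M p. g p u v = g p v u \<and>
           (\<forall>w\<in>tangent_space M p. \<forall>a b.
              g p (\<lambda>f. a * u f + b * v f) w = a * g p u w + b * g p v w)) \<and>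
        (\<forall>v\<in>tangent_space M p. v \<noteq> (\<lambda>f. 0) \<longrightarrow> g p v v > 0)) \<and>
     (\<forall>c\<in>atlas M. \<forall>i<mdim M. \<forall>j<mdim M.
        smooth_fun_on M (fst c) (\<lambda>p. g p (coord_vec M c p i) (coord_vec M c p j)))"

definition restrict_metric :: "'a mfd \<Rightarrow> 'a mfd \<Rightarrow> 'a metric \<Rightarrow> 'a metric" where
  "restrict_metric S M g p u v =
     g p (differential S M (\<lambda>x. x) p u) (differential S M (\<lambda>x. x) p v)"

text \<open>The metric on \<open>N\<F> = TM/T\<F>\<close> induced by \<open>g\<close> via \<open>N\<F> \<cong> T\<F>\<^sup>\<bottom>\<close>, evaluated on representatives
  in \<open>TM\<close>.\<close>

definition normal_part :: "'a mfd \<Rightarrow> 'a mfd set \<Rightarrow> 'a metric \<Rightarrow> 'a \<Rightarrow> 'a tvec \<Rightarrow> 'a tvec" where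
  "normal_part M \<F> g p v = (THE u. u \<in> tangent_space M p \<and>
     (\<lambda>f. v f - u f) \<in> fol_tangent M \<F> p \<and> (\<forall>t\<in>fol_tangent M \<F> p. g p u t = 0))"

definition normal_metric :: "'a mfd \<Rightarrow> 'a mfd set \<Rightarrow> 'a metric \<Rightarrow> 'a metric" where
  "normal_metric M \<F> g p u v = g p (normal_part M \<F> g p u) (normal_part M \<F> g p v)"

definition lie_derivative_metric ::
  "'a mfd \<Rightarrow> 'a vfield \<Rightarrow> 'a metric \<Rightarrow> 'a vfield \<Rightarrow> 'a vfield \<Rightarrow> 'a \<Rightarrow> real" where
  "lie_derivative_metric M X h Y Z p =
     X p (\<lambda>q. h q (Y q) (Z q)) - h p (lie_bracket M X Y p) (Z p) - h p (Y p) (lie_bracket M X Z p)"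

text \<open>Here \<open>Y\<close> and \<open>Z\<close> represent sections of \<open>N\<F>\<close>. The Lie derivative of the class of \<open>Y\<close> along
  \<open>X \<in> \<Gamma>(\<F>)\<close> is the class of \<open>[X, Y]\<close>.\<close>

definition bundle_like :: "'a mfd \<Rightarrow> 'a mfd set \<Rightarrow> 'a metric \<Rightarrow> bool" where
  "bundle_like M \<F> g \<longleftrightarrow>
     (\<forall>X\<in>fol_sections M \<F>. \<forall>Y Z. vector_field M Y \<longrightarrow> vector_field M Z \<longrightarrow>
        (\<forall>p\<in>points M. lie_derivative_metric M X (normal_metric M \<F> g) Y Z p = 0))"


section \<open>Differential forms\<close>

text \<open>A k-form takes a point and a list of k tangent vectors, and is 0 on all other arguments.\<close>

type_synonym 'a form = "'a \<Rightarrow> 'a tvec list \<Rightarrow> real"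

abbreviation zero_form :: "'a form" where
  "zero_form \<equiv> \<lambda>p vs. 0"

definition forms :: "'a mfd \<Rightarrow> nat \<Rightarrow> 'a form set" where
  "forms M k = {\<omega>.
     (\<forall>p vs. \<not> (p \<in> points M \<and> length vs = k \<and> set vs \<subseteq> tangent_space M p) \<longrightarrow> \<omega> p vs = 0) \<and>
     (\<forall>p\<in>points M. \<forall>vs. length vs = k \<and> set vs \<subseteq> tangent_space M p \<longrightarrow>
        (\<forall>i<k. \<forall>u\<in>tangent_space M p. \<forall>v\<in>tangent_space M p. \<forall>a b.
           \<omega> p (vs[i := (\<lambda>f. a * u f + b * v f)]) = a * \<omega> p (vs[i := u]) + b * \<omega> p (vs[i := v])) \<and>
        (\<forall>i<k. \<forall>j<k. i \<noteq> j \<and> vs ! i = vs ! j \<longrightarrow> \<omega> p vs = 0)) \<and>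
     (\<forall>c\<in>atlas M. \<forall>is. length is = k \<and> set is \<subseteq> {..<mdim M} \<longrightarrow>
        smooth_fun_on M (fst c) (\<lambda>p. \<omega> p (map (coord_vec M c p) is)))}"

text \<open>The exterior derivative of a k-form, characterised by the invariant (Koszul) formula.\<close>

definition koszul :: "'a mfd \<Rightarrow> nat \<Rightarrow> 'a form \<Rightarrow> 'a vfield list \<Rightarrow> 'a \<Rightarrow> real" where
  "koszul M k \<omega> Xs p =
     (\<Sum>i\<le>k. (-1) ^ i * (Xs ! i) p (\<lambda>q. \<omega> q (map (\<lambda>X. X q) (nths Xs (- {i}))))) +
     (\<Sum>j\<le>k. \<Sum>i<j. (-1) ^ (i + j) *
        \<omega> p (lie_bracket M (Xs ! i) (Xs ! j) p # map (\<lambda>X. X p) (nths Xs (- {i, j}))))"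

definition ext_deriv :: "'a mfd \<Rightarrow> nat \<Rightarrow> 'a form \<Rightarrow> 'a form" where
  "ext_deriv M k \<omega> = (THE \<eta>. \<eta> \<in> forms M (Suc k) \<and>
     (\<forall>Xs. length Xs = Suc k \<and> (\<forall>X\<in>set Xs. vector_field M X) \<longrightarrow>
        (\<forall>p\<in>points M. \<eta> p (map (\<lambda>X. X p) Xs) = koszul M k \<omega> Xs p)))"

definition interior_product :: "'a vfield \<Rightarrow> 'a form \<Rightarrow> 'a form" where
  "interior_product X \<omega> p vs = \<omega> p (X p # vs)"

definition basic_forms :: "'a mfd \<Rightarrow> 'a mfd set \<Rightarrow> nat \<Rightarrow> 'a form set" where
  "basic_forms M \<F> k = {\<alpha>\<in>forms M k. \<forall>X\<in>fol_sections M \<F>.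
     \<forall>p\<in>points M. interior_product X \<alpha> p = (\<lambda>vs. 0) \<and> interior_product X (ext_deriv M k \<alpha>) p = (\<lambda>vs. 0)}"


section \<open>The basic Laplacian\<close>

definition lebesgue_Rn :: "nat \<Rightarrow> (nat \<Rightarrow> real) measure" where
  "lebesgue_Rn n = distr (PiM {..<n} (\<lambda>_. lborel)) borel (\<lambda>x i. if i < n then x i else 0)"

definition gram_det :: "'a mfd \<Rightarrow> 'a metric \<Rightarrow> 'a chart \<Rightarrow> 'a \<Rightarrow> real" where
  "gram_det M g c p = Determinant.det (Matrix.mat (mdim M) (mdim M)
     (\<lambda>(i, j). g p (coord_vec M c p i) (coord_vec M c p j)))"

definition riemannian_measure :: "'a mfd \<Rightarrow> 'a metric \<Rightarrow> 'a measure" where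
  "riemannian_measure M g = (THE \<mu>. space \<mu> = points M \<and>
     sets \<mu> = sigma_sets (points M) {U. openin (mtop M) U} \<and>
     (\<forall>(D, \<phi>)\<in>atlas M. \<forall>B\<in>sets \<mu>. B \<subseteq> D \<longrightarrow>
        emeasure \<mu> B = (\<integral>\<^sup>+x\<in>\<phi> ` B. ennreal (sqrt (gram_det M g (D, \<phi>) (inv_into D \<phi> x)))
                          \<partial>lebesgue_Rn (mdim M))))"

text \<open>The pointwise inner product of k-forms, computed in an arbitrary orthonormal basis. The factor
  \<open>1/k!\<close> compensates for summing over all, not only increasing, multi-indices.\<close>

definition form_inner :: "'a mfd \<Rightarrow> 'a metric \<Rightarrow> nat \<Rightarrow> 'a form \<Rightarrow> 'a form \<Rightarrow> 'a \<Rightarrow> real" where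
  "form_inner M g k \<alpha> \<beta> p =
     (let e = (SOME e. length e = mdim M \<and> set e \<subseteq> tangent_space M p \<and>
                 (\<forall>i<mdim M. \<forall>j<mdim M. g p (e ! i) (e ! j) = (if i = j then 1 else 0)))
      in (\<Sum>I\<in>{I. length I = k \<and> set I \<subseteq> {..<mdim M}}.
            \<alpha> p (map (\<lambda>i. e ! i) I) * \<beta> p (map (\<lambda>i. e ! i) I)) / fact k)"

definition L2_inner :: "'a mfd \<Rightarrow> 'a metric \<Rightarrow> nat \<Rightarrow> 'a form \<Rightarrow> 'a form \<Rightarrow> real" where
  "L2_inner M g k \<alpha> \<beta> = (\<integral>p. form_inner M g k \<alpha> \<beta> p \<partial>riemannian_measure M g)"

text \<open>The formal adjoint of \<open>d\<close> on basic forms, as a map from k-forms to (k-1)-forms.\<close>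

definition basic_codiff :: "'a mfd \<Rightarrow> 'a mfd set \<Rightarrow> 'a metric \<Rightarrow> nat \<Rightarrow> 'a form \<Rightarrow> 'a form" where
  "basic_codiff M \<F> g k \<alpha> = (if k = 0 then zero_form else
     (THE \<beta>. \<beta> \<in> basic_forms M \<F> (k - 1) \<and>
        (\<forall>\<gamma>\<in>basic_forms M \<F> (k - 1).
           L2_inner M g k (ext_deriv M (k - 1) \<gamma>) \<alpha> = L2_inner M g (k - 1) \<gamma> \<beta>)))"

definition basic_laplacian :: "'a mfd \<Rightarrow> 'a mfd set \<Rightarrow> 'a metric \<Rightarrow> nat \<Rightarrow> 'a form \<Rightarrow> 'a form" where
  "basic_laplacian M \<F> g k \<alpha> =
     (\<lambda>p vs. (if k = 0 then 0 else ext_deriv M (k - 1) (basic_codiff M \<F> g k \<alpha>) p vs)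
            + basic_codiff M \<F> g (Suc k) (ext_deriv M k \<alpha>) p vs)"

definition basic_harmonic :: "'a mfd \<Rightarrow> 'a mfd set \<Rightarrow> 'a metric \<Rightarrow> nat \<Rightarrow> 'a form \<Rightarrow> bool" where
  "basic_harmonic M \<F> g k \<alpha> \<longleftrightarrow>
     \<alpha> \<in> basic_forms M \<F> k \<and> basic_laplacian M \<F> g k \<alpha> = zero_form"


section \<open>Integration of 1-forms along curves and 1-cycles\<close>

definition smooth_curve_on :: "'a mfd \<Rightarrow> real set \<Rightarrow> (real \<Rightarrow> 'a) \<Rightarrow> bool" where
  "smooth_curve_on M J \<gamma> \<longleftrightarrow> continuous_map (top_of_set J) (mtop M) \<gamma> \<and>
     (\<forall>(D, \<phi>)\<in>atlas M. \<forall>i<mdim M. \<forall>m. \<forall>t\<in>J. \<gamma> t \<in> D \<longrightarrow>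
        ((deriv ^^ m) (\<lambda>s. \<phi> (\<gamma> s) i)) differentiable (at t))"

definition smooth_arc :: "'a mfd \<Rightarrow> real \<Rightarrow> real \<Rightarrow> (real \<Rightarrow> 'a) \<Rightarrow> bool" where
  "smooth_arc M a b \<gamma> \<longleftrightarrow> (\<exists>\<epsilon>>0. \<exists>\<delta>. smooth_curve_on M {a - \<epsilon><..<b + \<epsilon>} \<delta> \<and>
     (\<forall>t\<in>{a..b}. \<gamma> t = \<delta> t))"

definition piecewise_smooth_path :: "'a mfd \<Rightarrow> (real \<Rightarrow> 'a) \<Rightarrow> bool" where
  "piecewise_smooth_path M \<gamma> \<longleftrightarrow>
     (\<exists>ts. ts \<noteq> [] \<and> hd ts = 0 \<and> last ts = 1 \<and> sorted ts \<and>
        (\<forall>i. Suc i < length ts \<longrightarrow> smooth_arc M (ts ! i) (ts ! Suc i) \<gamma>))"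

definition velocity :: "'a mfd \<Rightarrow> (real \<Rightarrow> 'a) \<Rightarrow> real \<Rightarrow> 'a tvec" where
  "velocity M \<gamma> t = (\<lambda>f. if smooth_near M (\<gamma> t) f then deriv (f \<circ> \<gamma>) t else 0)"

definition path_integral :: "'a mfd \<Rightarrow> 'a form \<Rightarrow> (real \<Rightarrow> 'a) \<Rightarrow> real" where
  "path_integral M \<omega> \<gamma> = integral {0..1} (\<lambda>t. \<omega> (\<gamma> t) [velocity M \<gamma> t])"

definition edge_path :: "((nat \<Rightarrow> real) \<Rightarrow> 'a) \<Rightarrow> real \<Rightarrow> 'a" where
  "edge_path \<sigma> t = \<sigma> (\<lambda>i. if i = 0 then 1 - t else if i = 1 then t else 0)"

text \<open>Integral classes in \<open>H\<^sub>1(M, \<int>)\<close> are represented by smooth singular cycles. For a closed form the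
  integral depends only on the class.\<close>

definition smooth_1_cycles :: "'a mfd \<Rightarrow> 'a chain set" where
  "smooth_1_cycles M = {z. singular_relcycle 1 (mtop M) {} z \<and>
     (\<forall>\<sigma>\<in>Poly_Mapping.keys z. smooth_arc M 0 1 (edge_path \<sigma>))}"

definition cycle_integral :: "'a mfd \<Rightarrow> 'a form \<Rightarrow> 'a chain \<Rightarrow> real" where
  "cycle_integral M \<omega> z =
     (\<Sum>\<sigma>\<in>Poly_Mapping.keys z.
        of_int (Poly_Mapping.lookup z \<sigma>) * path_integral M \<omega> (edge_path \<sigma>))"


section \<open>First basic cohomology\<close>

definition basic_closed1 :: "'a mfd \<Rightarrow> 'a mfd set \<Rightarrow> 'a form set" where
  "basic_closed1 M \<F> = {\<alpha>\<in>basic_forms M \<F> 1. ext_deriv M 1 \<alpha> = zero_form}"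

definition basic_class :: "'a mfd \<Rightarrow> 'a mfd set \<Rightarrow> 'a form \<Rightarrow> 'a form set" where
  "basic_class M \<F> \<alpha> = {\<beta>\<in>basic_closed1 M \<F>.
     \<exists>f\<in>basic_forms M \<F> 0. \<beta> = (\<lambda>p vs. \<alpha> p vs + ext_deriv M 0 f p vs)}"

definition basic_H1_rat :: "'a mfd \<Rightarrow> 'a mfd set \<Rightarrow> 'a form set set" where
  "basic_H1_rat M \<F> = basic_class M \<F> `
     {\<alpha>\<in>basic_closed1 M \<F>. \<forall>z\<in>smooth_1_cycles M. cycle_integral M \<alpha> z \<in> \<rat>}"

definition rat_comb :: "nat \<Rightarrow> (nat \<Rightarrow> rat) \<Rightarrow> (nat \<Rightarrow> 'a form) \<Rightarrow> 'a form" where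
  "rat_comb k r \<omega> = (\<lambda>p vs. \<Sum>i<k. of_rat (r i) * \<omega> i p vs)"

text \<open>The classes of \<open>\<omega>\<^sub>0, \<dots>, \<omega>\<^bsub>k-1\<^esub>\<close> form a basis of the rational vector space
  \<open>H\<^sup>1(M/\<F>, \<rat>)\<close>.\<close>

definition basic_H1_rat_basis :: "'a mfd \<Rightarrow> 'a mfd set \<Rightarrow> nat \<Rightarrow> (nat \<Rightarrow> 'a form) \<Rightarrow> bool" where
  "basic_H1_rat_basis M \<F> k \<omega> \<longleftrightarrow>
     (\<forall>i<k. \<omega> i \<in> basic_closed1 M \<F> \<and> basic_class M \<F> (\<omega> i) \<in> basic_H1_rat M \<F>) \<and>
     (\<forall>r. basic_class M \<F> (rat_comb k r \<omega>) = basic_class M \<F> zero_form \<longrightarrow> (\<forall>i<k. r i = 0)) \<and>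
     (\<forall>\<xi>\<in>basic_H1_rat M \<F>. \<exists>r. \<xi> = basic_class M \<F> (rat_comb k r \<omega>))"


section \<open>The basic Albanese map\<close>

definition period_lattice :: "'a mfd \<Rightarrow> nat \<Rightarrow> (nat \<Rightarrow> 'a form) \<Rightarrow> (nat \<Rightarrow> real) set" where
  "period_lattice M k \<omega> =
     {\<lambda>i. if i < k then cycle_integral M (\<omega> i) z else 0 | z. z \<in> smooth_1_cycles M}"

definition lattice_coset :: "(nat \<Rightarrow> real) set \<Rightarrow> (nat \<Rightarrow> real) \<Rightarrow> (nat \<Rightarrow> real) set" where
  "lattice_coset \<Lambda> v = {\<lambda>i. v i + l i | l. l \<in> \<Lambda>}"

text \<open>The quotient of \<open>Rn k\<close> by a lattice, with the local inverses of the projection as charts.\<close>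

definition torus :: "nat \<Rightarrow> (nat \<Rightarrow> real) set \<Rightarrow> (nat \<Rightarrow> real) set mfd" where
  "torus k \<Lambda> = \<lparr>points = lattice_coset \<Lambda> ` Rn k, mdim = k,
     atlas = {(lattice_coset \<Lambda> ` U, inv_into U (lattice_coset \<Lambda>)) | U.
                openin (Euclidean_space k) U \<and> inj_on (lattice_coset \<Lambda>) U}\<rparr>"

definition albanese :: "'a mfd \<Rightarrow> nat \<Rightarrow> (nat \<Rightarrow> 'a form) \<Rightarrow> (nat \<Rightarrow> real) set mfd" where
  "albanese M k \<omega> = torus k (period_lattice M k \<omega>)"

text \<open>The union is over all paths from the base point \<open>x\<^sub>0\<close> to \<open>x\<close>. All of them give the same
  coset.\<close>

definition albanese_map ::
  "'a mfd \<Rightarrow> nat \<Rightarrow> (nat \<Rightarrow> 'a form) \<Rightarrow> 'a \<Rightarrow> 'a \<Rightarrow> (nat \<Rightarrow> real) set" where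
  "albanese_map M k \<omega> x\<^sub>0 x =
     (\<Union>\<gamma>\<in>{\<gamma>. piecewise_smooth_path M \<gamma> \<and> \<gamma> 0 = x\<^sub>0 \<and> \<gamma> 1 = x}.
        lattice_coset (period_lattice M k \<omega>) (\<lambda>i. if i < k then path_integral M (\<omega> i) \<gamma> else 0))"

end

theory Submission
  imports Defs
begin

text \<open>
  Why the theorem holds. A vector tangent to the fibre \<open>F\<close> has the same orthogonal projection away
  from the leaf through its base point whether it is computed in \<open>F\<close> or in \<open>M\<close>: the leaf lies in
  \<open>F\<close>, so its directions are the same, and \<open>g\<^sub>F\<close> is the restriction of \<open>g\<close>. Hence the transverse
  metric of \<open>F\<close> is the restriction of the transverse metric of \<open>M\<close> (\<open>normal_metric_sub\<close>).
  Let \<open>X\<close> be a field on \<open>F\<close> that is tangent to the leaves and let \<open>Y\<close>, \<open>Z\<close> be fields on \<open>F\<close>. Near a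
  point of \<open>F\<close> they extend to global fields \<open>X'\<close>, \<open>Y'\<close>, \<open>Z'\<close> on \<open>M\<close>, with \<open>X'\<close> still tangent to the
  leaves (\<open>extend_vector_field\<close>). Derivatives along \<open>X\<close> and brackets of fields tangent to \<open>F\<close> can be
  computed with the extensions (\<open>push_lie_bracket\<close>), so the Lie derivative of the transverse metric
  of \<open>F\<close> is the restriction of that of \<open>M\<close>, which vanishes.

  The geometry of \<open>F\<close> enters in two ways only: \<open>F\<close> has slice charts, and it contains the leaf through
  each of its points. Both can be read off from one section \<open>X\<close> of the tangent bundle of the restricted
  foliation, since \<open>X q\<close> is a combination of coordinate vectors of a slice chart at \<open>q\<close> and also a
  tangent vector of a leaf contained in \<open>F\<close>. Without such a section the Lie derivative condition is
  empty. So the result is proved for an arbitrary subset with the structure given by its slice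
  charts (\<open>bundle_like_submanifold\<close>).

  The extension has to preserve tangency to the leaves, and this is done in a flat chart. There the
  tangent space of the leaf is spanned by the first \<open>p\<close> coordinate vectors (\<open>fol_tangent_flat_chart\<close>):
  the last coordinates take countably many values on a leaf, hence are locally constant along it, and
  an injective linear map between spaces of dimension \<open>p\<close> is onto. The components of a field on \<open>F\<close> in
  such a chart are smooth functions on \<open>F\<close>, which extend through a slice chart
  (\<open>smooth_near_extend\<close>), and a bump function makes the result global.

  A tangent vector acts as a derivation only on smooth functions, so the transverse metric of two
  fields has to be shown smooth. This is why the normal part is computed by the Gram-Schmidt
  process applied to the coordinate frame of a flat chart, in which only rational operations occur
  (\<open>smooth_near_normal_metric\<close>). The calculus needed on manifolds is derived from the C1 chain rule
  and the symmetry of second partial derivatives for functions on open subsets of real n-space.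
\<close>

section \<open>Calculus on open subsets of real n-space\<close>

lemma Rn_iff: "x \<in> Rn n \<longleftrightarrow> (\<forall>i\<ge>n. x i = 0)"
  by (simp add: topspace_Euclidean_space)

lemma openin_Euclidean_space_top_of_set:
  "openin (Euclidean_space n) U = openin (top_of_set {x. \<forall>i\<ge>n. x i = 0}) U"
  by (simp add: Euclidean_space_def euclidean_product_topology)

lemma openin_Euclidean_space:
  "openin (Euclidean_space n) U \<longleftrightarrow> (\<exists>T. open T \<and> U = Rn n \<inter> T)"
  by (simp add: openin_Euclidean_space_top_of_set openin_open topspace_Euclidean_space)

lemma openin_Rn_preimage:
  assumes U: "openin (Euclidean_space n) U" and h: "continuous_on U h" and "open B"
  shows "openin (Euclidean_space n) {z \<in> U. h z \<in> B}"
proof -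
  have "openin (top_of_set U) (U \<inter> h -` B)"
    by (rule continuous_openin_preimage_gen[OF h \<open>open B\<close>])
  moreover have "U \<inter> h -` B = {z \<in> U. h z \<in> B}" by auto
  ultimately show ?thesis
    using openin_trans[OF _ U[unfolded openin_Euclidean_space_top_of_set]]
    by (simp add: openin_Euclidean_space_top_of_set)
qed

lemma openin_Rn_subset: "openin (Euclidean_space n) U \<Longrightarrow> U \<subseteq> Rn n"
  by (rule openin_subset)

lemma openin_Rn_update:
  assumes "openin (Euclidean_space n) U" "x \<in> U" "i < n"
  shows "\<forall>\<^sub>F t in nhds (x i). x(i := t) \<in> U"
proof -
  obtain T where T: "open T" "U = Rn n \<inter> T"
    using assms(1) unfolding openin_Euclidean_space by blast
  have "continuous_on UNIV (\<lambda>t. x(i := t))"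
  proof (rule continuous_on_coordinatewise_then_product)
    show "continuous_on UNIV (\<lambda>t. (x(i := t)) j)" for j
      by (cases "j = i") auto
  qed
  then have "open ((\<lambda>t. x(i := t)) -` T)"
    using T(1) open_vimage by blast
  moreover have "x i \<in> (\<lambda>t. x(i := t)) -` T"
    using assms T by simp
  ultimately have "\<forall>\<^sub>F t in nhds (x i). x(i := t) \<in> T"
    unfolding eventually_nhds by blast
  moreover have "x(i := t) \<in> Rn n" for t
    using assms T by (auto simp: Rn_iff)
  ultimately show ?thesis
    by (simp add: T)
qed

lemma openin_Rn_box:
  assumes "openin (Euclidean_space n) U" "x \<in> U"
  obtains \<delta> where "\<delta> > 0" "\<And>y. y \<in> Rn n \<Longrightarrow> (\<And>i. i < n \<Longrightarrow> \<bar>y i - x i\<bar> < \<delta>) \<Longrightarrow> y \<in> U"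
proof -
  obtain T where T: "open T" "U = Rn n \<inter> T"
    using assms(1) unfolding openin_Euclidean_space by blast
  have "openin (product_topology (\<lambda>i. euclidean) UNIV) T"
    using T(1) by (simp add: open_fun_def)
  moreover have "x \<in> T" using assms(2) T(2) by blast
  ultimately obtain W where W': "x \<in> Pi\<^sub>E UNIV W" "\<forall>i. openin euclidean (W i)" "Pi\<^sub>E UNIV W \<subseteq> T"
    using product_topology_open_contains_basis[of "\<lambda>i. euclidean" UNIV T x]
    by - (drule (1) meta_mp, drule (1) meta_mp, elim exE conjE, rule that)
  then have W: "\<And>i. open (W i)" "\<And>i. x i \<in> W i" "\<And>y. (\<And>i. y i \<in> W i) \<Longrightarrow> y \<in> T"
    by (auto simp: PiE_UNIV_domain)
  have "\<exists>d>0. \<forall>t. \<bar>t - x i\<bar> < d \<longrightarrow> t \<in> W i" for i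
    using W(1,2)[of i] unfolding open_dist dist_real_def by auto
  then obtain d where d: "\<And>i. d i > 0" "\<And>i t. \<bar>t - x i\<bar> < d i \<Longrightarrow> t \<in> W i"
    by metis
  define \<delta> where "\<delta> = Min (insert 1 (d ` {..<n}))"
  have "\<delta> > 0" unfolding \<delta>_def using d by auto
  moreover have "y \<in> U" if y: "y \<in> Rn n" "\<And>i. i < n \<Longrightarrow> \<bar>y i - x i\<bar> < \<delta>" for y
  proof -
    have "y i \<in> W i" for i
    proof (cases "i < n")
      case True
      then have "\<delta> \<le> d i" by (simp add: \<delta>_def)
      then show ?thesis using y(2)[OF True] d(2) by force
    next
      case False
      then have "y i = x i" using y(1) assms T by (simp add: Rn_iff)
      then show ?thesis using d by simp
    qed
    then show ?thesis using W(3) y T by blast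
  qed
  ultimately show ?thesis using that by blast
qed

lemma continuous_on_locally:
  fixes f :: "'b::t2_space \<Rightarrow> 'c::topological_space"
  assumes "\<And>x. x \<in> U \<Longrightarrow> \<exists>V. openin (top_of_set S) V \<and> x \<in> V \<and> continuous_on V f" "U \<subseteq> S"
  shows "continuous_on U f"
  unfolding continuous_on_eq_continuous_within
proof
  fix x assume x: "x \<in> U"
  then obtain V T where V: "open T" "V = S \<inter> T" "x \<in> V" "continuous_on V f"
    using assms(1)[OF x] by (auto simp: openin_open)
  have "continuous (at x within (U \<inter> T)) f"
    using V x assms(2) continuous_within_subset[of x V f "U \<inter> T"]
    unfolding continuous_on_eq_continuous_within by blast
  moreover have "at x within (U \<inter> T) = at x within U"
    by (rule at_within_nhd[of _ T]) (use V in auto)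
  ultimately show "continuous (at x within U) f" by simp
qed

definition partially_differentiable_on ::
  "nat \<Rightarrow> (nat \<Rightarrow> real) set \<Rightarrow> ((nat \<Rightarrow> real) \<Rightarrow> real) \<Rightarrow> bool" where
  "partially_differentiable_on n U f \<longleftrightarrow>
     (\<forall>i<n. \<forall>x\<in>U. (\<lambda>t. f (x(i := t))) differentiable (at (x i)))"

text \<open>A function is smooth iff it is \<open>Ck\<close> for all \<open>k\<close> (\<open>smooth_on_iff_Ck\<close>). Closure properties of
  smooth functions are proved by induction on \<open>k\<close>: the partial derivatives of a sum, a product or a
  composition are expressions of the same kind.\<close>

fun Ck :: "nat \<Rightarrow> (nat \<Rightarrow> real) set \<Rightarrow> nat \<Rightarrow> ((nat \<Rightarrow> real) \<Rightarrow> real) \<Rightarrow> bool" where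
  "Ck n U 0 f \<longleftrightarrow> continuous_on U f"
| "Ck n U (Suc k) f \<longleftrightarrow> continuous_on U f \<and> partially_differentiable_on n U f \<and>
     (\<forall>i<n. Ck n U k (partial_deriv i f))"

lemma has_partial_deriv:
  "partially_differentiable_on n U f \<Longrightarrow> i < n \<Longrightarrow> x \<in> U \<Longrightarrow>
    ((\<lambda>t. f (x(i := t))) has_real_derivative partial_deriv i f x) (at (x i))"
  by (simp add: partially_differentiable_on_def partial_deriv_def DERIV_deriv_iff_real_differentiable)

lemma partial_derivI:
  "((\<lambda>t. f (x(i := t))) has_real_derivative d) (at (x i)) \<Longrightarrow> partial_deriv i f x = d"
  unfolding partial_deriv_def by (rule DERIV_imp_deriv)

lemma partially_differentiable_onI:
  assumes "\<And>i x. i < n \<Longrightarrow> x \<in> U \<Longrightarrow> ((\<lambda>t. f (x(i := t))) has_real_derivative d i x) (at (x i))"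
  shows "partially_differentiable_on n U f"
  unfolding partially_differentiable_on_def
  using assms real_differentiable_def by blast

lemma partial_deriv_cong:
  assumes "openin (Euclidean_space n) U" "\<And>x. x \<in> U \<Longrightarrow> f x = g x" "i < n" "x \<in> U"
  shows "partial_deriv i f x = partial_deriv i g x"
  unfolding partial_deriv_def
proof (rule deriv_cong_ev)
  show "\<forall>\<^sub>F t in nhds (x i). f (x(i := t)) = g (x(i := t))"
    using openin_Rn_update[OF assms(1,4,3)] assms(2) by (auto elim: eventually_mono)
qed simp

lemma partially_differentiable_on_cong:
  assumes "openin (Euclidean_space n) U" "\<And>x. x \<in> U \<Longrightarrow> f x = g x"
    "partially_differentiable_on n U f"
  shows "partially_differentiable_on n U g"
proof (rule partially_differentiable_onI)
  fix i x assume i: "i < n" "x \<in> U"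
  have "\<forall>\<^sub>F t in nhds (x i). f (x(i := t)) = g (x(i := t))"
    using openin_Rn_update[OF assms(1) i(2,1)] assms(2) by (auto elim: eventually_mono)
  from this show "((\<lambda>t. g (x(i := t))) has_real_derivative partial_deriv i f x) (at (x i))"
    using has_partial_deriv[OF assms(3) i] by (rule DERIV_cong_ev[OF refl _ refl, THEN iffD1])
qed

lemma Ck_cong:
  assumes "openin (Euclidean_space n) U" "\<And>x. x \<in> U \<Longrightarrow> f x = g x" "Ck n U k f"
  shows "Ck n U k g"
  using assms(2,3)
proof (induction k arbitrary: f g)
  case 0
  have "continuous_on U g"
    by (rule continuous_on_eq[OF _ 0(1)]) (use 0(2) in simp)
  then show ?case by simp
next
  case (Suc k)
  have f: "continuous_on U f" "partially_differentiable_on n U f" using Suc.prems(2) by auto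
  have "continuous_on U g"
    by (rule continuous_on_eq[OF _ Suc.prems(1)]) (use f in simp_all)
  moreover have "Ck n U k (partial_deriv i g)" if "i < n" for i
  proof (rule Suc.IH)
    show "Ck n U k (partial_deriv i f)" using Suc.prems(2) that by simp
    show "partial_deriv i f x = partial_deriv i g x" if "x \<in> U" for x
      by (rule partial_deriv_cong[OF assms(1) Suc.prems(1) \<open>i < n\<close> that])
  qed
  moreover have "partially_differentiable_on n U g"
    by (rule partially_differentiable_on_cong[OF assms(1) Suc.prems(1)]) (use f in simp_all)
  ultimately show ?case by simp
qed

lemma Ck_continuous_on: "Ck n U k f \<Longrightarrow> continuous_on U f"
  by (cases k) auto

lemma Ck_SucD: "Ck n U (Suc k) f \<Longrightarrow> Ck n U k f"
  by (induction k arbitrary: f) auto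

text \<open>The form in which the inductions use the definition: any functions that are partial derivatives
  on the open set \<open>U\<close> will do, because \<^const>\<open>partial_deriv\<close> only depends on values in \<open>U\<close>.\<close>

lemma Ck_SucI:
  assumes "openin (Euclidean_space n) U" "continuous_on U f"
    "\<And>i x. i < n \<Longrightarrow> x \<in> U \<Longrightarrow> ((\<lambda>t. f (x(i := t))) has_real_derivative d i x) (at (x i))"
    "\<And>i. i < n \<Longrightarrow> Ck n U k (d i)"
  shows "Ck n U (Suc k) f"
proof -
  have "Ck n U k (partial_deriv i f)" if "i < n" for i
  proof (rule Ck_cong[OF assms(1) _ assms(4)[OF that]])
    show "d i x = partial_deriv i f x" if "x \<in> U" for x
      using partial_derivI[OF assms(3)[OF \<open>i < n\<close> that]] by simp
  qed
  then show ?thesis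
    using assms(2) partially_differentiable_onI[of n U f d] assms(3) by simp
qed

lemma smooth_on_partial_deriv:
  assumes "smooth_on n U f" "i < n"
  shows "smooth_on n U (partial_deriv i f)"
proof -
  have *: "iterated_partial is (partial_deriv i f) = iterated_partial (is @ [i]) f" for "is"
    by (simp add: iterated_partial_def)
  show ?thesis
    using assms unfolding smooth_on_def *
    by (metis Un_subset_iff bot.extremum empty_set insert_subset lessThan_iff list.simps(15) set_append)
qed

lemma smooth_on_iff_Ck: "smooth_on n U f \<longleftrightarrow> (\<forall>k. Ck n U k f)"
proof
  assume "smooth_on n U f"
  then have "Ck n U k f" for k
  proof (induction k arbitrary: f)
    case 0
    then show ?case
      by (auto simp: smooth_on_def iterated_partial_def dest: spec[where x = "[]"])
  next
    case (Suc k)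
    have "continuous_on U f \<and> partially_differentiable_on n U f"
      using Suc.prems unfolding smooth_on_def partially_differentiable_on_def
      by (auto simp: iterated_partial_def dest!: spec[where x = "[]"])
    then show ?case using Suc.IH smooth_on_partial_deriv[OF Suc.prems] by simp
  qed
  then show "\<forall>k. Ck n U k f" by blast
next
  assume f: "\<forall>k. Ck n U k f"
  have it: "\<forall>k. Ck n U k (iterated_partial is f)" if "set is \<subseteq> {..<n}" for "is"
    using that
  proof (induction "is")
    case Nil
    then show ?case using f by (simp add: iterated_partial_def)
  next
    case (Cons i "is")
    then have *: "\<forall>k. Ck n U k (iterated_partial is f)" "i < n" by auto
    have "Ck n U k (partial_deriv i (iterated_partial is f))" for k
      using *(1)[rule_format, of "Suc k"] *(2) by simp
    then show ?case by (simp add: iterated_partial_def)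
  qed
  show "smooth_on n U f"
    unfolding smooth_on_def
  proof (intro allI impI)
    fix "is" assume "set is \<subseteq> {..<n}"
    then have "Ck n U (Suc 0) (iterated_partial is f)" using it by blast
    then show "continuous_on U (iterated_partial is f) \<and>
      (\<forall>i<n. \<forall>x\<in>U. (\<lambda>t. iterated_partial is f (x(i := t))) differentiable at (x i))"
      by (simp add: partially_differentiable_on_def)
  qed
qed

lemma smooth_on_SucI: "(\<And>k. Ck n U (Suc k) f) \<Longrightarrow> smooth_on n U f"
  using Ck_SucD smooth_on_iff_Ck by blast

lemma smooth_on_cong:
  assumes "openin (Euclidean_space n) U" "\<And>x. x \<in> U \<Longrightarrow> f x = g x" "smooth_on n U f"
  shows "smooth_on n U g"
  using assms Ck_cong by (metis smooth_on_iff_Ck)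

lemma smooth_on_subset: "smooth_on n U f \<Longrightarrow> V \<subseteq> U \<Longrightarrow> smooth_on n V f"
  unfolding smooth_on_def by (meson continuous_on_subset subsetD)

lemma smooth_on_dim_mono: "smooth_on n U f \<Longrightarrow> m \<le> n \<Longrightarrow> smooth_on m U f"
  unfolding smooth_on_def by (meson lessThan_subset_iff order_less_le_trans subset_trans)

lemma smooth_on_continuous_on: "smooth_on n U f \<Longrightarrow> continuous_on U f"
  using Ck_continuous_on smooth_on_iff_Ck by blast

lemma smooth_on_partially_differentiable:
  "smooth_on n U f \<Longrightarrow> partially_differentiable_on n U f"
  using smooth_on_iff_Ck[of n U f] Ck.simps(2) by blast

lemma smooth_on_locally:
  assumes "\<And>x. x \<in> U \<Longrightarrow> \<exists>V. openin (Euclidean_space n) V \<and> x \<in> V \<and> smooth_on n V f"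
    "U \<subseteq> Rn n"
  shows "smooth_on n U f"
  unfolding smooth_on_def
proof (intro allI impI conjI ballI)
  fix "is" assume sub: "set is \<subseteq> {..<n}"
  show "continuous_on U (iterated_partial is f)"
  proof (rule continuous_on_locally[of _ "{x. \<forall>i\<ge>n. x i = 0}"])
    fix x assume "x \<in> U"
    then obtain V where "openin (Euclidean_space n) V" "x \<in> V" "smooth_on n V f"
      using assms(1) by blast
    then show "\<exists>V. openin (top_of_set {x. \<forall>i\<ge>n. x i = 0}) V \<and> x \<in> V \<and> continuous_on V (iterated_partial is f)"
      using sub unfolding smooth_on_def openin_Euclidean_space_top_of_set by blast
  qed (use assms(2) in \<open>simp add: topspace_Euclidean_space\<close>)
  fix i x assume "i < n" "x \<in> U"
  then show "(\<lambda>t. iterated_partial is f (x(i := t))) differentiable at (x i)"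
    using assms(1)[of x] sub unfolding smooth_on_def by blast
qed

lemma smooth_on_const: "smooth_on n U (\<lambda>x. c)"
proof -
  have "partial_deriv i (\<lambda>x. c) = (\<lambda>x. 0)" for i c
    by (simp add: partial_deriv_def fun_eq_iff)
  then have "Ck n U k (\<lambda>x. c)" for k c
    by (induction k arbitrary: c) (auto simp: partially_differentiable_on_def)
  then show ?thesis by (simp add: smooth_on_iff_Ck)
qed

lemma smooth_on_coord: "openin (Euclidean_space n) U \<Longrightarrow> smooth_on n U (\<lambda>x. x j)"
proof (rule smooth_on_SucI)
  fix k assume U: "openin (Euclidean_space n) U"
  show "Ck n U (Suc k) (\<lambda>x. x j)"
  proof (rule Ck_SucI[OF U, where d = "\<lambda>i x. if i = j then 1 else 0"])
    show "continuous_on U (\<lambda>x. x j)"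
      by (rule continuous_on_subset[OF continuous_on_product_coordinates]) simp
    show "((\<lambda>t. (x(i := t)) j) has_real_derivative (if i = j then 1 else 0)) (at (x i))" for i x
      by (cases "i = j") auto
    show "Ck n U k (\<lambda>x. if i = j then 1 else 0)" for i
      using smooth_on_const smooth_on_iff_Ck by blast
  qed
qed

lemma Ck_add:
  assumes "openin (Euclidean_space n) U" "Ck n U k f" "Ck n U k g"
  shows "Ck n U k (\<lambda>x. f x + g x)"
  using assms(2,3)
proof (induction k arbitrary: f g)
  case 0
  then show ?case by (simp add: continuous_on_add)
next
  case (Suc k)
  show ?case
  proof (rule Ck_SucI[OF assms(1)])
    show "continuous_on U (\<lambda>x. f x + g x)"
      using Suc.prems by (simp add: continuous_on_add)
    show "((\<lambda>t. f (x(i := t)) + g (x(i := t))) has_real_derivative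
         partial_deriv i f x + partial_deriv i g x) (at (x i))" if "i < n" "x \<in> U" for i x
      using Suc.prems that by (auto intro!: DERIV_add has_partial_deriv)
    show "Ck n U k (\<lambda>x. partial_deriv i f x + partial_deriv i g x)" if "i < n" for i
      using Suc that by simp
  qed
qed

lemma Ck_mult:
  assumes "openin (Euclidean_space n) U" "Ck n U k f" "Ck n U k g"
  shows "Ck n U k (\<lambda>x. f x * g x)"
  using assms(2,3)
proof (induction k arbitrary: f g)
  case 0
  then show ?case by (simp add: continuous_on_mult)
next
  case (Suc k)
  show ?case
  proof (rule Ck_SucI[OF assms(1)])
    show "continuous_on U (\<lambda>x. f x * g x)"
      using Suc.prems by (simp add: continuous_on_mult)
    show "((\<lambda>t. f (x(i := t)) * g (x(i := t))) has_real_derivative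
         partial_deriv i f x * g x + partial_deriv i g x * f x) (at (x i))" if "i < n" "x \<in> U" for i x
      using DERIV_mult[OF has_partial_deriv[of n U f i x] has_partial_deriv[of n U g i x]] Suc.prems that
      by simp
    show "Ck n U k (\<lambda>x. partial_deriv i f x * g x + partial_deriv i g x * f x)" if "i < n" for i
      using Suc.prems that Ck_SucD[OF Suc.prems(1)] Ck_SucD[OF Suc.prems(2)]
      by (intro Ck_add[OF assms(1)] Suc.IH) auto
  qed
qed

lemma smooth_on_add:
  "openin (Euclidean_space n) U \<Longrightarrow> smooth_on n U f \<Longrightarrow> smooth_on n U g \<Longrightarrow> smooth_on n U (\<lambda>x. f x + g x)"
  by (simp add: smooth_on_iff_Ck Ck_add)

lemma smooth_on_mult:
  "openin (Euclidean_space n) U \<Longrightarrow> smooth_on n U f \<Longrightarrow> smooth_on n U g \<Longrightarrow> smooth_on n U (\<lambda>x. f x * g x)"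
  by (simp add: smooth_on_iff_Ck Ck_mult)

lemma smooth_on_prod:
  "openin (Euclidean_space n) U \<Longrightarrow> (\<And>j. j \<in> J \<Longrightarrow> smooth_on n U (f j)) \<Longrightarrow>
    smooth_on n U (\<lambda>x. \<Prod>j\<in>J. f j x)"
  by (induction J rule: infinite_finite_induct) (auto intro: smooth_on_mult smooth_on_const)

lemma smooth_on_inverse:
  assumes U: "openin (Euclidean_space n) U" and f: "smooth_on n U f" "\<And>x. x \<in> U \<Longrightarrow> f x \<noteq> 0"
  shows "smooth_on n U (\<lambda>x. inverse (f x))"
proof -
  have cont: "continuous_on U (\<lambda>x. inverse (f x))"
    using f smooth_on_continuous_on[OF f(1)] by (auto intro: continuous_on_inverse)
  have "Ck n U k (\<lambda>x. inverse (f x))" for k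
  proof (induction k)
    case (Suc k)
    show ?case
    proof (rule Ck_SucI[OF U cont])
      show "((\<lambda>t. inverse (f (x(i := t)))) has_real_derivative
          ((-1) * partial_deriv i f x) * (inverse (f x) * inverse (f x))) (at (x i))"
        if "i < n" "x \<in> U" for i x
        using DERIV_inverse_fun[OF has_partial_deriv[OF smooth_on_partially_differentiable[OF f(1)] that]]
          f(2) that by simp
      show "Ck n U k (\<lambda>x. ((-1) * partial_deriv i f x) * (inverse (f x) * inverse (f x)))" if "i < n" for i
        using Suc.IH smooth_on_partial_deriv[OF f(1) that] smooth_on_const[of n U "-1"]
        by (intro Ck_mult[OF U]) (auto simp: smooth_on_iff_Ck)
    qed
  qed (use cont in simp)
  then show ?thesis by (simp add: smooth_on_iff_Ck)
qed

text \<open>Continuous partial derivatives give a linear approximation: go from \<open>x\<close> to \<open>y\<close> by changing one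
  coordinate at a time and apply the mean value theorem on each of the \<open>m\<close> segments.\<close>

lemma partial_linear_approximation:
  assumes V: "openin (Euclidean_space m) V" and diff: "partially_differentiable_on m V f"
    and cont: "\<And>j. j < m \<Longrightarrow> continuous_on V (partial_deriv j f)"
    and x: "x \<in> V" and "\<epsilon> > 0"
  obtains \<delta> where "\<delta> > 0"
    "\<And>y. y \<in> Rn m \<Longrightarrow> (\<And>j. j < m \<Longrightarrow> \<bar>y j - x j\<bar> < \<delta>) \<Longrightarrow>
        \<bar>f y - f x - (\<Sum>j<m. partial_deriv j f x * (y j - x j))\<bar> \<le> \<epsilon> * (\<Sum>j<m. \<bar>y j - x j\<bar>)"
proof -
  define V' where "V' = V \<inter> (\<Inter>j\<in>{..<m}. {z \<in> V. partial_deriv j f z \<in> ball (partial_deriv j f x) \<epsilon>})"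
  have "openin (Euclidean_space m) {z \<in> V. partial_deriv j f z \<in> ball (partial_deriv j f x) \<epsilon>}" if "j < m" for j
    by (rule openin_Rn_preimage[OF V cont[OF that] open_ball])
  then have "openin (Euclidean_space m) V'"
    unfolding V'_def using V
    by (cases "m = 0") (auto intro!: openin_Int openin_INT2 simp: openin_INT2)
  moreover have "x \<in> V'" using x \<open>\<epsilon> > 0\<close> by (simp add: V'_def)
  ultimately obtain \<delta> where \<delta>: "\<delta> > 0"
    "\<And>y. y \<in> Rn m \<Longrightarrow> (\<And>i. i < m \<Longrightarrow> \<bar>y i - x i\<bar> < \<delta>) \<Longrightarrow> y \<in> V'"
    using openin_Rn_box by blast
  have "\<bar>f y - f x - (\<Sum>j<m. partial_deriv j f x * (y j - x j))\<bar> \<le> \<epsilon> * (\<Sum>j<m. \<bar>y j - x j\<bar>)"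
    if y: "y \<in> Rn m" "\<And>j. j < m \<Longrightarrow> \<bar>y j - x j\<bar> < \<delta>" for y
  proof -
    have xR: "x \<in> Rn m" using x openin_Rn_subset[OF V] by blast
    \<comment> \<open>the corner after the first \<open>l\<close> coordinates have been changed\<close>
    define h where "h l = (\<lambda>i. if i < l then y i else x i)" for l :: nat
    have h0: "h 0 = x" "h m = y"
      using xR y(1) by (auto simp: h_def Rn_iff fun_eq_iff)
    have step: "\<bar>(f (h (Suc j)) - f (h j)) - partial_deriv j f x * (y j - x j)\<bar> \<le> \<epsilon> * \<bar>y j - x j\<bar>"
      if j: "j < m" for j
    proof -
      define u where "u t = f ((h j)(j := t)) - partial_deriv j f x * t" for t
      have inV: "(h j)(j := t) \<in> V'" if "t \<in> closed_segment (x j) (y j)" for t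
      proof (rule \<delta>(2))
        show "(h j)(j := t) \<in> Rn m"
          using xR y(1) j by (auto simp: h_def Rn_iff)
        have "\<bar>t - x j\<bar> \<le> \<bar>y j - x j\<bar>"
          using that by (auto simp: closed_segment_eq_real_ivl split: if_splits)
        then have "\<bar>t - x j\<bar> < \<delta>" using y(2)[OF j] by linarith
        then show "\<bar>((h j)(j := t)) i - x i\<bar> < \<delta>" if "i < m" for i
          using y(2)[OF that] \<delta>(1) by (auto simp: h_def)
      qed
      have "norm (u (y j) - u (x j)) \<le> \<epsilon> * norm (y j - x j)"
      proof (rule field_differentiable_bound[where S = "closed_segment (x j) (y j)"])
        fix t assume t: "t \<in> closed_segment (x j) (y j)"
        have "(h j)(j := t) \<in> V" using inV[OF t] by (auto simp: V'_def)
        from has_partial_deriv[OF diff j this]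
        have "((\<lambda>s. f ((h j)(j := s))) has_real_derivative partial_deriv j f ((h j)(j := t))) (at t)"
          by simp
        then have "(u has_real_derivative partial_deriv j f ((h j)(j := t)) - partial_deriv j f x) (at t)"
          unfolding u_def by (auto intro!: derivative_eq_intros)
        then show "(u has_field_derivative partial_deriv j f ((h j)(j := t)) - partial_deriv j f x)
            (at t within closed_segment (x j) (y j))"
          using has_field_derivative_at_within by blast
        show "norm (partial_deriv j f ((h j)(j := t)) - partial_deriv j f x) \<le> \<epsilon>"
          using inV[OF t] j by (auto simp: V'_def dist_real_def abs_minus_commute less_eq_real_def)
      qed auto
      moreover have "(h j)(j := y j) = h (Suc j)" "(h j)(j := x j) = h j"
        by (auto simp: h_def fun_eq_iff)
      ultimately show ?thesis
        by (simp add: u_def algebra_simps)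
    qed
    have "f y - f x - (\<Sum>j<m. partial_deriv j f x * (y j - x j))
        = (\<Sum>j<m. (f (h (Suc j)) - f (h j)) - partial_deriv j f x * (y j - x j))"
      using sum_lessThan_telescope[of "\<lambda>j. f (h j)" m] h0 by (simp add: sum_subtractf)
    also have "\<bar>\<dots>\<bar> \<le> (\<Sum>j<m. \<epsilon> * \<bar>y j - x j\<bar>)"
      by (rule order_trans[OF sum_abs sum_mono]) (use step in auto)
    finally show ?thesis by (simp add: sum_distrib_left)
  qed
  then show ?thesis using that \<delta>(1) by blast
qed

text \<open>After subtracting the linear part, the composition has derivative 0, since the error in
  \<open>partial_linear_approximation\<close> is an arbitrarily small multiple of the increment of \<open>\<gamma>\<close>, which is
  at most \<open>K * \<bar>t - t\<^sub>0\<bar>\<close>.\<close>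

lemma chain_rule_curve:
  assumes V: "openin (Euclidean_space m) V" and diff: "partially_differentiable_on m V f"
    and cont: "\<And>j. j < m \<Longrightarrow> continuous_on V (partial_deriv j f)"
    and \<gamma>V: "\<forall>\<^sub>F t in nhds t\<^sub>0. \<gamma> t \<in> V"
    and \<gamma>: "\<And>j. j < m \<Longrightarrow> ((\<lambda>t. \<gamma> t j) has_real_derivative d j) (at t\<^sub>0)"
  shows "((\<lambda>t. f (\<gamma> t)) has_real_derivative (\<Sum>j<m. partial_deriv j f (\<gamma> t\<^sub>0) * d j)) (at t\<^sub>0)"
proof -
  let ?x = "\<gamma> t\<^sub>0"
  have x: "?x \<in> V" using \<gamma>V eventually_nhds_x_imp_x by blast
  define R where "R t = f (\<gamma> t) - (\<Sum>j<m. partial_deriv j f ?x * \<gamma> t j)" for t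
  \<comment> \<open>the last summand makes \<open>K\<close> positive also for \<open>m = 0\<close>\<close>
  define K where "K = (\<Sum>j<m. \<bar>d j\<bar> + 1) + 1"
  have K: "K > 0" unfolding K_def
    by (rule add_nonneg_pos) (auto intro: sum_nonneg)
  have lip: "\<forall>\<^sub>F t in at t\<^sub>0. \<bar>\<gamma> t j - ?x j\<bar> \<le> (\<bar>d j\<bar> + 1) * \<bar>t - t\<^sub>0\<bar>" if "j < m" for j
  proof -
    have "tendsto (\<lambda>t. (\<gamma> t j - ?x j) / (t - t\<^sub>0)) (d j) (at t\<^sub>0)"
      using \<gamma>[OF that] by (simp add: has_field_derivative_iff)
    then have "\<forall>\<^sub>F t in at t\<^sub>0. dist ((\<gamma> t j - ?x j) / (t - t\<^sub>0)) (d j) < 1"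
      by (rule tendstoD) simp
    moreover have "\<forall>\<^sub>F t in at t\<^sub>0. t \<noteq> t\<^sub>0"
      by (simp add: eventually_at_filter)
    ultimately show ?thesis
    proof eventually_elim
      case (elim t)
      have "\<bar>(\<gamma> t j - ?x j) / (t - t\<^sub>0)\<bar> \<le> \<bar>d j\<bar> + 1"
        using elim(1) unfolding dist_real_def by linarith
      then show ?case using elim(2) by (simp add: abs_divide divide_simps)
    qed
  qed
  have close: "\<forall>\<^sub>F t in at t\<^sub>0. \<forall>j<m. \<bar>\<gamma> t j - ?x j\<bar> < \<delta>" if "\<delta> > 0" for \<delta>
  proof -
    have "\<forall>\<^sub>F t in at t\<^sub>0. \<bar>\<gamma> t j - ?x j\<bar> < \<delta>" if "j < m" for j
    proof -
      have "tendsto (\<lambda>t. \<gamma> t j) (?x j) (at t\<^sub>0)"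
        using DERIV_isCont[OF \<gamma>[OF that]] by (simp add: isCont_def)
      from tendstoD[OF this \<open>\<delta> > 0\<close>] show ?thesis by (simp add: dist_real_def)
    qed
    then have "\<forall>\<^sub>F t in at t\<^sub>0. \<forall>j\<in>{..<m}. \<bar>\<gamma> t j - ?x j\<bar> < \<delta>"
      by (intro eventually_ball_finite) auto
    then show ?thesis by (simp add: Ball_def lessThan_iff)
  qed
  have "(R has_real_derivative 0) (at t\<^sub>0)"
    unfolding has_field_derivative_iff
  proof (rule tendstoI)
    fix e :: real assume "e > 0"
    define \<epsilon> where "\<epsilon> = e / (2 * K)"
    have \<epsilon>: "\<epsilon> > 0" using \<open>e > 0\<close> K by (simp add: \<epsilon>_def)
    obtain \<delta> where \<delta>: "\<delta> > 0" "\<And>y. y \<in> Rn m \<Longrightarrow> (\<And>j. j < m \<Longrightarrow> \<bar>y j - ?x j\<bar> < \<delta>) \<Longrightarrow>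
        \<bar>f y - f ?x - (\<Sum>j<m. partial_deriv j f ?x * (y j - ?x j))\<bar> \<le> \<epsilon> * (\<Sum>j<m. \<bar>y j - ?x j\<bar>)"
      using partial_linear_approximation[OF V diff cont x \<epsilon>] by blast
    have lip': "\<forall>\<^sub>F t in at t\<^sub>0. \<forall>j\<in>{..<m}. \<bar>\<gamma> t j - ?x j\<bar> \<le> (\<bar>d j\<bar> + 1) * \<bar>t - t\<^sub>0\<bar>"
      using lip by (intro eventually_ball_finite) auto
    have "\<forall>\<^sub>F t in at t\<^sub>0. \<gamma> t \<in> V"
      using \<gamma>V by (simp add: eventually_at_filter eventually_mono)
    moreover have "\<forall>\<^sub>F t in at t\<^sub>0. t \<noteq> t\<^sub>0"
      by (simp add: eventually_at_filter)
    ultimately show "\<forall>\<^sub>F t in at t\<^sub>0. dist ((R t - R t\<^sub>0) / (t - t\<^sub>0)) 0 < e"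
      using lip' close[OF \<delta>(1)]
    proof eventually_elim
      case (elim t)
      have "\<gamma> t \<in> Rn m" using elim openin_Rn_subset[OF V] by blast
      then have "\<bar>f (\<gamma> t) - f ?x - (\<Sum>j<m. partial_deriv j f ?x * (\<gamma> t j - ?x j))\<bar>
          \<le> \<epsilon> * (\<Sum>j<m. \<bar>\<gamma> t j - ?x j\<bar>)"
        using \<delta>(2) elim by blast
      then have "\<bar>R t - R t\<^sub>0\<bar> \<le> \<epsilon> * (\<Sum>j<m. \<bar>\<gamma> t j - ?x j\<bar>)"
        by (simp add: R_def algebra_simps sum_subtractf)
      also have "\<dots> \<le> \<epsilon> * (\<Sum>j<m. (\<bar>d j\<bar> + 1) * \<bar>t - t\<^sub>0\<bar>)"
        using elim \<epsilon> by (intro mult_left_mono sum_mono) auto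
      also have "\<dots> \<le> \<epsilon> * (K * \<bar>t - t\<^sub>0\<bar>)"
        using \<epsilon> unfolding K_def sum_distrib_right[symmetric]
        by (intro mult_left_mono mult_right_mono) auto
      finally have "\<bar>R t - R t\<^sub>0\<bar> \<le> (e / 2) * \<bar>t - t\<^sub>0\<bar>"
        using K by (simp add: \<epsilon>_def)
      then have "\<bar>(R t - R t\<^sub>0) / (t - t\<^sub>0)\<bar> \<le> e / 2"
        using elim by (simp add: abs_divide divide_simps)
      then show ?case using \<open>e > 0\<close> unfolding dist_real_def by linarith
    qed
  qed
  moreover have "((\<lambda>t. \<Sum>j<m. partial_deriv j f ?x * \<gamma> t j) has_real_derivative
      (\<Sum>j<m. partial_deriv j f ?x * d j)) (at t\<^sub>0)"
    using \<gamma> by (intro DERIV_sum DERIV_cmult) auto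
  ultimately have "((\<lambda>t. R t + (\<Sum>j<m. partial_deriv j f ?x * \<gamma> t j)) has_real_derivative
      0 + (\<Sum>j<m. partial_deriv j f ?x * d j)) (at t\<^sub>0)"
    by (rule DERIV_add)
  then show ?thesis by (simp add: R_def)
qed

lemma partial_chain_rule:
  assumes U: "openin (Euclidean_space n) U" and V: "openin (Euclidean_space m) V"
    and \<Phi>: "\<And>x. x \<in> U \<Longrightarrow> \<Phi> x \<in> V" "\<And>j. j < m \<Longrightarrow> partially_differentiable_on n U (\<lambda>x. \<Phi> x j)"
    and f: "Ck m V (Suc k) f" and x: "x \<in> U" "i < n"
  shows "((\<lambda>t. f (\<Phi> (x(i := t)))) has_real_derivative
      (\<Sum>j<m. partial_deriv j f (\<Phi> x) * partial_deriv i (\<lambda>x. \<Phi> x j) x)) (at (x i))"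
proof -
  have "\<forall>\<^sub>F t in nhds (x i). \<Phi> (x(i := t)) \<in> V"
    using openin_Rn_update[OF U x] \<Phi>(1) by (auto elim: eventually_mono)
  then have "((\<lambda>t. f (\<Phi> (x(i := t)))) has_real_derivative
      (\<Sum>j<m. partial_deriv j f (\<Phi> (x(i := x i))) * partial_deriv i (\<lambda>x. \<Phi> x j) x)) (at (x i))"
  proof (rule chain_rule_curve[OF V, where \<gamma> = "\<lambda>t. \<Phi> (x(i := t))", rotated 2])
    show "((\<lambda>t. \<Phi> (x(i := t)) j) has_real_derivative partial_deriv i (\<lambda>x. \<Phi> x j) x) (at (x i))"
      if "j < m" for j
      using has_partial_deriv[OF \<Phi>(2)[OF that] x(2,1)] .
  qed (use f in \<open>auto intro: Ck_continuous_on\<close>)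
  then show ?thesis by simp
qed

lemma Ck_sum:
  "openin (Euclidean_space n) U \<Longrightarrow> (\<And>j. j \<in> J \<Longrightarrow> Ck n U k (f j)) \<Longrightarrow>
    Ck n U k (\<lambda>x. \<Sum>j\<in>J. f j x)"
proof (induction J rule: infinite_finite_induct)
  case (insert j J)
  then show ?case by (simp add: Ck_add)
qed (use smooth_on_const smooth_on_iff_Ck in \<open>auto\<close>)

lemma smooth_on_compose:
  assumes U: "openin (Euclidean_space n) U" and V: "openin (Euclidean_space m) V"
    and \<Phi>: "\<And>x. x \<in> U \<Longrightarrow> \<Phi> x \<in> V" "\<And>j. j < m \<Longrightarrow> smooth_on n U (\<lambda>x. \<Phi> x j)"
    and f: "smooth_on m V f"
  shows "smooth_on n U (\<lambda>x. f (\<Phi> x))"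
proof -
  have "continuous_on U (\<lambda>x. \<Phi> x j)" for j
  proof (cases "j < m")
    case False
    then have "\<Phi> x j = 0" if "x \<in> U" for x
      using \<Phi>(1)[OF that] openin_Rn_subset[OF V] by (auto simp: Rn_iff)
    then show ?thesis using continuous_on_eq[of U "\<lambda>x. 0" "\<lambda>x. \<Phi> x j"] by simp
  qed (use \<Phi> smooth_on_continuous_on in blast)
  then have cont\<Phi>: "continuous_on U \<Phi>"
    by (rule continuous_on_coordinatewise_then_product)
  have cont: "continuous_on U (\<lambda>x. f (\<Phi> x))" if "Ck m V k f" for k f
    using continuous_on_compose2[OF Ck_continuous_on[OF that] cont\<Phi>] \<Phi>(1) by blast
  have "Ck n U k (\<lambda>x. f (\<Phi> x))" if "\<And>k. Ck m V k f" for k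
    using that
  proof (induction k arbitrary: f)
    case 0
    then show ?case using cont by simp
  next
    case (Suc k)
    show ?case
    proof (rule Ck_SucI[OF U])
      show "continuous_on U (\<lambda>x. f (\<Phi> x))" using cont Suc.prems by blast
      show "((\<lambda>t. f (\<Phi> (x(i := t)))) has_real_derivative
          (\<Sum>j<m. partial_deriv j f (\<Phi> x) * partial_deriv i (\<lambda>x. \<Phi> x j) x)) (at (x i))"
        if "i < n" "x \<in> U" for i x
        by (rule partial_chain_rule[OF U V \<Phi>(1) smooth_on_partially_differentiable[OF \<Phi>(2)]
              Suc.prems[of "Suc 0"] that(2,1)])
      have "Ck m V l (partial_deriv j f)" if "j < m" for j l
        using Suc.prems[of "Suc l"] that by simp
      moreover have "Ck n U k (partial_deriv i (\<lambda>x. \<Phi> x j))" if "j < m" "i < n" for i j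
        using smooth_on_partial_deriv[OF \<Phi>(2)] that smooth_on_iff_Ck by blast
      ultimately show "Ck n U k (\<lambda>x. \<Sum>j<m. partial_deriv j f (\<Phi> x) * partial_deriv i (\<lambda>x. \<Phi> x j) x)"
        if "i < n" for i
        using Suc.IH that by (intro Ck_sum[OF U] Ck_mult[OF U]) auto
    qed
  qed
  then show ?thesis using f by (simp add: smooth_on_iff_Ck)
qed

text \<open>The second difference over a square of side \<open>s\<close> is, by the mean value theorem in each direction,
  \<open>s\<^sup>2\<close> times a mixed second derivative at a point of the square. The second difference is symmetric
  in the two directions; this yields the symmetry of second derivatives.\<close>

lemma second_difference_mvt:
  fixes f x i j
  defines "P \<equiv> \<lambda>a b. x(i := x i + a, j := x j + b)"
  assumes "partially_differentiable_on n U f" "partially_differentiable_on n U (partial_deriv i f)"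
    and "i < n" "j < n" "i \<noteq> j" "s > 0"
    and PU: "\<And>a b. 0 \<le> a \<Longrightarrow> a \<le> s \<Longrightarrow> 0 \<le> b \<Longrightarrow> b \<le> s \<Longrightarrow> P a b \<in> U"
  obtains a b where "0 < a" "a < s" "0 < b" "b < s"
    "f (P s s) - f (P s 0) - f (P 0 s) + f (P 0 0) = s * s * partial_deriv j (partial_deriv i f) (P a b)"
proof -
  have di: "((\<lambda>a. f (P a b)) has_real_derivative partial_deriv i f (P a b)) (at a)"
    if "P a b \<in> U" for a b
  proof -
    have "((\<lambda>t. f ((P a b)(i := t))) has_real_derivative partial_deriv i f (P a b)) (at (P a b i))"
      using assms that by (intro has_partial_deriv)
    then have "((\<lambda>t. f ((P a b)(i := t))) has_real_derivative partial_deriv i f (P a b)) (at (x i + a))"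
      using \<open>i \<noteq> j\<close> by (simp add: P_def)
    then have "((\<lambda>t. f ((P a b)(i := x i + t))) has_real_derivative partial_deriv i f (P a b)) (at a)"
      using DERIV_shift[of "\<lambda>t. f ((P a b)(i := t))" _ a "x i"] by (simp add: add.commute)
    moreover have "(P a b)(i := x i + t) = P t b" for t
      using \<open>i \<noteq> j\<close> by (auto simp: P_def)
    ultimately show ?thesis by simp
  qed
  have dj: "((\<lambda>b. partial_deriv i f (P a b)) has_real_derivative
      partial_deriv j (partial_deriv i f) (P a b)) (at b)" if "P a b \<in> U" for a b
  proof -
    have "((\<lambda>t. partial_deriv i f ((P a b)(j := t))) has_real_derivative
        partial_deriv j (partial_deriv i f) (P a b)) (at (P a b j))"
      using assms that by (intro has_partial_deriv)
    then have "((\<lambda>t. partial_deriv i f ((P a b)(j := t))) has_real_derivative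
        partial_deriv j (partial_deriv i f) (P a b)) (at (x j + b))"
      by (simp add: P_def)
    then have "((\<lambda>t. partial_deriv i f ((P a b)(j := x j + t))) has_real_derivative
        partial_deriv j (partial_deriv i f) (P a b)) (at b)"
      using DERIV_shift[of "\<lambda>t. partial_deriv i f ((P a b)(j := t))" _ b "x j"] by (simp add: add.commute)
    moreover have "(P a b)(j := x j + t) = P a t" for t
      by (auto simp: P_def)
    ultimately show ?thesis by simp
  qed
  have "\<exists>a>0. a < s \<and> (f (P s s) - f (P s 0)) - (f (P 0 s) - f (P 0 0)) =
      (s - 0) * (partial_deriv i f (P a s) - partial_deriv i f (P a 0))"
    by (rule MVT2) (use \<open>s > 0\<close> PU di in \<open>auto intro!: DERIV_diff\<close>)
  then obtain a where a: "0 < a" "a < s" "(f (P s s) - f (P s 0)) - (f (P 0 s) - f (P 0 0)) =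
      (s - 0) * (partial_deriv i f (P a s) - partial_deriv i f (P a 0))" by blast
  have "\<exists>b>0. b < s \<and> partial_deriv i f (P a s) - partial_deriv i f (P a 0) =
      (s - 0) * partial_deriv j (partial_deriv i f) (P a b)"
    by (rule MVT2) (use \<open>s > 0\<close> PU dj a in auto)
  then show ?thesis using a that by (auto simp: algebra_simps)
qed

lemma partial_deriv_commute:
  assumes U: "openin (Euclidean_space n) U" and f: "smooth_on n U f" and x: "x \<in> U"
    and ij: "i < n" "j < n"
  shows "partial_deriv j (partial_deriv i f) x = partial_deriv i (partial_deriv j f) x"
proof (cases "i = j")
  case False
  let ?A = "partial_deriv j (partial_deriv i f)" and ?B = "partial_deriv i (partial_deriv j f)"
  have sA: "smooth_on n U ?A" and sB: "smooth_on n U ?B"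
    using f ij smooth_on_partial_deriv by blast+
  have "\<bar>?A x - ?B x\<bar> \<le> e" if "e > 0" for e
  proof -
    define V where "V = {z \<in> U. ?A z \<in> ball (?A x) (e/2)} \<inter> {z \<in> U. ?B z \<in> ball (?B x) (e/2)}"
    have "openin (Euclidean_space n) {z \<in> U. h z \<in> ball (h x) (e/2)}" if "smooth_on n U h" for h
      by (rule openin_Rn_preimage[OF U smooth_on_continuous_on[OF that] open_ball])
    then have "openin (Euclidean_space n) V"
      unfolding V_def using sA sB by blast
    moreover have "x \<in> V" using x \<open>e > 0\<close> by (simp add: V_def)
    ultimately obtain \<delta> where \<delta>: "\<delta> > 0"
      "\<And>y. y \<in> Rn n \<Longrightarrow> (\<And>i. i < n \<Longrightarrow> \<bar>y i - x i\<bar> < \<delta>) \<Longrightarrow> y \<in> V"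
      using openin_Rn_box by blast
    define s where "s = \<delta> / 2"
    have s: "s > 0" "s < \<delta>" using \<delta> by (auto simp: s_def)
    have xR: "x \<in> Rn n" using x openin_Rn_subset[OF U] by blast
    have PV: "x(i := x i + a, j := x j + b) \<in> V" if "0 \<le> a" "a \<le> s" "0 \<le> b" "b \<le> s" for a b
      by (rule \<delta>(2)) (use xR ij that s \<delta>(1) in \<open>auto simp: Rn_iff\<close>)
    have PV': "x(j := x j + b, i := x i + a) \<in> V" if "0 \<le> a" "a \<le> s" "0 \<le> b" "b \<le> s" for a b
      using PV[OF that] False by (simp add: fun_upd_twist)
    have VU: "V \<subseteq> U" by (auto simp: V_def)
    have pd: "partially_differentiable_on n U f" "partially_differentiable_on n U (partial_deriv i f)"
      "partially_differentiable_on n U (partial_deriv j f)"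
      using f ij smooth_on_partial_deriv smooth_on_partially_differentiable by blast+
    obtain a b where ab: "0 < a" "a < s" "0 < b" "b < s"
      "f (x(i := x i + s, j := x j + s)) - f (x(i := x i + s, j := x j + 0))
        - f (x(i := x i + 0, j := x j + s)) + f (x(i := x i + 0, j := x j + 0))
        = s * s * ?A (x(i := x i + a, j := x j + b))"
      using second_difference_mvt[OF pd(1,2) ij False s(1), of x] PV VU by blast
    obtain a' b' where ab': "0 < a'" "a' < s" "0 < b'" "b' < s"
      "f (x(j := x j + s, i := x i + s)) - f (x(j := x j + s, i := x i + 0))
        - f (x(j := x j + 0, i := x i + s)) + f (x(j := x j + 0, i := x i + 0))
        = s * s * ?B (x(j := x j + a', i := x i + b'))"
      using second_difference_mvt[OF pd(1,3) ij(2,1) False[symmetric] s(1), of x] PV' VU by blast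
    have "s * s * ?A (x(i := x i + a, j := x j + b)) = s * s * ?B (x(j := x j + a', i := x i + b'))"
      unfolding ab(5)[symmetric] ab'(5)[symmetric] using False by (simp add: fun_upd_twist)
    then have "?A (x(i := x i + a, j := x j + b)) = ?B (x(j := x j + a', i := x i + b'))"
      using s by simp
    moreover have "\<bar>?A x - ?A (x(i := x i + a, j := x j + b))\<bar> < e / 2"
      using PV[of a b] ab by (auto simp: V_def dist_real_def)
    moreover have "\<bar>?B x - ?B (x(j := x j + a', i := x i + b'))\<bar> < e / 2"
      using PV'[of b' a'] ab' by (auto simp: V_def dist_real_def)
    ultimately show ?thesis by linarith
  qed
  then have "\<bar>?A x - ?B x\<bar> \<le> 0" by (rule field_le_epsilon) simp
  then show ?thesis by simp
qed simp


section \<open>Bump functions\<close>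

text \<open>The classical smooth function that vanishes for \<open>t \<le> 0\<close>, together with its multiples by powers
  of \<open>1 / t\<close>: the derivative of a member of this family is a combination of two others
  (\<open>DERIV_flat_exp\<close>), so all of them are smooth by one induction.\<close>

definition flat_exp :: "nat \<Rightarrow> real \<Rightarrow> real" where
  "flat_exp k t = (if t > 0 then inverse t ^ k * exp (- inverse t) else 0)"

lemma flat_exp_tendsto_0: "tendsto (flat_exp k) 0 (at 0)"
proof -
  have "((\<lambda>u::real. u ^ k * exp (- u)) \<longlongrightarrow> 0) at_top"
    using tendsto_power_div_exp_0[of k] by (simp add: exp_minus divide_inverse)
  then have "tendsto (\<lambda>t::real. inverse t ^ k * exp (- inverse t)) 0 (at_right 0)"
    using filterlim_compose filterlim_inverse_at_top_right by blast
  then have "tendsto (flat_exp k) 0 (at_right 0)"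
  proof (rule Lim_transform_eventually)
    show "\<forall>\<^sub>F t in at_right 0. inverse t ^ k * exp (- inverse t) = flat_exp k t"
      unfolding eventually_at_right_field by (auto simp: flat_exp_def intro: exI[of _ 1])
  qed
  moreover have "tendsto (flat_exp k) 0 (at_left 0)"
  proof (rule Lim_transform_eventually[OF tendsto_const])
    show "\<forall>\<^sub>F t in at_left 0. 0 = flat_exp k t"
      unfolding eventually_at_left_field by (auto simp: flat_exp_def intro: exI[of _ "-1"])
  qed
  ultimately show ?thesis
    by (simp add: filterlim_at_split)
qed

lemma DERIV_flat_exp: "(flat_exp k has_real_derivative flat_exp (k + 2) t - real k * flat_exp (Suc k) t) (at t)"
proof (cases "t = 0")
  case True
  have "(flat_exp k has_real_derivative 0) (at 0)"
    unfolding has_field_derivative_iff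
  proof (rule Lim_transform_eventually[OF flat_exp_tendsto_0[of "Suc k"]])
    show "\<forall>\<^sub>F h in at 0. flat_exp (Suc k) h = (flat_exp k h - flat_exp k 0) / (h - 0)"
      by (auto simp: flat_exp_def eventually_at_filter divide_inverse)
  qed
  then show ?thesis using True by (simp add: flat_exp_def)
next
  case False
  then consider "t > 0" | "t < 0" by linarith
  then show ?thesis
  proof cases
    case 1
    have "((\<lambda>t. inverse t ^ k * exp (- inverse t)) has_real_derivative
        flat_exp (k + 2) t - real k * flat_exp (Suc k) t) (at t)"
    proof -
      have inv: "((\<lambda>t. inverse t) has_real_derivative - (inverse t * inverse t)) (at t)"
        using DERIV_inverse[of t] 1 by (simp add: numeral_2_eq_2)
      have eq: "real k * (- (inverse t * inverse t) * inverse t ^ (k - Suc 0)) = - real k * inverse t ^ Suc k"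
        by (cases k) (auto simp: algebra_simps)
      have "((\<lambda>t. inverse t ^ k * exp (- inverse t)) has_real_derivative
          - real k * inverse t ^ Suc k * exp (- inverse t) + exp (- inverse t) * (inverse t * inverse t) * inverse t ^ k)
          (at t)"
        using DERIV_mult[OF DERIV_power[OF inv, of k, unfolded eq] DERIV_chain2[OF DERIV_exp DERIV_minus[OF inv]]]
        by simp
      then show ?thesis
        using 1 by (simp add: flat_exp_def algebra_simps)
    qed
    then show ?thesis
      by (rule has_field_derivative_transform_within_open[of _ _ _ "{0<..}"])
        (use 1 in \<open>auto simp: flat_exp_def\<close>)
  next
    case 2
    have "((\<lambda>t. 0) has_real_derivative flat_exp (k + 2) t - real k * flat_exp (Suc k) t) (at t)"
      using 2 by (simp add: flat_exp_def)
    then show ?thesis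
      by (rule has_field_derivative_transform_within_open[of _ _ _ "{..<0}"])
        (use 2 in \<open>auto simp: flat_exp_def\<close>)
  qed
qed

lemma smooth_on_flat_exp:
  assumes U: "openin (Euclidean_space n) U" and h: "smooth_on n U h"
  shows "smooth_on n U (\<lambda>x. flat_exp k (h x))"
proof -
  have cont: "continuous_on U (\<lambda>x. flat_exp k (h x))" for k
  proof (rule continuous_on_compose2[OF _ smooth_on_continuous_on[OF h]])
    show "continuous_on UNIV (flat_exp k)"
      by (rule continuous_at_imp_continuous_on) (simp add: DERIV_isCont[OF DERIV_flat_exp])
  qed simp
  have "Ck n U r (\<lambda>x. flat_exp k (h x))" for r
  proof (induction r arbitrary: k)
    case (Suc r)
    show ?case
    proof (rule Ck_SucI[OF U cont])
      show "((\<lambda>t. flat_exp k (h (x(i := t)))) has_real_derivative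
          (flat_exp (k + 2) (h x) + (- real k) * flat_exp (Suc k) (h x)) * partial_deriv i h x) (at (x i))"
        if "i < n" "x \<in> U" for i x
        using DERIV_chain2[OF DERIV_flat_exp has_partial_deriv[OF smooth_on_partially_differentiable[OF h] that], of k]
        by simp
      show "Ck n U r (\<lambda>x. (flat_exp (k + 2) (h x) + (- real k) * flat_exp (Suc k) (h x)) * partial_deriv i h x)"
        if "i < n" for i
        using smooth_on_partial_deriv[OF h that] smooth_on_const[of n U "- real k"]
        unfolding smooth_on_iff_Ck by (intro Ck_mult[OF U] Ck_add[OF U] Suc.IH) auto
    qed
  qed (use cont in simp)
  then show ?thesis by (simp add: smooth_on_iff_Ck)
qed

text \<open>Equal to 1 for \<open>\<bar>s\<bar> \<le> 1/2\<close> and to 0 for \<open>\<bar>s\<bar> \<ge> 1\<close>. The denominator is positive because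
  \<open>1 - s\<^sup>2\<close> and \<open>s\<^sup>2 - 1/4\<close> are never both nonpositive.\<close>

definition bump :: "real \<Rightarrow> real" where
  "bump s = flat_exp 0 (1 - s\<^sup>2) * inverse (flat_exp 0 (1 - s\<^sup>2) + flat_exp 0 (s\<^sup>2 - 1/4))"

lemma smooth_on_bump:
  assumes U: "openin (Euclidean_space n) U" and h: "smooth_on n U h"
  shows "smooth_on n U (\<lambda>x. bump (h x))"
proof -
  have "smooth_on n U (\<lambda>x. (- 1) * (h x * h x) + 1)" "smooth_on n U (\<lambda>x. h x * h x + (- 1/4))"
    by (intro smooth_on_add[OF U] smooth_on_mult[OF U] smooth_on_const h)+
  then have "smooth_on n U (\<lambda>x. 1 - (h x)\<^sup>2)" "smooth_on n U (\<lambda>x. (h x)\<^sup>2 - 1/4)"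
    by (simp_all add: power2_eq_square algebra_simps)
  moreover have "flat_exp 0 (1 - s\<^sup>2) + flat_exp 0 (s\<^sup>2 - 1/4) \<noteq> 0" for s
    by (auto simp: flat_exp_def add_pos_pos less_imp_neq[THEN not_sym])
  ultimately show ?thesis
    unfolding bump_def
    by (intro smooth_on_mult[OF U] smooth_on_inverse[OF U] smooth_on_add[OF U] smooth_on_flat_exp[OF U])
qed

lemma bump_eq_1: "\<bar>s\<bar> \<le> 1 / 2 \<Longrightarrow> bump s = 1"
proof -
  assume "\<bar>s\<bar> \<le> 1 / 2"
  then have "s\<^sup>2 \<le> (1 / 2)\<^sup>2" by (metis abs_ge_zero power2_abs power_mono)
  then show ?thesis by (simp add: bump_def flat_exp_def power2_eq_square)
qed

lemma bump_nonzeroD: "bump s \<noteq> 0 \<Longrightarrow> \<bar>s\<bar> < 1"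
  by (simp add: bump_def flat_exp_def abs_square_less_1 split: if_splits)

lemma exists_box_bump:
  assumes "\<delta> > 0"
  obtains b where "smooth_on n (Rn n) b"
    "\<And>x. (\<And>i. i < n \<Longrightarrow> \<bar>x i - a i\<bar> \<le> \<delta> / 2) \<Longrightarrow> b x = 1"
    "\<And>x i. b x \<noteq> 0 \<Longrightarrow> i < n \<Longrightarrow> \<bar>x i - a i\<bar> < \<delta>"
proof
  define b where "b x = (\<Prod>i<n. bump (inverse \<delta> * (x i + (- a i))))" for x :: "nat \<Rightarrow> real"
  have R: "openin (Euclidean_space n) (Rn n)" by simp
  show "smooth_on n (Rn n) b"
    unfolding b_def
    by (intro smooth_on_prod[OF R] smooth_on_bump[OF R] smooth_on_mult[OF R] smooth_on_add[OF R]
        smooth_on_const smooth_on_coord[OF R])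
  show "b x = 1" if "\<And>i. i < n \<Longrightarrow> \<bar>x i - a i\<bar> \<le> \<delta> / 2" for x
    using that assms by (auto simp: b_def abs_mult field_simps intro!: prod.neutral bump_eq_1)
  show "\<bar>x i - a i\<bar> < \<delta>" if "b x \<noteq> 0" "i < n" for x i
  proof -
    have "bump (inverse \<delta> * (x i + (- a i))) \<noteq> 0"
      using that by (auto simp: b_def)
    from bump_nonzeroD[OF this] show ?thesis
      using assms by (simp add: abs_mult field_simps)
  qed
qed

lemma compactin_box: "compactin (Euclidean_space n) {x \<in> Rn n. \<forall>i<n. \<bar>x i - a i\<bar> \<le> \<delta>}"
proof -
  have *: "{x \<in> Rn n. \<forall>i<n. \<bar>x i - a i\<bar> \<le> \<delta>} = Pi\<^sub>E UNIV (\<lambda>i. if i < n then cball (a i) \<delta> else {0})"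
    by (auto simp: Rn_iff PiE_UNIV_domain Pi_iff dist_real_def abs_minus_commute split: if_splits)
  have "compactin (powertop_real UNIV) (Pi\<^sub>E UNIV (\<lambda>i. if i < n then cball (a i) \<delta> else {0}))"
    unfolding compactin_PiE by auto
  then show ?thesis
    unfolding *[symmetric] Euclidean_space_def compactin_subtopology
    by (auto simp: topspace_Euclidean_space)
qed


section \<open>Charts and smooth functions on a manifold\<close>

text \<open>The coordinates with index at least \<open>n\<close> vanish identically and the others are smooth.\<close>

lemma smooth_transition_continuous:
  assumes "smooth_transition n (D, \<phi>) (D', \<phi>')" "\<phi>' ` D' \<subseteq> Rn n" "inj_on \<phi> D"
  shows "continuous_on (\<phi> ` (D \<inter> D')) (\<lambda>x. \<phi>' (inv_into D \<phi> x))"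
proof (rule continuous_on_coordinatewise_then_product)
  fix i
  show "continuous_on (\<phi> ` (D \<inter> D')) (\<lambda>x. \<phi>' (inv_into D \<phi> x) i)"
  proof (cases "i < n")
    case True
    then show ?thesis
      using assms(1) smooth_on_continuous_on by (auto simp: smooth_transition_def)
  next
    case False
    have "\<phi>' (inv_into D \<phi> x) i = 0" if "x \<in> \<phi> ` (D \<inter> D')" for x
      using that assms(2,3) False by (auto simp: Rn_iff subset_iff)
    then show ?thesis
      using continuous_on_eq[of "\<phi> ` (D \<inter> D')" "\<lambda>x. 0"] by simp
  qed
qed

lemma smooth_transition_preimage:
  assumes t: "smooth_transition n (D, \<phi>) (D', \<phi>')" and R: "\<phi>' ` D' \<subseteq> Rn n" and inj: "inj_on \<phi> D"
    and W: "openin (Euclidean_space n) W"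
  shows "openin (Euclidean_space n) {x \<in> \<phi> ` (D \<inter> D'). \<phi>' (inv_into D \<phi> x) \<in> W}"
proof -
  obtain T where T: "open T" "W = Rn n \<inter> T"
    using W unfolding openin_Euclidean_space by blast
  have "openin (Euclidean_space n) (\<phi> ` (D \<inter> D'))"
    using t by (simp add: smooth_transition_def)
  then have "openin (Euclidean_space n) {x \<in> \<phi> ` (D \<inter> D'). \<phi>' (inv_into D \<phi> x) \<in> T}"
    by (rule openin_Rn_preimage[OF _ smooth_transition_continuous[OF t R inj] T(1)])
  moreover have "{x \<in> \<phi> ` (D \<inter> D'). \<phi>' (inv_into D \<phi> x) \<in> T}
      = {x \<in> \<phi> ` (D \<inter> D'). \<phi>' (inv_into D \<phi> x) \<in> W}"
    using inj R T(2) by (auto simp: subset_iff)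
  ultimately show ?thesis by simp
qed

lemma smooth_on_transition:
  assumes t: "smooth_transition n (D, \<phi>) (D', \<phi>')" and R: "\<phi>' ` D' \<subseteq> Rn n"
    and inj: "inj_on \<phi> D" "inj_on \<phi>' D'"
    and W: "openin (Euclidean_space n) W" and f: "smooth_on n W (f \<circ> inv_into D' \<phi>')"
  shows "smooth_on n {x \<in> \<phi> ` (D \<inter> D'). \<phi>' (inv_into D \<phi> x) \<in> W} (f \<circ> inv_into D \<phi>)"
    (is "smooth_on n ?W' _")
proof -
  have W': "openin (Euclidean_space n) ?W'"
    by (rule smooth_transition_preimage[OF t R inj(1) W])
  have "smooth_on n ?W' (\<lambda>x. (f \<circ> inv_into D' \<phi>') (\<phi>' (inv_into D \<phi> x)))"
  proof (rule smooth_on_compose[OF W' W _ _ f])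
    show "smooth_on n ?W' (\<lambda>x. \<phi>' (inv_into D \<phi> x) j)" if "j < n" for j
      by (rule smooth_on_subset[of _ "\<phi> ` (D \<inter> D')"]) (use t that in \<open>auto simp: smooth_transition_def\<close>)
  qed auto
  then show ?thesis
    by (rule smooth_on_cong[OF W', rotated]) (use inj in auto)
qed

text \<open>The part of \<^const>\<open>smooth_manifold\<close> that concerns the atlas alone. It suffices for the calculus of
  tangent vectors; the Hausdorff property enters only with bump functions.\<close>

locale smooth_structure =
  fixes M :: "'a mfd"
  assumes chart_subset: "(D, \<phi>) \<in> atlas M \<Longrightarrow> D \<subseteq> points M"
    and chart_inj: "(D, \<phi>) \<in> atlas M \<Longrightarrow> inj_on \<phi> D"
    and chart_image: "(D, \<phi>) \<in> atlas M \<Longrightarrow> openin (Euclidean_space (mdim M)) (\<phi> ` D)"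
    and chart_cover: "\<Union> (fst ` atlas M) = points M"
    and chart_transition: "c \<in> atlas M \<Longrightarrow> c' \<in> atlas M \<Longrightarrow> smooth_transition (mdim M) c c'"

lemma smooth_manifold_imp_smooth_structure: "smooth_manifold M \<Longrightarrow> smooth_structure M"
  by unfold_locales (auto simp: smooth_manifold_def)

context smooth_structure
begin

abbreviation "n \<equiv> mdim M"

lemma openin_mtop:
  "openin (mtop M) U \<longleftrightarrow> U \<subseteq> points M \<and>
     (\<forall>(D, \<phi>)\<in>atlas M. openin (Euclidean_space n) (\<phi> ` (U \<inter> D)))"
proof -
  define P where "P U \<longleftrightarrow> U \<subseteq> points M \<and>
     (\<forall>(D, \<phi>)\<in>atlas M. openin (Euclidean_space n) (\<phi> ` (U \<inter> D)))" for U
  have "istopology P"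
    unfolding istopology_def
  proof (intro conjI allI impI)
    fix U V assume UV: "P U" "P V"
    have "openin (Euclidean_space n) (\<phi> ` (U \<inter> V \<inter> D))" if c: "(D, \<phi>) \<in> atlas M" for D \<phi>
    proof -
      have "\<phi> ` (U \<inter> V \<inter> D) = \<phi> ` (U \<inter> D) \<inter> \<phi> ` (V \<inter> D)"
        using chart_inj[OF c] by (auto dest!: inj_onD)
      moreover have "openin (Euclidean_space n) (\<phi> ` (U \<inter> D))" "openin (Euclidean_space n) (\<phi> ` (V \<inter> D))"
        using UV c by (auto simp: P_def)
      ultimately show ?thesis by (simp add: openin_Int)
    qed
    then show "P (U \<inter> V)" using UV by (auto simp: P_def)
  next
    fix K assume K: "\<forall>U\<in>K. P U"
    have "openin (Euclidean_space n) (\<phi> ` (\<Union>K \<inter> D))" if c: "(D, \<phi>) \<in> atlas M" for D \<phi>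
    proof -
      have "\<phi> ` (\<Union>K \<inter> D) = (\<Union>U\<in>K. \<phi> ` (U \<inter> D))" by auto
      then show ?thesis using K c by (auto simp: P_def intro!: openin_Union)
    qed
    then show "P (\<Union>K)" using K by (auto simp: P_def)
  qed
  then show ?thesis
    using topology_inverse'[of P] by (simp add: mtop_def P_def[abs_def])
qed

lemma topspace_mtop: "topspace (mtop M) = points M"
proof
  show "topspace (mtop M) \<subseteq> points M"
    using openin_mtop openin_topspace by blast
  have "openin (mtop M) (points M)"
    unfolding openin_mtop
  proof (intro conjI ballI subset_refl, clarify)
    fix D \<phi> assume c: "(D, \<phi>) \<in> atlas M"
    then have "points M \<inter> D = D" using chart_subset by blast
    then show "openin (Euclidean_space n) (\<phi> ` (points M \<inter> D))" using chart_image[OF c] by simp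
  qed
  then show "points M \<subseteq> topspace (mtop M)"
    by (rule openin_subset)
qed

lemma openin_subset_points: "openin (mtop M) U \<Longrightarrow> U \<subseteq> points M"
  using openin_subset topspace_mtop by blast

lemma atlas_subset_max_atlas: "atlas M \<subseteq> max_atlas M"
proof (clarify)
  fix D \<phi> assume c: "(D, \<phi>) \<in> atlas M"
  show "(D, \<phi>) \<in> max_atlas M"
    using chart_subset[OF c] chart_inj[OF c] chart_image[OF c] chart_transition[OF c] chart_transition[OF _ c]
    by (simp add: max_atlas_def)
qed

lemma chart_at:
  assumes "q \<in> points M"
  obtains D \<phi> where "(D, \<phi>) \<in> atlas M" "q \<in> D"
proof -
  obtain c where "c \<in> atlas M" "q \<in> fst c"
    using assms unfolding chart_cover[symmetric] by blast
  then show ?thesis using that[of "fst c" "snd c"] by simp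
qed

lemma max_chartD:
  assumes "(D, \<phi>) \<in> max_atlas M"
  shows "D \<subseteq> points M" "inj_on \<phi> D" "openin (Euclidean_space n) (\<phi> ` D)" "\<phi> ` D \<subseteq> Rn n"
    and "c \<in> atlas M \<Longrightarrow> smooth_transition n c (D, \<phi>)"
    and "c \<in> atlas M \<Longrightarrow> smooth_transition n (D, \<phi>) c"
  using assms openin_Rn_subset by (auto simp: max_atlas_def)

lemma chartD:
  assumes "(D, \<phi>) \<in> atlas M"
  shows "D \<subseteq> points M" "inj_on \<phi> D" "openin (Euclidean_space n) (\<phi> ` D)" "\<phi> ` D \<subseteq> Rn n"
  using max_chartD(1-4)[of D \<phi>] subsetD[OF atlas_subset_max_atlas assms] by simp_all

lemma max_chart_image_open:
  assumes c': "(D', \<phi>') \<in> max_atlas M" and U: "openin (mtop M) U"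
  shows "openin (Euclidean_space n) (\<phi>' ` (U \<inter> D'))"
proof (subst openin_subopen, intro ballI)
  fix x assume "x \<in> \<phi>' ` (U \<inter> D')"
  then obtain q where q: "x = \<phi>' q" "q \<in> U" "q \<in> D'" by blast
  then obtain D \<phi> where c: "(D, \<phi>) \<in> atlas M" "q \<in> D"
    using chart_at openin_subset_points[OF U] by blast
  note D = chartD[OF c(1)] and D' = max_chartD[OF c']
  define T where "T = {x \<in> \<phi>' ` (D' \<inter> D). \<phi> (inv_into D' \<phi>' x) \<in> \<phi> ` (U \<inter> D)}"
  have "openin (Euclidean_space n) T"
    unfolding T_def
    by (rule smooth_transition_preimage[OF D'(6)[OF c(1)] D(4) D'(2)]) (use U c(1) openin_mtop in blast)
  moreover have "x \<in> T" unfolding T_def using q c D'(2) by auto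
  moreover have "T \<subseteq> \<phi>' ` (U \<inter> D')"
  proof
    fix z assume "z \<in> T"
    then obtain r where r: "z = \<phi>' r" "r \<in> D'" "r \<in> D" "\<phi> (inv_into D' \<phi>' z) \<in> \<phi> ` (U \<inter> D)"
      unfolding T_def by blast
    then have "\<phi> r \<in> \<phi> ` (U \<inter> D)" using D'(2) by simp
    then have "r \<in> U" using D(2) r(3) by (auto dest: inj_onD)
    then show "z \<in> \<phi>' ` (U \<inter> D')" using r by blast
  qed
  ultimately show "\<exists>T. openin (Euclidean_space n) T \<and> x \<in> T \<and> T \<subseteq> \<phi>' ` (U \<inter> D')" by blast
qed

lemma max_chart_preimage_open:
  assumes c': "(D', \<phi>') \<in> max_atlas M" and W: "openin (Euclidean_space n) W"
  shows "openin (mtop M) {q \<in> D'. \<phi>' q \<in> W}"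
  unfolding openin_mtop
proof (intro conjI ballI, use max_chartD[OF c'] in blast, clarify)
  fix D \<phi> assume c: "(D, \<phi>) \<in> atlas M"
  note D = chartD[OF c(1)] and D' = max_chartD[OF c']
  have "\<phi> ` ({q \<in> D'. \<phi>' q \<in> W} \<inter> D) = {x \<in> \<phi> ` (D \<inter> D'). \<phi>' (inv_into D \<phi> x) \<in> W}"
    using D(2) by auto
  then show "openin (Euclidean_space n) (\<phi> ` ({q \<in> D'. \<phi>' q \<in> W} \<inter> D))"
    using smooth_transition_preimage[OF D'(5)[OF c] D'(4) D(2) W] by simp
qed

lemma max_chart_open: "(D, \<phi>) \<in> max_atlas M \<Longrightarrow> openin (mtop M) D"
  using max_chart_preimage_open[of D \<phi> "Rn n"] max_chartD(4)[of D \<phi>]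
  by (simp add: image_subset_iff Collect_conj_eq Int_absorb2 subset_iff)

lemma smooth_near_imp_point: "smooth_near M q f \<Longrightarrow> q \<in> points M"
  unfolding smooth_near_def using openin_subset_points by blast

text \<open>Smoothness near a point can be tested in a single chart, which may be taken from the maximal
  atlas; slice charts and flat charts come from there.\<close>

lemma smooth_near_chart:
  assumes c: "(D, \<phi>) \<in> max_atlas M" "q \<in> D"
  shows "smooth_near M q f \<longleftrightarrow> (\<exists>W. openin (Euclidean_space n) W \<and> \<phi> q \<in> W \<and> W \<subseteq> \<phi> ` D \<and>
      smooth_on n W (f \<circ> inv_into D \<phi>))"
proof
  assume "smooth_near M q f"
  then obtain U where U: "openin (mtop M) U" "q \<in> U" "smooth_fun_on M U f"
    unfolding smooth_near_def by blast
  obtain D1 \<phi>1 where c1: "(D1, \<phi>1) \<in> atlas M" "q \<in> D1"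
    using chart_at max_chartD(1)[OF c(1)] c(2) by blast
  note D = max_chartD[OF c(1)] and D1 = chartD[OF c1(1)]
  define W where "W = {x \<in> \<phi> ` (D \<inter> D1). \<phi>1 (inv_into D \<phi> x) \<in> \<phi>1 ` (U \<inter> D1)}"
  have o: "openin (Euclidean_space n) (\<phi>1 ` (U \<inter> D1))"
    using U(1) c1 unfolding openin_mtop by blast
  have "openin (Euclidean_space n) W"
    unfolding W_def by (rule smooth_transition_preimage[OF D(6)[OF c1(1)] D1(4) D(2) o])
  moreover have "smooth_on n W (f \<circ> inv_into D \<phi>)"
    unfolding W_def
    by (rule smooth_on_transition[OF D(6)[OF c1(1)] D1(4) D(2) D1(2) o])
      (use U(3) c1 in \<open>auto simp: smooth_fun_on_def\<close>)
  moreover have "\<phi> q \<in> W" "W \<subseteq> \<phi> ` D"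
    unfolding W_def using c c1 U D(2) by auto
  ultimately show "\<exists>W. openin (Euclidean_space n) W \<and> \<phi> q \<in> W \<and> W \<subseteq> \<phi> ` D \<and>
      smooth_on n W (f \<circ> inv_into D \<phi>)" by blast
next
  assume "\<exists>W. openin (Euclidean_space n) W \<and> \<phi> q \<in> W \<and> W \<subseteq> \<phi> ` D \<and>
      smooth_on n W (f \<circ> inv_into D \<phi>)"
  then obtain W where W: "openin (Euclidean_space n) W" "\<phi> q \<in> W" "smooth_on n W (f \<circ> inv_into D \<phi>)"
    by blast
  note D = max_chartD[OF c(1)]
  have "smooth_fun_on M {r \<in> D. \<phi> r \<in> W} f"
    unfolding smooth_fun_on_def
  proof clarify
    fix D1 \<phi>1 assume c1: "(D1, \<phi>1) \<in> atlas M"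
    note D1 = chartD[OF c1(1)]
    have "\<phi>1 ` ({r \<in> D. \<phi> r \<in> W} \<inter> D1) = {x \<in> \<phi>1 ` (D1 \<inter> D). \<phi> (inv_into D1 \<phi>1 x) \<in> W}"
      using D1(2) by auto
    then show "smooth_on n (\<phi>1 ` ({r \<in> D. \<phi> r \<in> W} \<inter> D1)) (f \<circ> inv_into D1 \<phi>1)"
      using smooth_on_transition[OF D(5)[OF c1] D(4) D1(2) D(2) W(1,3)] by simp
  qed
  then show "smooth_near M q f"
    unfolding smooth_near_def using max_chart_preimage_open[OF c(1) W(1)] c(2) W(2) by blast
qed

lemma smooth_near_chart_finite:
  assumes c: "(D, \<phi>) \<in> max_atlas M" "q \<in> D" and J: "finite J"
    and f: "\<And>j. j \<in> J \<Longrightarrow> smooth_near M q (f j)" and U: "openin (mtop M) U" "q \<in> U"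
  obtains W where "openin (Euclidean_space n) W" "\<phi> q \<in> W" "W \<subseteq> \<phi> ` (U \<inter> D)"
    "\<And>j. j \<in> J \<Longrightarrow> smooth_on n W (f j \<circ> inv_into D \<phi>)"
proof -
  have "\<exists>W. openin (Euclidean_space n) W \<and> \<phi> q \<in> W \<and> W \<subseteq> \<phi> ` (U \<inter> D) \<and>
    (\<forall>j\<in>J. smooth_on n W (f j \<circ> inv_into D \<phi>))"
    using J f
  proof (induction J)
    case empty
    show ?case using max_chart_image_open[OF c(1) U(1)] c(2) U(2) by auto
  next
    case (insert j J)
    then obtain W where W: "openin (Euclidean_space n) W" "\<phi> q \<in> W" "W \<subseteq> \<phi> ` (U \<inter> D)"
      "\<forall>j\<in>J. smooth_on n W (f j \<circ> inv_into D \<phi>)" by (meson insertCI)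
    obtain W' where W': "openin (Euclidean_space n) W'" "\<phi> q \<in> W'" "smooth_on n W' (f j \<circ> inv_into D \<phi>)"
      using insert.prems[of j] smooth_near_chart[OF c] by auto
    have J': "\<forall>i\<in>insert j J. smooth_on n (W \<inter> W') (f i \<circ> inv_into D \<phi>)"
      using W(4) W'(3) smooth_on_subset by (metis insert_iff inf_le1 inf_le2)
    show ?case
    proof (intro exI conjI)
      show "\<forall>i\<in>insert j J. smooth_on n (W \<inter> W') (f i \<circ> inv_into D \<phi>)" by (rule J')
    qed (use W W' in auto)
  qed
  then show ?thesis using that by blast
qed

lemma smooth_nearI:
  assumes "(D, \<phi>) \<in> max_atlas M" "q \<in> D" "openin (Euclidean_space n) W" "\<phi> q \<in> W" "W \<subseteq> \<phi> ` D"
    "smooth_on n W h" "\<And>x. x \<in> W \<Longrightarrow> h x = f (inv_into D \<phi> x)"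
  shows "smooth_near M q f"
  unfolding smooth_near_chart[OF assms(1,2)]
  using assms(3-5) smooth_on_cong[OF assms(3) _ assms(6), of "f \<circ> inv_into D \<phi>"] assms(7) by auto

lemma smooth_near_cong:
  assumes "smooth_near M q f" "openin (mtop M) U" "q \<in> U" "\<And>r. r \<in> U \<Longrightarrow> f r = g r"
  shows "smooth_near M q g"
proof -
  obtain D \<phi> where c: "(D, \<phi>) \<in> max_atlas M" "q \<in> D"
    using chart_at smooth_near_imp_point[OF assms(1)] atlas_subset_max_atlas by blast
  obtain W where W: "openin (Euclidean_space n) W" "\<phi> q \<in> W" "W \<subseteq> \<phi> ` (U \<inter> D)"
    "smooth_on n W (f \<circ> inv_into D \<phi>)"
    using smooth_near_chart_finite[OF c, of "{()}" "\<lambda>_. f" U] assms(1-3) by auto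
  show ?thesis
  proof (rule smooth_nearI[OF c W(1,2) _ W(4)])
    show "W \<subseteq> \<phi> ` D" using W(3) by blast
    show "(f \<circ> inv_into D \<phi>) x = g (inv_into D \<phi> x)" if "x \<in> W" for x
      using that W(3) assms(4) max_chartD(2)[OF c(1)] by auto
  qed
qed

lemma smooth_near_cong_iff:
  "openin (mtop M) U \<Longrightarrow> q \<in> U \<Longrightarrow> (\<And>r. r \<in> U \<Longrightarrow> f r = g r) \<Longrightarrow> smooth_near M q f \<longleftrightarrow> smooth_near M q g"
  using smooth_near_cong[of q f U g] smooth_near_cong[of q g U f] by auto

lemma smooth_near_open:
  assumes "smooth_near M q f"
  obtains U where "openin (mtop M) U" "q \<in> U" "\<And>r. r \<in> U \<Longrightarrow> smooth_near M r f"
  using assms that unfolding smooth_near_def by blast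

text \<open>Transfers a closure property of smooth functions on open sets of real n-space, given by the
  operation \<open>H\<close>, to functions on the manifold. The predicate \<open>P\<close> records a side condition on the
  arguments, such as a nonzero denominator.\<close>

lemma smooth_near_compose:
  fixes f :: "nat \<Rightarrow> 'a \<Rightarrow> real" and H :: "(nat \<Rightarrow> real) \<Rightarrow> real"
  assumes q: "q \<in> points M" and f: "\<And>j. j < m \<Longrightarrow> smooth_near M q (f j)"
    and H: "\<And>W g. openin (Euclidean_space n) W \<Longrightarrow> (\<And>j. j < m \<Longrightarrow> smooth_on n W (g j)) \<Longrightarrow>
      (\<And>x. x \<in> W \<Longrightarrow> P (\<lambda>j. g j x)) \<Longrightarrow> smooth_on n W (\<lambda>x. H (\<lambda>j. g j x))"
    and U: "openin (mtop M) U" "q \<in> U" "\<And>r. r \<in> U \<Longrightarrow> P (\<lambda>j. f j r)"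
  shows "smooth_near M q (\<lambda>r. H (\<lambda>j. f j r))"
proof -
  obtain D \<phi> where c: "(D, \<phi>) \<in> max_atlas M" "q \<in> D"
    using chart_at q atlas_subset_max_atlas by blast
  obtain W where W: "openin (Euclidean_space n) W" "\<phi> q \<in> W" "W \<subseteq> \<phi> ` (U \<inter> D)"
    "\<And>j. j < m \<Longrightarrow> smooth_on n W (f j \<circ> inv_into D \<phi>)"
    using smooth_near_chart_finite[OF c finite_lessThan[of m], of f U] f U(1,2) by auto
  have W': "W \<subseteq> \<phi> ` D" using W(3) by blast
  have "smooth_on n W (\<lambda>x. H (\<lambda>j. (f j \<circ> inv_into D \<phi>) x))"
  proof (rule H[OF W(1)])
    show "smooth_on n W (\<lambda>x. (f j \<circ> inv_into D \<phi>) x)" if "j < m" for j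
      using W(4)[OF that] by (simp add: o_def)
    show "P (\<lambda>j. (f j \<circ> inv_into D \<phi>) x)" if "x \<in> W" for x
      using that W(3) U(3) max_chartD(2)[OF c(1)] by auto
  qed
  then show ?thesis
    by (rule smooth_nearI[OF c W(1,2) W']) auto
qed

lemma smooth_near_const: "q \<in> points M \<Longrightarrow> smooth_near M q (\<lambda>r. c)"
  using smooth_near_compose[of q 0 "\<lambda>_ _. 0" "\<lambda>_. True" "\<lambda>_. c" "points M"]
    smooth_on_const openin_topspace[of "mtop M"] by (simp add: topspace_mtop)

lemma smooth_near_add:
  assumes "smooth_near M q f" "smooth_near M q g"
  shows "smooth_near M q (\<lambda>r. f r + g r)"
proof -
  have "smooth_near M q (\<lambda>r. (\<lambda>v. v 0 + v 1) (\<lambda>j::nat. (if j = 0 then f else g) r))"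
    by (rule smooth_near_compose[of q 2 _ "\<lambda>_. True" _ "points M"])
      (use assms smooth_near_imp_point[OF assms(1)] openin_topspace[of "mtop M"] in
        \<open>auto simp: topspace_mtop intro: smooth_on_add\<close>)
  then show ?thesis by simp
qed

lemma smooth_near_mult:
  assumes "smooth_near M q f" "smooth_near M q g"
  shows "smooth_near M q (\<lambda>r. f r * g r)"
proof -
  have "smooth_near M q (\<lambda>r. (\<lambda>v. v 0 * v 1) (\<lambda>j::nat. (if j = 0 then f else g) r))"
    by (rule smooth_near_compose[of q 2 _ "\<lambda>_. True" _ "points M"])
      (use assms smooth_near_imp_point[OF assms(1)] openin_topspace[of "mtop M"] in
        \<open>auto simp: topspace_mtop intro: smooth_on_mult\<close>)
  then show ?thesis by simp
qed

lemma smooth_near_inverse: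
  assumes "smooth_near M q f" "openin (mtop M) U" "q \<in> U" "\<And>r. r \<in> U \<Longrightarrow> f r \<noteq> 0"
  shows "smooth_near M q (\<lambda>r. inverse (f r))"
proof -
  have "smooth_near M q (\<lambda>r. (\<lambda>v. inverse (v 0)) (\<lambda>j::nat. f r))"
    by (rule smooth_near_compose[of q 1 "\<lambda>_. f" "\<lambda>v. v 0 \<noteq> 0" "\<lambda>v. inverse (v 0)" U])
      (use assms smooth_near_imp_point[OF assms(1)] in \<open>auto intro: smooth_on_inverse\<close>)
  then show ?thesis by simp
qed

lemma smooth_near_sum:
  "q \<in> points M \<Longrightarrow> (\<And>j. j \<in> J \<Longrightarrow> smooth_near M q (f j)) \<Longrightarrow> smooth_near M q (\<lambda>r. \<Sum>j\<in>J. f j r)"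
  by (induction J rule: infinite_finite_induct) (auto intro: smooth_near_add smooth_near_const)

lemma smooth_near_coord:
  assumes c: "(D, \<phi>) \<in> max_atlas M" "q \<in> D"
  shows "smooth_near M q (\<lambda>r. \<phi> r i)"
  by (rule smooth_nearI[OF c max_chartD(3)[OF c(1)] _ _ smooth_on_coord[OF max_chartD(3)[OF c(1)], of i]])
    (use c in \<open>auto simp: f_inv_into_f\<close>)

lemma smooth_fun_on_iff:
  assumes U: "openin (mtop M) U"
  shows "smooth_fun_on M U f \<longleftrightarrow> (\<forall>q\<in>U. smooth_near M q f)"
proof
  show "smooth_fun_on M U f \<Longrightarrow> \<forall>q\<in>U. smooth_near M q f"
    using U by (auto simp: smooth_near_def)
  assume f: "\<forall>q\<in>U. smooth_near M q f"
  show "smooth_fun_on M U f"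
    unfolding smooth_fun_on_def
  proof clarify
    fix D \<phi> assume c: "(D, \<phi>) \<in> atlas M"
    show "smooth_on n (\<phi> ` (U \<inter> D)) (f \<circ> inv_into D \<phi>)"
    proof (rule smooth_on_locally)
      fix x assume "x \<in> \<phi> ` (U \<inter> D)"
      then show "\<exists>V. openin (Euclidean_space n) V \<and> x \<in> V \<and> smooth_on n V (f \<circ> inv_into D \<phi>)"
        using f smooth_near_chart[of D \<phi> _ f] c atlas_subset_max_atlas by blast
    qed (use chartD(4)[OF c] in blast)
  qed
qed

end


section \<open>Tangent vectors and vector fields\<close>

lemma coord_vec_smooth:
  "smooth_near M q f \<Longrightarrow> coord_vec M (D, \<phi>) q i f = partial_deriv i (f \<circ> inv_into D \<phi>) (\<phi> q)"
  by (simp add: coord_vec_def)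

lemma coord_vec_not_smooth: "\<not> smooth_near M q f \<Longrightarrow> coord_vec M c q i f = 0"
  by (simp add: coord_vec_def)

text \<open>The chain rule for a map between manifolds, in charts of both. The map is only assumed to have
  smooth coordinates in one chart around \<open>f q\<close>; applied to the identity map it also describes the
  change of charts, and applied to inclusions it computes their differentials.\<close>

lemma
  assumes N: "smooth_structure N" and M: "smooth_structure M"
    and f: "continuous_map (mtop N) (mtop M) f"
    and cN: "(E, \<psi>) \<in> max_atlas N" "q \<in> E" and cM: "(D, \<phi>) \<in> max_atlas M" "f q \<in> D"
    and sm: "\<And>j. j < mdim M \<Longrightarrow> smooth_near N q (\<lambda>r. \<phi> (f r) j)"
    and h: "smooth_near M (f q) h"
  shows smooth_near_pullback: "smooth_near N q (\<lambda>r. h (f r))"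
    and coord_vec_pullback: "i < mdim N \<Longrightarrow> coord_vec N (E, \<psi>) q i (\<lambda>r. h (f r)) =
      (\<Sum>j<mdim M. coord_vec N (E, \<psi>) q i (\<lambda>r. \<phi> (f r) j) * coord_vec M (D, \<phi>) (f q) j h)"
proof -
  interpret N: smooth_structure N by fact
  interpret M: smooth_structure M by fact
  obtain V where V: "openin (Euclidean_space (mdim M)) V" "\<phi> (f q) \<in> V" "V \<subseteq> \<phi> ` D"
    "smooth_on (mdim M) V (h \<circ> inv_into D \<phi>)"
    using M.smooth_near_chart[OF cM, of h] h by blast
  define U where "U = {r \<in> topspace (mtop N). f r \<in> {s \<in> D. \<phi> s \<in> V}}"
  have U: "openin (mtop N) U" unfolding U_def
    by (rule openin_continuous_map_preimage[OF f M.max_chart_preimage_open[OF cM(1) V(1)]])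
  have qU: "q \<in> U"
    using cM(2) V(2) N.max_chartD(1)[OF cN(1)] cN(2) by (auto simp: U_def N.topspace_mtop)
  obtain W where W: "openin (Euclidean_space (mdim N)) W" "\<psi> q \<in> W" "W \<subseteq> \<psi> ` (U \<inter> E)"
    and W4: "\<And>j. j \<in> {..<mdim M} \<Longrightarrow> smooth_on (mdim N) W ((\<lambda>r. \<phi> (f r) j) \<circ> inv_into E \<psi>)"
    using N.smooth_near_chart_finite[OF cN finite_lessThan _ U qU, of "mdim M" "\<lambda>j r. \<phi> (f r) j"] sm
    by auto
  define \<Phi> where "\<Phi> x = \<phi> (f (inv_into E \<psi> x))" for x
  have s\<Phi>: "smooth_on (mdim N) W (\<lambda>x. \<Phi> x j)" if "j < mdim M" for j
    using W4[of j] that by (simp add: \<Phi>_def o_def)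
  have injE: "inj_on \<psi> E" by (rule N.max_chartD(2)[OF cN(1)])
  have injD: "inj_on \<phi> D" by (rule M.max_chartD(2)[OF cM(1)])
  have \<Phi>V: "\<Phi> x \<in> V" and eq: "(h \<circ> inv_into D \<phi>) (\<Phi> x) = h (f (inv_into E \<psi> x))" if "x \<in> W" for x
    using that W(3) injE injD by (auto simp: \<Phi>_def U_def)
  have comp: "smooth_on (mdim N) W (\<lambda>x. (h \<circ> inv_into D \<phi>) (\<Phi> x))"
    by (rule smooth_on_compose[OF W(1) V(1) \<Phi>V s\<Phi> V(4)])
  have WE: "W \<subseteq> \<psi> ` E" using W(3) by blast
  show A: "smooth_near N q (\<lambda>r. h (f r))"
    by (rule N.smooth_nearI[OF cN W(1,2) WE comp eq])
  show "coord_vec N (E, \<psi>) q i (\<lambda>r. h (f r)) =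
      (\<Sum>j<mdim M. coord_vec N (E, \<psi>) q i (\<lambda>r. \<phi> (f r) j) * coord_vec M (D, \<phi>) (f q) j h)"
    if i: "i < mdim N"
  proof -
    have "coord_vec N (E, \<psi>) q i (\<lambda>r. h (f r)) = partial_deriv i (\<lambda>x. (h \<circ> inv_into D \<phi>) (\<Phi> x)) (\<psi> q)"
      unfolding coord_vec_smooth[OF A]
      by (rule partial_deriv_cong[OF W(1) _ i W(2)]) (simp add: eq[simplified])
    also have "\<dots> = (\<Sum>j<mdim M. partial_deriv j (h \<circ> inv_into D \<phi>) (\<Phi> (\<psi> q)) * partial_deriv i (\<lambda>x. \<Phi> x j) (\<psi> q))"
      by (rule partial_derivI, rule partial_chain_rule[OF W(1) V(1) \<Phi>V
            smooth_on_partially_differentiable[OF s\<Phi>] V(4)[unfolded smooth_on_iff_Ck, rule_format] W(2) i])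
    also have "\<Phi> (\<psi> q) = \<phi> (f q)"
      using cN(2) injE by (simp add: \<Phi>_def)
    finally show ?thesis
      by (simp add: coord_vec_smooth[OF sm] coord_vec_smooth[OF h] \<Phi>_def o_def mult.commute)
  qed
qed

context smooth_structure
begin

lemma max_chart_at:
  assumes "q \<in> points M"
  obtains D \<phi> where "(D, \<phi>) \<in> max_atlas M" "q \<in> D"
  using chart_at[OF assms] atlas_subset_max_atlas by blast

lemma coord_vec_change:
  assumes "(E, \<psi>) \<in> max_atlas M" "q \<in> E" "(D, \<phi>) \<in> max_atlas M" "q \<in> D" "i < n"
  shows "coord_vec M (E, \<psi>) q i h = (\<Sum>j<n. coord_vec M (E, \<psi>) q i (\<lambda>r. \<phi> r j) * coord_vec M (D, \<phi>) q j h)"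
proof (cases "smooth_near M q h")
  case True
  then show ?thesis
    using coord_vec_pullback[OF smooth_structure_axioms smooth_structure_axioms continuous_map_id[unfolded id_def]
        assms(1-4), of h i] smooth_near_coord[OF assms(3,4)] assms(5) by simp
qed (simp add: coord_vec_not_smooth)

lemma coord_vec_coord:
  assumes c: "(D, \<phi>) \<in> max_atlas M" "q \<in> D" and i: "i < n"
  shows "coord_vec M (D, \<phi>) q i (\<lambda>r. \<phi> r j) = (if i = j then 1 else 0)"
proof -
  have "coord_vec M (D, \<phi>) q i (\<lambda>r. \<phi> r j) = partial_deriv i (\<lambda>x. x j) (\<phi> q)"
    unfolding coord_vec_smooth[OF smooth_near_coord[OF c]]
    by (rule partial_deriv_cong[OF max_chartD(3)[OF c(1)] _ i]) (use c in \<open>auto simp: f_inv_into_f\<close>)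
  also have "\<dots> = (if i = j then 1 else 0)"
    by (rule partial_derivI) (cases "i = j"; auto)
  finally show ?thesis .
qed

text \<open>The chain rule for the identity map: the coordinate vectors of one chart are combinations of those
  of any other. So tangent spaces may be described in any chart of the maximal atlas.\<close>

lemma coord_comb_change:
  assumes "(E, \<psi>) \<in> max_atlas M" "q \<in> E" "(D, \<phi>) \<in> max_atlas M" "q \<in> D"
  shows "(\<lambda>f. \<Sum>i<n. b i * coord_vec M (E, \<psi>) q i f) =
    (\<lambda>f. \<Sum>j<n. (\<Sum>i<n. b i * coord_vec M (E, \<psi>) q i (\<lambda>r. \<phi> r j)) * coord_vec M (D, \<phi>) q j f)"
proof
  fix f
  have "(\<Sum>i<n. b i * coord_vec M (E, \<psi>) q i f) =
      (\<Sum>i<n. \<Sum>j<n. b i * coord_vec M (E, \<psi>) q i (\<lambda>r. \<phi> r j) * coord_vec M (D, \<phi>) q j f)"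
    by (rule sum.cong) (auto simp: coord_vec_change[OF assms, of _ f] sum_distrib_left mult.assoc)
  also have "\<dots> = (\<Sum>j<n. \<Sum>i<n. b i * coord_vec M (E, \<psi>) q i (\<lambda>r. \<phi> r j) * coord_vec M (D, \<phi>) q j f)"
    by (rule sum.swap)
  finally show "(\<Sum>i<n. b i * coord_vec M (E, \<psi>) q i f) =
      (\<Sum>j<n. (\<Sum>i<n. b i * coord_vec M (E, \<psi>) q i (\<lambda>r. \<phi> r j)) * coord_vec M (D, \<phi>) q j f)"
    by (simp add: sum_distrib_right)
qed

lemma tangent_space_chart:
  assumes c: "(D, \<phi>) \<in> max_atlas M" "q \<in> D"
  shows "v \<in> tangent_space M q \<longleftrightarrow> (\<exists>a. v = (\<lambda>f. \<Sum>i<n. a i * coord_vec M (D, \<phi>) q i f))"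
proof
  assume "v \<in> tangent_space M q"
  then obtain E \<psi> b where E: "(E, \<psi>) \<in> atlas M" "q \<in> E" and v: "v = (\<lambda>f. \<Sum>i<n. b i * coord_vec M (E, \<psi>) q i f)"
    unfolding tangent_space_def by force
  show "\<exists>a. v = (\<lambda>f. \<Sum>i<n. a i * coord_vec M (D, \<phi>) q i f)"
    by (rule exI, rule trans[OF v coord_comb_change[OF subsetD[OF atlas_subset_max_atlas E(1)] E(2) c]])
next
  assume "\<exists>a. v = (\<lambda>f. \<Sum>i<n. a i * coord_vec M (D, \<phi>) q i f)"
  then obtain a where a: "v = (\<lambda>f. \<Sum>i<n. a i * coord_vec M (D, \<phi>) q i f)" by blast
  obtain E \<psi> where E: "(E, \<psi>) \<in> atlas M" "q \<in> E"
    using chart_at max_chartD(1)[OF c(1)] c(2) by blast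
  have "\<exists>b. v = (\<lambda>f. \<Sum>i<n. b i * coord_vec M (E, \<psi>) q i f)"
    by (rule exI, rule trans[OF a coord_comb_change[OF c subsetD[OF atlas_subset_max_atlas E(1)] E(2)]])
  then show "v \<in> tangent_space M q"
    unfolding tangent_space_def using E by force
qed

lemma coord_comb_tangent:
  "(D, \<phi>) \<in> max_atlas M \<Longrightarrow> q \<in> D \<Longrightarrow> (\<lambda>f. \<Sum>i<n. a i * coord_vec M (D, \<phi>) q i f) \<in> tangent_space M q"
  using tangent_space_chart by blast

lemma coord_comb_coord:
  assumes "(D, \<phi>) \<in> max_atlas M" "q \<in> D" "j < n"
  shows "(\<Sum>i<n. a i * coord_vec M (D, \<phi>) q i (\<lambda>r. \<phi> r j)) = a j"
proof -
  have "(\<Sum>i<n. a i * coord_vec M (D, \<phi>) q i (\<lambda>r. \<phi> r j)) = (\<Sum>i<n. if i = j then a i else 0)"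
    by (rule sum.cong) (auto simp: coord_vec_coord[OF assms(1,2)])
  then show ?thesis using assms(3) by simp
qed

text \<open>The coordinate vectors of a chart take the values 0 and 1 on its coordinate functions, so the
  coefficients of a tangent vector are its values on these functions.\<close>

lemma tangent_expand:
  assumes c: "(D, \<phi>) \<in> max_atlas M" "q \<in> D" and v: "v \<in> tangent_space M q"
  shows "v f = (\<Sum>i<n. v (\<lambda>r. \<phi> r i) * coord_vec M (D, \<phi>) q i f)"
proof -
  obtain a where a: "v = (\<lambda>f. \<Sum>i<n. a i * coord_vec M (D, \<phi>) q i f)"
    using tangent_space_chart[OF c] v by blast
  then have "v (\<lambda>r. \<phi> r j) = a j" if "j < n" for j
    using coord_comb_coord[OF c that] by simp
  then show ?thesis by (subst a) simp
qed

lemma tangent_eqI: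
  assumes c: "(D, \<phi>) \<in> max_atlas M" "q \<in> D" and "u \<in> tangent_space M q" "v \<in> tangent_space M q"
    and "\<And>i. i < n \<Longrightarrow> u (\<lambda>r. \<phi> r i) = v (\<lambda>r. \<phi> r i)"
  shows "u = v"
proof
  fix f
  show "u f = v f"
    unfolding tangent_expand[OF c assms(3), of f] tangent_expand[OF c assms(4), of f]
    by (simp add: assms(5))
qed

lemma tangent_imp_point: "v \<in> tangent_space M q \<Longrightarrow> q \<in> points M"
  unfolding tangent_space_def using chart_cover by force

lemma tangent_lincomb:
  assumes "u \<in> tangent_space M q" "v \<in> tangent_space M q"
  shows "(\<lambda>f. a * u f + b * v f) \<in> tangent_space M q"
proof -
  obtain D \<phi> where c: "(D, \<phi>) \<in> max_atlas M" "q \<in> D"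
    using max_chart_at[OF tangent_imp_point[OF assms(1)]] .
  have "(\<lambda>f. a * u f + b * v f) =
      (\<lambda>f. \<Sum>i<n. (a * u (\<lambda>r. \<phi> r i) + b * v (\<lambda>r. \<phi> r i)) * coord_vec M (D, \<phi>) q i f)"
    by (subst tangent_expand[OF c assms(1)], subst tangent_expand[OF c assms(2)])
      (simp add: sum_distrib_left distrib_right sum.distrib mult.assoc)
  then show ?thesis using coord_comb_tangent[OF c] by simp
qed

lemma tangent_zero: "q \<in> points M \<Longrightarrow> (\<lambda>f. 0) \<in> tangent_space M q"
proof -
  assume "q \<in> points M"
  then obtain D \<phi> where c: "(D, \<phi>) \<in> max_atlas M" "q \<in> D" by (rule max_chart_at)
  then show ?thesis using coord_comb_tangent[OF c, of "\<lambda>_. 0"] by simp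
qed

lemma coord_vec_local:
  assumes c: "(D, \<phi>) \<in> max_atlas M" "q \<in> D" and "openin (mtop M) U" "q \<in> U" "\<And>r. r \<in> U \<Longrightarrow> f r = g r"
    and i: "i < n"
  shows "coord_vec M (D, \<phi>) q i f = coord_vec M (D, \<phi>) q i g"
proof -
  have "partial_deriv i (f \<circ> inv_into D \<phi>) (\<phi> q) = partial_deriv i (g \<circ> inv_into D \<phi>) (\<phi> q)"
    by (rule partial_deriv_cong[OF max_chart_image_open[OF c(1) assms(3)] _ i])
      (use c assms max_chartD(2)[OF c(1)] in auto)
  then show ?thesis
    using smooth_near_cong_iff[OF assms(3-5)] by (simp add: coord_vec_def)
qed

text \<open>Tangent vectors only see germs. This justifies replacing functions on a submanifold by functions
  that agree with them near the point.\<close>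

lemma tangent_local:
  assumes v: "v \<in> tangent_space M q" and U: "openin (mtop M) U" "q \<in> U" "\<And>r. r \<in> U \<Longrightarrow> f r = g r"
  shows "v f = v g"
proof -
  obtain D \<phi> where c: "(D, \<phi>) \<in> max_atlas M" "q \<in> D"
    using max_chart_at[OF tangent_imp_point[OF v]] .
  show ?thesis
    unfolding tangent_expand[OF c v, of f] tangent_expand[OF c v, of g]
    by (rule sum.cong) (auto simp: coord_vec_local[OF c U])
qed

lemma coord_vec_has_derivative:
  assumes c: "(D, \<phi>) \<in> max_atlas M" "q \<in> D" and f: "smooth_near M q f" and i: "i < n"
  shows "((\<lambda>t. f (inv_into D \<phi> ((\<phi> q)(i := t)))) has_real_derivative coord_vec M (D, \<phi>) q i f) (at (\<phi> q i))"
proof -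
  obtain W where W: "openin (Euclidean_space n) W" "\<phi> q \<in> W" "smooth_on n W (f \<circ> inv_into D \<phi>)"
    using smooth_near_chart[OF c] f by blast
  show ?thesis
    using has_partial_deriv[OF smooth_on_partially_differentiable[OF W(3)] i W(2)]
    by (simp add: coord_vec_smooth[OF f])
qed

lemma coord_vec_add:
  assumes c: "(D, \<phi>) \<in> max_atlas M" "q \<in> D" and f: "smooth_near M q f" "smooth_near M q g" and i: "i < n"
  shows "coord_vec M (D, \<phi>) q i (\<lambda>r. f r + g r) = coord_vec M (D, \<phi>) q i f + coord_vec M (D, \<phi>) q i g"
  unfolding coord_vec_smooth[OF smooth_near_add[OF f]] o_def
  by (rule partial_derivI) (intro DERIV_add coord_vec_has_derivative c f i)

lemma coord_vec_mult:
  assumes c: "(D, \<phi>) \<in> max_atlas M" "q \<in> D" and f: "smooth_near M q f" "smooth_near M q g" and i: "i < n"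
  shows "coord_vec M (D, \<phi>) q i (\<lambda>r. f r * g r) =
    coord_vec M (D, \<phi>) q i f * g q + f q * coord_vec M (D, \<phi>) q i g"
  unfolding coord_vec_smooth[OF smooth_near_mult[OF f]] o_def
proof (rule partial_derivI)
  have "inv_into D \<phi> (\<phi> q) = q" using c max_chartD(2)[OF c(1)] by simp
  then show "((\<lambda>t. f (inv_into D \<phi> ((\<phi> q)(i := t))) * g (inv_into D \<phi> ((\<phi> q)(i := t)))) has_real_derivative
      coord_vec M (D, \<phi>) q i f * g q + f q * coord_vec M (D, \<phi>) q i g) (at (\<phi> q i))"
    using DERIV_mult[OF coord_vec_has_derivative[OF c f(1) i] coord_vec_has_derivative[OF c f(2) i]]
    by (simp add: mult.commute)
qed

lemma tangent_add:
  assumes v: "v \<in> tangent_space M q" and f: "smooth_near M q f" "smooth_near M q g"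
  shows "v (\<lambda>r. f r + g r) = v f + v g"
proof -
  obtain D \<phi> where c: "(D, \<phi>) \<in> max_atlas M" "q \<in> D"
    using max_chart_at[OF tangent_imp_point[OF v]] .
  show ?thesis
    unfolding tangent_expand[OF c v, of f] tangent_expand[OF c v, of g] tangent_expand[OF c v, of "\<lambda>r. f r + g r"]
    by (simp add: coord_vec_add[OF c f] distrib_left sum.distrib)
qed

lemma tangent_mult:
  assumes v: "v \<in> tangent_space M q" and f: "smooth_near M q f" "smooth_near M q g"
  shows "v (\<lambda>r. f r * g r) = v f * g q + f q * v g"
proof -
  obtain D \<phi> where c: "(D, \<phi>) \<in> max_atlas M" "q \<in> D"
    using max_chart_at[OF tangent_imp_point[OF v]] .
  show ?thesis
    unfolding tangent_expand[OF c v, of f] tangent_expand[OF c v, of g] tangent_expand[OF c v, of "\<lambda>r. f r * g r"]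
    by (simp add: coord_vec_mult[OF c f] distrib_left sum.distrib sum_distrib_left sum_distrib_right mult_ac)
qed

lemma tangent_const:
  assumes "v \<in> tangent_space M q"
  shows "v (\<lambda>r. c) = 0"
proof -
  have "coord_vec M c' q i (\<lambda>r. c) = 0" for c' i
    by (cases "smooth_near M q (\<lambda>r. c)") (simp_all add: coord_vec_def partial_deriv_def o_def)
  then show ?thesis using assms unfolding tangent_space_def by auto
qed

lemma tangent_sum:
  assumes v: "v \<in> tangent_space M q" and "\<And>j. j \<in> J \<Longrightarrow> smooth_near M q (f j)"
  shows "v (\<lambda>r. \<Sum>j\<in>J. f j r) = (\<Sum>j\<in>J. v (f j))"
  using assms(2)
proof (induction J rule: infinite_finite_induct)
  case (insert j J)
  then show ?case
    using tangent_add[OF v, of "f j" "\<lambda>r. \<Sum>j\<in>J. f j r"] smooth_near_sum[OF tangent_imp_point[OF v], of J f]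
    by simp
qed (simp_all add: tangent_const[OF v])

lemma smooth_near_coord_vec:
  assumes c: "(D, \<phi>) \<in> max_atlas M" "q \<in> D" and f: "smooth_near M q f" and i: "i < n"
  shows "smooth_near M q (\<lambda>r. coord_vec M (D, \<phi>) r i f)"
    and "j < n \<Longrightarrow> coord_vec M (D, \<phi>) q j (\<lambda>r. coord_vec M (D, \<phi>) r i f) =
      partial_deriv j (partial_deriv i (f \<circ> inv_into D \<phi>)) (\<phi> q)"
proof -
  obtain W where W: "openin (Euclidean_space n) W" "\<phi> q \<in> W" "W \<subseteq> \<phi> ` D" "smooth_on n W (f \<circ> inv_into D \<phi>)"
    using smooth_near_chart[OF c] f by blast
  have eq: "partial_deriv i (f \<circ> inv_into D \<phi>) x = coord_vec M (D, \<phi>) (inv_into D \<phi> x) i f" if "x \<in> W" for x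
  proof -
    have "inv_into D \<phi> x \<in> D" "\<phi> (inv_into D \<phi> x) = x"
      using that W(3) by (auto simp: inv_into_into f_inv_into_f subset_iff)
    moreover from this have "smooth_near M (inv_into D \<phi> x) f"
      using smooth_near_chart[OF c(1)] W that by metis
    ultimately show ?thesis by (simp add: coord_vec_smooth)
  qed
  show s: "smooth_near M q (\<lambda>r. coord_vec M (D, \<phi>) r i f)"
    by (rule smooth_nearI[OF c W(1-3) smooth_on_partial_deriv[OF W(4) i] eq])
  show "coord_vec M (D, \<phi>) q j (\<lambda>r. coord_vec M (D, \<phi>) r i f) =
      partial_deriv j (partial_deriv i (f \<circ> inv_into D \<phi>)) (\<phi> q)" if "j < n"
    unfolding coord_vec_smooth[OF s]
    by (rule partial_deriv_cong[OF W(1) _ that W(2)]) (simp add: eq)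
qed

lemma coord_vec_commute:
  assumes c: "(D, \<phi>) \<in> max_atlas M" "q \<in> D" and f: "smooth_near M q f" and ij: "i < n" "j < n"
  shows "coord_vec M (D, \<phi>) q j (\<lambda>r. coord_vec M (D, \<phi>) r i f) =
    coord_vec M (D, \<phi>) q i (\<lambda>r. coord_vec M (D, \<phi>) r j f)"
proof -
  obtain W where W: "openin (Euclidean_space n) W" "\<phi> q \<in> W" "smooth_on n W (f \<circ> inv_into D \<phi>)"
    using smooth_near_chart[OF c] f by blast
  show ?thesis
    unfolding smooth_near_coord_vec(2)[OF c f ij] smooth_near_coord_vec(2)[OF c f ij(2,1)]
    by (rule partial_deriv_commute[OF W(1,3,2) ij])
qed

text \<open>Smoothness of the components in all charts of the atlas amounts to a chart-free condition: coordinate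
  functions are smooth, and \<open>X f\<close> is a combination of the components of \<open>X\<close> with smooth coefficients.\<close>

lemma vector_field_on_iff:
  assumes U: "openin (mtop M) U"
  shows "vector_field_on M U X \<longleftrightarrow> (\<forall>q\<in>U. X q \<in> tangent_space M q \<and>
    (\<forall>f. smooth_near M q f \<longrightarrow> smooth_near M q (\<lambda>r. X r f)))"
proof
  assume X: "vector_field_on M U X"
  show "\<forall>q\<in>U. X q \<in> tangent_space M q \<and> (\<forall>f. smooth_near M q f \<longrightarrow> smooth_near M q (\<lambda>r. X r f))"
  proof (intro ballI conjI allI impI)
    fix q f assume q: "q \<in> U"
    show "X q \<in> tangent_space M q" using X q by (simp add: vector_field_on_def)
    assume f: "smooth_near M q f"
    have qM: "q \<in> points M" using q openin_subset_points[OF U] by blast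
    obtain D \<phi> where c: "(D, \<phi>) \<in> atlas M" "q \<in> D"
      using chart_at[OF qM] .
    have c': "(D, \<phi>) \<in> max_atlas M" using c atlas_subset_max_atlas by blast
    have o: "openin (mtop M) (U \<inter> D)" using U max_chart_open[OF c'] by (rule openin_Int)
    have "smooth_near M q (\<lambda>r. X r (\<lambda>s. \<phi> s i))" if "i < n" for i
      using X c q that smooth_fun_on_iff[OF o] by (fastforce simp: vector_field_on_def)
    then have "smooth_near M q (\<lambda>r. \<Sum>i<n. X r (\<lambda>s. \<phi> s i) * coord_vec M (D, \<phi>) r i f)"
      by (intro smooth_near_sum[OF qM] smooth_near_mult smooth_near_coord_vec(1)[OF c' c(2) f]) auto
    then show "smooth_near M q (\<lambda>r. X r f)"
      by (rule smooth_near_cong[OF _ o])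
        (use q c X tangent_expand[OF c'] in \<open>auto simp: vector_field_on_def\<close>)
  qed
next
  assume X: "\<forall>q\<in>U. X q \<in> tangent_space M q \<and> (\<forall>f. smooth_near M q f \<longrightarrow> smooth_near M q (\<lambda>r. X r f))"
  show "vector_field_on M U X"
    unfolding vector_field_on_def
  proof (intro conjI ballI, use X in blast, clarify)
    fix D \<phi> i assume c: "(D, \<phi>) \<in> atlas M"
    have c': "(D, \<phi>) \<in> max_atlas M" using c atlas_subset_max_atlas by blast
    have o: "openin (mtop M) (U \<inter> D)" using U max_chart_open[OF c'] by (rule openin_Int)
    show "smooth_fun_on M (U \<inter> D) (\<lambda>p. X p (\<lambda>q. \<phi> q i))"
      unfolding smooth_fun_on_iff[OF o] using X smooth_near_coord[OF c'] by blast
  qed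
qed

text \<open>In coordinates, \<open>X (Y f)\<close> consists of a first-order term and of second derivatives of \<open>f\<close>; the
  latter cancel in \<open>X (Y f) - Y (X f)\<close> by the symmetry of second derivatives.\<close>

lemma lie_bracket_tangent:
  assumes U: "openin (mtop M) U" "q \<in> U" and X: "vector_field_on M U X" and Y: "vector_field_on M U Y"
  shows "lie_bracket M X Y q \<in> tangent_space M q"
proof -
  have qM: "q \<in> points M" using U openin_subset_points by blast
  obtain D \<phi> where c: "(D, \<phi>) \<in> max_atlas M" "q \<in> D" using max_chart_at[OF qM] .
  have o: "openin (mtop M) (U \<inter> D)" using U(1) max_chart_open[OF c(1)] by (rule openin_Int)
  let ?c = "\<lambda>i. coord_vec M (D, \<phi>) q i"
  \<comment> \<open>the product rule applied to \<open>Z f = \<Sum>\<^sub>i Z(\<phi>\<^sub>i) \<partial>\<^sub>i f\<close>\<close>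
  have second: "V q (\<lambda>r. Z r f) = (\<Sum>i<n. V q (\<lambda>r. Z r (\<lambda>s. \<phi> s i)) * ?c i f) +
      (\<Sum>i<n. \<Sum>j<n. Z q (\<lambda>s. \<phi> s i) * V q (\<lambda>s. \<phi> s j) * ?c j (\<lambda>r. coord_vec M (D, \<phi>) r i f))"
    if V: "vector_field_on M U V" and Z: "vector_field_on M U Z" and f: "smooth_near M q f" for V Z f
  proof -
    have v: "V q \<in> tangent_space M q" using V U(2) by (simp add: vector_field_on_def)
    have z: "Z r \<in> tangent_space M r" if "r \<in> U" for r using Z that by (simp add: vector_field_on_def)
    have sz: "smooth_near M q (\<lambda>r. Z r (\<lambda>s. \<phi> s i))" for i
      using Z U smooth_near_coord[OF c] unfolding vector_field_on_iff[OF U(1)] by blast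
    have "V q (\<lambda>r. Z r f) = V q (\<lambda>r. \<Sum>i<n. Z r (\<lambda>s. \<phi> s i) * coord_vec M (D, \<phi>) r i f)"
      by (rule tangent_local[OF v o]) (use c U(2) z tangent_expand[OF c(1)] in auto)
    also have "\<dots> = (\<Sum>i<n. V q (\<lambda>r. Z r (\<lambda>s. \<phi> s i) * coord_vec M (D, \<phi>) r i f))"
      by (rule tangent_sum[OF v]) (intro smooth_near_mult sz smooth_near_coord_vec(1)[OF c f], simp)
    also have "\<dots> = (\<Sum>i<n. V q (\<lambda>r. Z r (\<lambda>s. \<phi> s i)) * ?c i f +
        Z q (\<lambda>s. \<phi> s i) * V q (\<lambda>r. coord_vec M (D, \<phi>) r i f))"
      by (rule sum.cong[OF refl], rule tangent_mult[OF v sz smooth_near_coord_vec(1)[OF c f]]) simp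
    also have "\<dots> = (\<Sum>i<n. V q (\<lambda>r. Z r (\<lambda>s. \<phi> s i)) * ?c i f) +
        (\<Sum>i<n. Z q (\<lambda>s. \<phi> s i) * V q (\<lambda>r. coord_vec M (D, \<phi>) r i f))"
      by (rule sum.distrib)
    finally show ?thesis
      unfolding tangent_expand[OF c v, of "\<lambda>r. coord_vec M (D, \<phi>) r _ f"]
      by (simp add: sum_distrib_left mult.assoc)
  qed
  have "lie_bracket M X Y q =
      (\<lambda>f. \<Sum>i<n. (X q (\<lambda>r. Y r (\<lambda>s. \<phi> s i)) - Y q (\<lambda>r. X r (\<lambda>s. \<phi> s i))) * ?c i f)"
  proof
    fix f
    show "lie_bracket M X Y q f =
      (\<Sum>i<n. (X q (\<lambda>r. Y r (\<lambda>s. \<phi> s i)) - Y q (\<lambda>r. X r (\<lambda>s. \<phi> s i))) * ?c i f)"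
    proof (cases "smooth_near M q f")
      case f: True
      let ?x = "\<lambda>i. X q (\<lambda>s. \<phi> s i)" and ?y = "\<lambda>i. Y q (\<lambda>s. \<phi> s i)"
        and ?d = "\<lambda>j i. ?c j (\<lambda>r. coord_vec M (D, \<phi>) r i f)"
      have "(\<Sum>i<n. \<Sum>j<n. ?y i * ?x j * ?d j i) = (\<Sum>j<n. \<Sum>i<n. ?y i * ?x j * ?d j i)"
        by (rule sum.swap)
      also have "\<dots> = (\<Sum>j<n. \<Sum>i<n. ?x j * ?y i * ?d i j)"
        by (intro sum.cong refl) (simp add: coord_vec_commute[OF c f] mult.commute)
      finally show ?thesis
        unfolding second[OF X Y f] second[OF Y X f] lie_bracket_def
        using f second[OF X Y f] second[OF Y X f] by (simp add: left_diff_distrib sum_subtractf)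
    qed (simp add: lie_bracket_def coord_vec_not_smooth)
  qed
  then show ?thesis using coord_comb_tangent[OF c] by simp
qed

end


section \<open>Extending vector fields from open sets\<close>

lemma openin_box: "openin (Euclidean_space n) {x \<in> Rn n. \<forall>i<n. \<bar>x i - a i\<bar> < \<delta>}"
proof -
  have "open {x::nat \<Rightarrow> real. \<forall>i\<in>{..<n}. x i \<in> ball (a i) \<delta>}"
    by (rule product_topology_basis'[of _ "\<lambda>i. ball (a i) \<delta>" "\<lambda>i. i"]) auto
  moreover have "{x \<in> Rn n. \<forall>i<n. \<bar>x i - a i\<bar> < \<delta>} = Rn n \<inter> {x. \<forall>i\<in>{..<n}. x i \<in> ball (a i) \<delta>}"
    by (auto simp: dist_real_def abs_minus_commute)
  ultimately show ?thesis unfolding openin_Euclidean_space by blast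
qed

context smooth_structure
begin

lemma openin_points: "openin (mtop M) (points M)"
  using openin_topspace[of "mtop M"] by (simp add: topspace_mtop)

lemma continuous_map_chart_inverse:
  assumes c: "(D, \<phi>) \<in> max_atlas M"
  shows "continuous_map (subtopology (Euclidean_space n) (\<phi> ` D)) (mtop M) (inv_into D \<phi>)"
  unfolding continuous_map_def
proof (intro conjI allI impI)
  have t: "topspace (subtopology (Euclidean_space n) (\<phi> ` D)) = \<phi> ` D"
    using max_chartD(4)[OF c] by auto
  show "inv_into D \<phi> \<in> topspace (subtopology (Euclidean_space n) (\<phi> ` D)) \<rightarrow> topspace (mtop M)"
    unfolding t topspace_mtop using max_chartD(1)[OF c] by (auto simp: inv_into_into)
  fix U assume U: "openin (mtop M) U"
  have "{x \<in> \<phi> ` D. inv_into D \<phi> x \<in> U} = \<phi> ` (U \<inter> D)"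
    using max_chartD(2)[OF c] by auto
  then show "openin (subtopology (Euclidean_space n) (\<phi> ` D))
      {x \<in> topspace (subtopology (Euclidean_space n) (\<phi> ` D)). inv_into D \<phi> x \<in> U}"
    unfolding t using max_chart_image_open[OF c U] by (simp add: openin_open_subtopology[OF max_chartD(3)[OF c]] image_mono)
qed

text \<open>The support of the bump function is the preimage of a closed box, which is compact and therefore
  closed in the manifold, by the Hausdorff property. Hence extending by 0 outside the chart is
  smooth.\<close>

lemma exists_bump:
  assumes H: "Hausdorff_space (mtop M)" and U: "openin (mtop M) U" "q \<in> U"
  obtains b V C where "\<And>r. r \<in> points M \<Longrightarrow> smooth_near M r b"
    "openin (mtop M) V" "q \<in> V" "V \<subseteq> U" "\<And>r. r \<in> V \<Longrightarrow> b r = 1"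
    "closedin (mtop M) C" "C \<subseteq> U" "\<And>r. r \<notin> C \<Longrightarrow> b r = 0"
proof -
  obtain D \<phi> where c: "(D, \<phi>) \<in> max_atlas M" "q \<in> D"
    using max_chart_at openin_subset_points[OF U(1)] U(2) by blast
  note D = max_chartD[OF c(1)]
  have o: "openin (Euclidean_space n) (\<phi> ` (U \<inter> D))" by (rule max_chart_image_open[OF c(1) U(1)])
  have "\<phi> q \<in> \<phi> ` (U \<inter> D)" using U(2) c(2) by blast
  then obtain \<delta>0 where \<delta>0: "\<delta>0 > 0"
    "\<And>y. y \<in> Rn n \<Longrightarrow> (\<And>i. i < n \<Longrightarrow> \<bar>y i - \<phi> q i\<bar> < \<delta>0) \<Longrightarrow> y \<in> \<phi> ` (U \<inter> D)"
    using openin_Rn_box[OF o] by blast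
  \<comment> \<open>half the size, so that also the closed box lies in the image of \<open>U\<close>\<close>
  define \<delta> where "\<delta> = \<delta>0 / 2"
  have \<delta>: "\<delta> > 0" "\<delta> < \<delta>0" using \<delta>0(1) by (auto simp: \<delta>_def)
  define K where "K = {x \<in> Rn n. \<forall>i<n. \<bar>x i - \<phi> q i\<bar> \<le> \<delta>}"
  have K: "K \<subseteq> \<phi> ` (U \<inter> D)"
    unfolding K_def using \<delta>0(2) \<delta>(2) by fastforce
  define C where "C = inv_into D \<phi> ` K"
  have "compactin (subtopology (Euclidean_space n) (\<phi> ` D)) K"
    unfolding compactin_subtopology using compactin_box K by (auto simp: K_def)
  then have "compactin (mtop M) C"
    unfolding C_def by (rule image_compactin[OF _ continuous_map_chart_inverse[OF c(1)]])
  then have C: "closedin (mtop M) C"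
    by (rule compactin_imp_closedin[OF H])
  have CU: "C \<subseteq> U \<inter> D"
    using K D(2) by (auto simp: C_def)
  obtain b0 where b0: "smooth_on n (Rn n) b0"
    "\<And>x. (\<And>i. i < n \<Longrightarrow> \<bar>x i - \<phi> q i\<bar> \<le> \<delta> / 2) \<Longrightarrow> b0 x = 1"
    "\<And>x i. b0 x \<noteq> 0 \<Longrightarrow> i < n \<Longrightarrow> \<bar>x i - \<phi> q i\<bar> < \<delta>"
    using exists_box_bump[OF \<delta>(1)] by metis
  define b where "b r = (if r \<in> D then b0 (\<phi> r) else 0)" for r
  have bC: "b r = 0" if "r \<notin> C" for r
  proof (rule ccontr)
    assume "b r \<noteq> 0"
    then have r: "r \<in> D" "b0 (\<phi> r) \<noteq> 0" by (auto simp: b_def split: if_splits)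
    then have "\<phi> r \<in> K" using b0(3) D(4) by (fastforce simp: K_def)
    then have "inv_into D \<phi> (\<phi> r) \<in> C" unfolding C_def by blast
    then show False using r D(2) that by simp
  qed
  define V where "V = {r \<in> D. \<phi> r \<in> {x \<in> Rn n. \<forall>i<n. \<bar>x i - \<phi> q i\<bar> < \<delta> / 2}}"
  have V: "openin (mtop M) V"
    unfolding V_def by (rule max_chart_preimage_open[OF c(1) openin_box])
  have qV: "q \<in> V" using c(2) D(4) \<delta>(1) by (auto simp: V_def)
  have bV: "b r = 1" if "r \<in> V" for r
    using that b0(2)[of "\<phi> r"] by (auto simp: V_def b_def less_imp_le)
  have "V \<subseteq> C" using bV bC by fastforce
  then have "V \<subseteq> U" using CU by blast
  moreover have "smooth_near M r b" if r: "r \<in> points M" for r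
  proof (cases "r \<in> D")
    case True
    show ?thesis
      by (rule smooth_nearI[OF c(1) True D(3) _ subset_refl smooth_on_subset[OF b0(1) D(4)]])
        (use True D(2) in \<open>auto simp: b_def\<close>)
  next
    case False
    then have "r \<in> points M - C" using CU r by blast
    moreover have "openin (mtop M) (points M - C)"
      using C openin_points by blast
    ultimately show ?thesis
      using smooth_near_cong[OF smooth_near_const[OF r, of 0], of "points M - C" b] bC by simp
  qed
  ultimately show ?thesis
    using that[of b V C] V qV bV C CU bC by blast
qed

text \<open>Multiply by a bump function. The last conclusion says that the values of the new field are multiples
  of those of the old one, so that pointwise linear conditions such as tangency to a foliation
  are preserved.\<close>

lemma exists_global_extension:
  assumes H: "Hausdorff_space (mtop M)" and U: "openin (mtop M) U" "q \<in> U" and X: "vector_field_on M U X"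
  obtains X' V b where "vector_field M X'" "openin (mtop M) V" "q \<in> V" "V \<subseteq> U"
    "\<And>r. r \<in> V \<Longrightarrow> X' r = X r"
    "\<And>r. X' r = (if r \<in> U then (\<lambda>f. b r * X r f) else (\<lambda>f. 0))"
proof -
  obtain b V C where b: "\<And>r. r \<in> points M \<Longrightarrow> smooth_near M r b"
    and V: "openin (mtop M) V" "q \<in> V" "V \<subseteq> U" "\<And>r. r \<in> V \<Longrightarrow> b r = 1"
    and C: "closedin (mtop M) C" "C \<subseteq> U" "\<And>r. r \<notin> C \<Longrightarrow> b r = 0"
    using exists_bump[OF H U] by metis
  define X' where "X' r = (if r \<in> U then (\<lambda>f. b r * X r f) else (\<lambda>f. 0))" for r
  note X = X[unfolded vector_field_on_iff[OF U(1)]]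
  have "vector_field M X'"
    unfolding vector_field_on_iff[OF openin_points]
  proof (intro ballI conjI allI impI)
    fix r assume r: "r \<in> points M"
    show "X' r \<in> tangent_space M r"
      using X tangent_lincomb[of "X r" r "X r" "b r" 0] tangent_zero[OF r] by (auto simp: X'_def)
    fix f assume f: "smooth_near M r f"
    show "smooth_near M r (\<lambda>s. X' s f)"
    proof (cases "r \<in> U")
      case True
      then have "smooth_near M r (\<lambda>s. b s * X s f)"
        using X f b[OF r] by (intro smooth_near_mult) auto
      then show ?thesis
        by (rule smooth_near_cong[OF _ U(1) True]) (simp add: X'_def)
    next
      case False
      then have "r \<in> points M - C" using C(2) r by blast
      moreover have "openin (mtop M) (points M - C)"
        using C(1) openin_points by blast
      ultimately show ?thesis
        using smooth_near_cong[OF smooth_near_const[OF r, of 0], of "points M - C" "\<lambda>s. X' s f"] C(3)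
        by (simp add: X'_def)
    qed
  qed
  moreover have "X' r = X r" if "r \<in> V" for r
    using that V(3,4) by (auto simp: X'_def)
  ultimately show ?thesis using that[of X' V b] V X'_def by blast
qed

end


section \<open>Submanifolds given by slice charts\<close>

context smooth_structure
begin

lemma max_atlas_transition:
  assumes c: "(D, \<phi>) \<in> max_atlas M" and c': "(D', \<phi>') \<in> max_atlas M"
  shows "smooth_transition n (D, \<phi>) (D', \<phi>')"
  unfolding smooth_transition_def fst_conv snd_conv
proof (intro conjI allI impI)
  have "openin (Euclidean_space n) (\<phi> ` (D' \<inter> D))"
    by (rule max_chart_image_open[OF c max_chart_open[OF c']])
  then show o: "openin (Euclidean_space n) (\<phi> ` (D \<inter> D'))" by (simp add: Int_commute)
  fix i assume "i < n"
  show "smooth_on n (\<phi> ` (D \<inter> D')) (\<lambda>x. \<phi>' (inv_into D \<phi> x) i)"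
  proof (rule smooth_on_locally[OF _ openin_Rn_subset[OF o]])
    fix x assume "x \<in> \<phi> ` (D \<inter> D')"
    then obtain q where q: "x = \<phi> q" "q \<in> D" "q \<in> D'" by blast
    then show "\<exists>V. openin (Euclidean_space n) V \<and> x \<in> V \<and> smooth_on n V (\<lambda>x. \<phi>' (inv_into D \<phi> x) i)"
      using smooth_near_chart[OF c q(2), of "\<lambda>s. \<phi>' s i"] smooth_near_coord[OF c' q(3), of i]
      by (auto simp: o_def)
  qed
qed

end

text \<open>The subspace \<open>Rn m\<close> carries the topology induced from \<open>Rn n\<close>, since both carry the product
  topology.\<close>

lemma openin_Rn_slice:
  assumes "openin (Euclidean_space n) W" "m \<le> n"
  shows "openin (Euclidean_space m) (W \<inter> Rn m)"
proof -
  obtain T where "open T" "W = Rn n \<inter> T" using assms(1) unfolding openin_Euclidean_space by blast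
  moreover have "Rn m \<subseteq> Rn n" using assms(2) by simp
  ultimately show ?thesis unfolding openin_Euclidean_space by blast
qed

lemma smooth_on_slice: "smooth_on n W f \<Longrightarrow> m \<le> n \<Longrightarrow> smooth_on m (W \<inter> Rn m) f"
  using smooth_on_dim_mono smooth_on_subset by blast

text \<open>The differential of a smooth map is again a combination of coordinate vectors, by the chain
  rule.\<close>

lemma differential_tangent:
  assumes N: "smooth_structure N" and M: "smooth_structure M"
    and f: "continuous_map (mtop N) (mtop M) f"
    and pull: "\<And>h. smooth_near M (f q) h \<Longrightarrow> smooth_near N q (\<lambda>r. h (f r))"
    and v: "v \<in> tangent_space N q"
  shows "differential N M f q v \<in> tangent_space M (f q)"
    and "(D, \<phi>) \<in> max_atlas M \<Longrightarrow> f q \<in> D \<Longrightarrow> differential N M f q v =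
      (\<lambda>h. \<Sum>j<mdim M. v (\<lambda>r. \<phi> (f r) j) * coord_vec M (D, \<phi>) (f q) j h)"
proof -
  interpret N: smooth_structure N by fact
  interpret M: smooth_structure M by fact
  obtain E \<psi> where cN: "(E, \<psi>) \<in> max_atlas N" "q \<in> E"
    using N.max_chart_at[OF N.tangent_imp_point[OF v]] .
  have *: "differential N M f q v =
      (\<lambda>h. \<Sum>j<mdim M. v (\<lambda>r. \<phi> (f r) j) * coord_vec M (D, \<phi>) (f q) j h)"
    if cM: "(D, \<phi>) \<in> max_atlas M" "f q \<in> D" for D \<phi>
  proof
    fix h
    show "differential N M f q v h = (\<Sum>j<mdim M. v (\<lambda>r. \<phi> (f r) j) * coord_vec M (D, \<phi>) (f q) j h)"
    proof (cases "smooth_near M (f q) h")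
      case True
      let ?c = "coord_vec N (E, \<psi>) q" and ?d = "coord_vec M (D, \<phi>) (f q)"
      define a where "a i = v (\<lambda>r. \<psi> r i)" for i
      have va: "v g = (\<Sum>i<mdim N. a i * ?c i g)" for g
        unfolding a_def by (rule N.tangent_expand[OF cN v])
      have "v (\<lambda>r. h (f r)) = (\<Sum>i<mdim N. \<Sum>j<mdim M. a i * ?c i (\<lambda>r. \<phi> (f r) j) * ?d j h)"
        unfolding va[of "\<lambda>r. h (f r)"]
        by (rule sum.cong[OF refl])
          (simp add: coord_vec_pullback[OF N M f cN cM pull[OF M.smooth_near_coord[OF cM]] True]
            sum_distrib_left mult.assoc)
      also have "\<dots> = (\<Sum>j<mdim M. \<Sum>i<mdim N. a i * ?c i (\<lambda>r. \<phi> (f r) j) * ?d j h)"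
        by (rule sum.swap)
      also have "\<dots> = (\<Sum>j<mdim M. v (\<lambda>r. \<phi> (f r) j) * ?d j h)"
        by (simp add: va sum_distrib_right)
      finally show ?thesis using True by (simp add: differential_def o_def)
    qed (simp add: differential_def coord_vec_not_smooth)
  qed
  then show "(D, \<phi>) \<in> max_atlas M \<Longrightarrow> f q \<in> D \<Longrightarrow> differential N M f q v =
      (\<lambda>h. \<Sum>j<mdim M. v (\<lambda>r. \<phi> (f r) j) * coord_vec M (D, \<phi>) (f q) j h)" by blast
  have "f q \<in> points M"
    using continuous_map_image_subset_topspace[OF f] N.tangent_imp_point[OF v]
    by (auto simp: N.topspace_mtop M.topspace_mtop)
  then obtain D \<phi> where "(D, \<phi>) \<in> max_atlas M" "f q \<in> D" by (rule M.max_chart_at)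
  then show "differential N M f q v \<in> tangent_space M (f q)"
    using * M.coord_comb_tangent by simp
qed

locale slice_submanifold = smooth_structure M for M :: "'a mfd" +
  fixes S :: "'a set" and m :: nat
  assumes dim_le: "m \<le> mdim M"
    and slice_cover: "q \<in> S \<Longrightarrow> \<exists>D \<phi>. (D, \<phi>) \<in> max_atlas M \<and> q \<in> D \<and> \<phi> ` (D \<inter> S) = \<phi> ` D \<inter> Rn m"
begin

abbreviation "N \<equiv> submanifold M S m"

lemma points_sub: "points N = S" and mdim_sub: "mdim N = m"
  by (simp_all add: submanifold_def)

lemma atlas_sub: "c \<in> atlas N \<longleftrightarrow> (\<exists>D \<phi>. c = (D \<inter> S, \<phi>) \<and> (D, \<phi>) \<in> max_atlas M \<and> \<phi> ` (D \<inter> S) = \<phi> ` D \<inter> Rn m)"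
  by (auto simp: submanifold_def)

lemma S_subset: "S \<subseteq> points M"
  using slice_cover max_chartD(1) by blast

lemma slice_chart_at:
  assumes "q \<in> S"
  obtains D \<phi> where "(D, \<phi>) \<in> max_atlas M" "q \<in> D" "\<phi> ` (D \<inter> S) = \<phi> ` D \<inter> Rn m" "(D \<inter> S, \<phi>) \<in> atlas N"
  using slice_cover[OF assms] that unfolding atlas_sub by blast

lemma slice_mem_iff:
  assumes "(D, \<phi>) \<in> max_atlas M" "\<phi> ` (D \<inter> S) = \<phi> ` D \<inter> Rn m" "r \<in> D"
  shows "\<phi> r \<in> Rn m \<longleftrightarrow> r \<in> S"
proof
  assume "\<phi> r \<in> Rn m"
  then have "\<phi> r \<in> \<phi> ` (D \<inter> S)" using assms by blast
  then show "r \<in> S" using max_chartD(2)[OF assms(1)] assms(3) by (auto dest: inj_onD)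
qed (use assms in blast)

lemma slice_inverse:
  assumes "(D, \<phi>) \<in> max_atlas M" "x \<in> \<phi> ` (D \<inter> S)"
  shows "inv_into (D \<inter> S) \<phi> x = inv_into D \<phi> x"
  using assms max_chartD(2)[OF assms(1)] by (auto simp: inj_on_Int)

lemma smooth_structure_sub: "smooth_structure N"
proof
  fix D' \<phi> assume "(D', \<phi>) \<in> atlas N"
  then obtain D where D: "D' = D \<inter> S" "(D, \<phi>) \<in> max_atlas M" "\<phi> ` (D \<inter> S) = \<phi> ` D \<inter> Rn m"
    by (auto simp: atlas_sub)
  show "D' \<subseteq> points N" using D by (simp add: points_sub)
  show "inj_on \<phi> D'" using D max_chartD(2)[OF D(2)] by (simp add: inj_on_Int)
  show "openin (Euclidean_space (mdim N)) (\<phi> ` D')"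
    unfolding D(1,3) mdim_sub by (rule openin_Rn_slice[OF max_chartD(3)[OF D(2)] dim_le])
next
  show "\<Union> (fst ` atlas N) = points N"
  proof
    show "\<Union> (fst ` atlas N) \<subseteq> points N"
      by (auto simp: points_sub atlas_sub)
    show "points N \<subseteq> \<Union> (fst ` atlas N)"
    proof
      fix q assume "q \<in> points N"
      then have q: "q \<in> S" by (simp add: points_sub)
      then obtain D \<phi> where "(D, \<phi>) \<in> max_atlas M" "q \<in> D" "\<phi> ` (D \<inter> S) = \<phi> ` D \<inter> Rn m" "(D \<inter> S, \<phi>) \<in> atlas N"
        by (rule slice_chart_at)
      then show "q \<in> \<Union> (fst ` atlas N)" using q by force
    qed
  qed
next
  fix c c' assume "c \<in> atlas N" "c' \<in> atlas N"
  then obtain D \<phi> D' \<phi>' where c: "c = (D \<inter> S, \<phi>)" "(D, \<phi>) \<in> max_atlas M" "\<phi> ` (D \<inter> S) = \<phi> ` D \<inter> Rn m"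
    and c': "c' = (D' \<inter> S, \<phi>')" "(D', \<phi>') \<in> max_atlas M" by (auto simp: atlas_sub)
  have t: "smooth_transition n (D, \<phi>) (D', \<phi>')"
    by (rule max_atlas_transition[OF c(2) c'(2)])
  have eq: "\<phi> ` (D \<inter> S \<inter> (D' \<inter> S)) = \<phi> ` (D \<inter> D') \<inter> Rn m"
    using slice_mem_iff[OF c(2,3)] by blast
  have o: "openin (Euclidean_space m) (\<phi> ` (D \<inter> D') \<inter> Rn m)"
    using t dim_le by (intro openin_Rn_slice) (auto simp: smooth_transition_def)
  show "smooth_transition (mdim N) c c'"
    unfolding smooth_transition_def c(1) c'(1) fst_conv snd_conv mdim_sub eq
  proof (intro conjI allI impI o)
    fix i assume i: "i < m"
    then have "smooth_on n (\<phi> ` (D \<inter> D')) (\<lambda>x. \<phi>' (inv_into D \<phi> x) i)"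
      using t dim_le by (simp add: smooth_transition_def)
    from smooth_on_slice[OF this dim_le]
    show "smooth_on m (\<phi> ` (D \<inter> D') \<inter> Rn m) (\<lambda>x. \<phi>' (inv_into (D \<inter> S) \<phi> x) i)"
    proof (rule smooth_on_cong[OF o, rotated])
      fix x assume "x \<in> \<phi> ` (D \<inter> D') \<inter> Rn m"
      then have "x \<in> \<phi> ` (D \<inter> S)" using c(3) by blast
      then show "\<phi>' (inv_into D \<phi> x) i = \<phi>' (inv_into (D \<inter> S) \<phi> x) i"
        using slice_inverse[OF c(2)] by simp
    qed
  qed
qed

sublocale N: smooth_structure N
  by (rule smooth_structure_sub)

lemma mtop_sub: "mtop N = subtopology (mtop M) S"
  unfolding topology_eq
proof (intro allI iffI)
  fix U assume U: "openin (mtop N) U"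
  show "openin (subtopology (mtop M) S) U"
  proof (subst openin_subopen, intro ballI)
    fix q assume q: "q \<in> U"
    then have "q \<in> S" using N.openin_subset_points[OF U] points_sub by blast
    then obtain D \<phi> where c: "(D, \<phi>) \<in> max_atlas M" "q \<in> D" "\<phi> ` (D \<inter> S) = \<phi> ` D \<inter> Rn m" "(D \<inter> S, \<phi>) \<in> atlas N"
      by (rule slice_chart_at)
    have "openin (Euclidean_space m) (\<phi> ` (U \<inter> (D \<inter> S)))"
      using U c(4) unfolding N.openin_mtop mdim_sub by blast
    then obtain T where T: "open T" "\<phi> ` (U \<inter> (D \<inter> S)) = Rn m \<inter> T"
      unfolding openin_Euclidean_space by blast
    have "openin (Euclidean_space n) (Rn n \<inter> T)" using T(1) unfolding openin_Euclidean_space by blast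
    then have "openin (mtop M) {r \<in> D. \<phi> r \<in> Rn n \<inter> T}"
      by (rule max_chart_preimage_open[OF c(1)])
    then have "openin (subtopology (mtop M) S) ({r \<in> D. \<phi> r \<in> Rn n \<inter> T} \<inter> S)"
      unfolding openin_subtopology by blast
    moreover have "q \<in> {r \<in> D. \<phi> r \<in> Rn n \<inter> T} \<inter> S"
    proof -
      have "\<phi> q \<in> \<phi> ` (U \<inter> (D \<inter> S))" using q c(2) \<open>q \<in> S\<close> by blast
      then show ?thesis using T(2) c(2) \<open>q \<in> S\<close> max_chartD(4)[OF c(1)] by blast
    qed
    moreover have "{r \<in> D. \<phi> r \<in> Rn n \<inter> T} \<inter> S \<subseteq> U"
    proof
      fix r assume r: "r \<in> {r \<in> D. \<phi> r \<in> Rn n \<inter> T} \<inter> S"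
      then have "\<phi> r \<in> Rn m \<inter> T" using slice_mem_iff[OF c(1,3)] by blast
      then have "\<phi> r \<in> \<phi> ` (U \<inter> (D \<inter> S))" using T(2) by blast
      then show "r \<in> U" using r max_chartD(2)[OF c(1)] by (auto dest: inj_onD)
    qed
    ultimately show "\<exists>T. openin (subtopology (mtop M) S) T \<and> q \<in> T \<and> T \<subseteq> U" by blast
  qed
next
  fix U assume "openin (subtopology (mtop M) S) U"
  then obtain T where T: "openin (mtop M) T" "U = T \<inter> S" unfolding openin_subtopology by blast
  show "openin (mtop N) U"
    unfolding N.openin_mtop mdim_sub points_sub
  proof (intro conjI ballI, use T in blast, clarify)
    fix D' \<phi> assume "(D', \<phi>) \<in> atlas N"
    then obtain D where D: "D' = D \<inter> S" "(D, \<phi>) \<in> max_atlas M" "\<phi> ` (D \<inter> S) = \<phi> ` D \<inter> Rn m"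
      by (auto simp: atlas_sub)
    have "\<phi> ` (U \<inter> D') = \<phi> ` (T \<inter> D) \<inter> Rn m"
      using slice_mem_iff[OF D(2,3)] T(2) D(1) by blast
    then show "openin (Euclidean_space m) (\<phi> ` (U \<inter> D'))"
      using openin_Rn_slice[OF max_chart_image_open[OF D(2) T(1)] dim_le] by simp
  qed
qed

lemma openin_restrict: "openin (mtop M) U \<Longrightarrow> openin (mtop N) (U \<inter> S)"
  unfolding mtop_sub openin_subtopology by blast

lemma continuous_inclusion: "continuous_map (mtop N) (mtop M) (\<lambda>x. x)"
  unfolding mtop_sub by (simp add: continuous_map_from_subtopology)

lemma smooth_near_restrict:
  assumes q: "q \<in> S" and f: "smooth_near M q f"
  shows "smooth_near N q f"
proof -
  obtain D \<phi> where c: "(D, \<phi>) \<in> max_atlas M" "q \<in> D" "\<phi> ` (D \<inter> S) = \<phi> ` D \<inter> Rn m" "(D \<inter> S, \<phi>) \<in> atlas N"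
    using slice_chart_at[OF q] .
  obtain W where W: "openin (Euclidean_space n) W" "\<phi> q \<in> W" "W \<subseteq> \<phi> ` D" "smooth_on n W (f \<circ> inv_into D \<phi>)"
    using smooth_near_chart[OF c(1,2)] f by blast
  show ?thesis
  proof (rule N.smooth_nearI[OF subsetD[OF N.atlas_subset_max_atlas c(4)]])
    show "q \<in> D \<inter> S" using q c by blast
    show "openin (Euclidean_space N.n) (W \<inter> Rn m)"
      unfolding mdim_sub by (rule openin_Rn_slice[OF W(1) dim_le])
    show "\<phi> q \<in> W \<inter> Rn m" using W(2) slice_mem_iff[OF c(1,3,2)] q by blast
    show "W \<inter> Rn m \<subseteq> \<phi> ` (D \<inter> S)" using W(3) c(3) by blast
    show "smooth_on N.n (W \<inter> Rn m) (f \<circ> inv_into D \<phi>)"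
      unfolding mdim_sub by (rule smooth_on_slice[OF W(4) dim_le])
    show "(f \<circ> inv_into D \<phi>) x = f (inv_into (D \<inter> S) \<phi> x)" if "x \<in> W \<inter> Rn m" for x
    proof -
      have "x \<in> \<phi> ` (D \<inter> S)" using that W(3) c(3) by blast
      then show ?thesis using slice_inverse[OF c(1)] by simp
    qed
  qed
qed

text \<open>In a slice chart, a function on the submanifold is extended by making it independent of the
  last coordinates, that is, by composing with the projection \<open>trunc\<close> to the first \<open>m\<close> coordinates.\<close>

lemma smooth_near_extend:
  assumes f: "smooth_near N q f"
  obtains g U where "smooth_near M q g" "openin (mtop M) U" "q \<in> U" "\<And>r. r \<in> U \<inter> S \<Longrightarrow> g r = f r"
proof -
  have q: "q \<in> S" using N.smooth_near_imp_point[OF f] points_sub by blast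
  obtain D \<phi> where c: "(D, \<phi>) \<in> max_atlas M" "q \<in> D" "\<phi> ` (D \<inter> S) = \<phi> ` D \<inter> Rn m" "(D \<inter> S, \<phi>) \<in> atlas N"
    using slice_chart_at[OF q] .
  have c': "(D \<inter> S, \<phi>) \<in> max_atlas N" using c(4) N.atlas_subset_max_atlas by blast
  have inj: "inj_on \<phi> D" by (rule max_chartD(2)[OF c(1)])
  obtain V where V: "openin (Euclidean_space m) V" "\<phi> q \<in> V" "V \<subseteq> \<phi> ` (D \<inter> S)"
    "smooth_on m V (f \<circ> inv_into (D \<inter> S) \<phi>)"
    using N.smooth_near_chart[OF c', of q f] f q c(2) unfolding mdim_sub by blast
  define trunc :: "(nat \<Rightarrow> real) \<Rightarrow> nat \<Rightarrow> real" where "trunc x = (\<lambda>i. if i < m then x i else 0)" for x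
  have trunc_id: "trunc x = x" if "x \<in> Rn m" for x
    using that by (auto simp: trunc_def Rn_iff fun_eq_iff)
  have trunc_mem: "trunc x \<in> Rn m" for x by (auto simp: trunc_def Rn_iff)
  have trunc_smooth: "smooth_on n (\<phi> ` D) (\<lambda>x. trunc x j)" for j
    by (cases "j < m") (auto simp: trunc_def smooth_on_const intro: smooth_on_coord max_chartD(3)[OF c(1)])
  obtain T where T: "open T" "V = Rn m \<inter> T" using V(1) unfolding openin_Euclidean_space by blast
  define W where "W = {x \<in> \<phi> ` D. trunc x \<in> T}"
  have "continuous_on (\<phi> ` D) trunc"
    by (rule continuous_on_coordinatewise_then_product) (rule smooth_on_continuous_on[OF trunc_smooth])
  then have W: "openin (Euclidean_space n) W"
    unfolding W_def by (rule openin_Rn_preimage[OF max_chartD(3)[OF c(1)] _ T(1)])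
  have WV: "trunc x \<in> V" if "x \<in> W" for x using that trunc_mem T(2) by (auto simp: W_def)
  define g where "g r = f (inv_into (D \<inter> S) \<phi> (trunc (\<phi> r)))" for r
  have "smooth_near M q g"
  proof (rule smooth_nearI[OF c(1,2) W])
    show "\<phi> q \<in> W" using V(2) c(2) T(2) trunc_id[of "\<phi> q"] by (auto simp: W_def)
    show "W \<subseteq> \<phi> ` D" by (auto simp: W_def)
    show "smooth_on n W (\<lambda>x. (f \<circ> inv_into (D \<inter> S) \<phi>) (trunc x))"
      by (rule smooth_on_compose[OF W V(1) WV smooth_on_subset[OF trunc_smooth] V(4)]) (auto simp: W_def)
    show "(f \<circ> inv_into (D \<inter> S) \<phi>) (trunc x) = g (inv_into D \<phi> x)" if "x \<in> W" for x
      using that by (auto simp: g_def W_def f_inv_into_f)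
  qed
  moreover have "g r = f r" if "r \<in> D \<inter> S" for r
  proof -
    have "\<phi> r \<in> Rn m" using that slice_mem_iff[OF c(1,3)] by blast
    then have "g r = f (inv_into (D \<inter> S) \<phi> (\<phi> r))" by (simp add: g_def trunc_id)
    also have "inv_into (D \<inter> S) \<phi> (\<phi> r) = r"
      by (rule inv_into_f_f[OF inj_on_subset[OF inj] that]) simp
    finally show ?thesis .
  qed
  ultimately show ?thesis using that max_chart_open[OF c(1)] c(2) by blast
qed

text \<open>The differential of the inclusion. Because tangent vectors act on germs of smooth functions, it is
  the restriction of a tangent vector of the submanifold to functions that are smooth near the point
  in the ambient manifold.\<close>

abbreviation push :: "'a \<Rightarrow> 'a tvec \<Rightarrow> 'a tvec" where
  "push q \<equiv> differential N M (\<lambda>x. x) q"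

lemma push_apply: "push q v f = (if smooth_near M q f then v f else 0)"
  by (simp add: differential_def o_def)

lemma push_tangent: "v \<in> tangent_space N q \<Longrightarrow> push q v \<in> tangent_space M q"
  using differential_tangent(1)[OF smooth_structure_sub smooth_structure_axioms continuous_inclusion, of q v]
    smooth_near_restrict N.tangent_imp_point points_sub by blast

text \<open>The coordinates of a slice chart are smooth in the ambient manifold, and they determine a tangent
  vector of the submanifold.\<close>

lemma push_inj:
  assumes u: "u \<in> tangent_space N q" and v: "v \<in> tangent_space N q" and eq: "push q u = push q v"
  shows "u = v"
proof -
  have q: "q \<in> S" using N.tangent_imp_point[OF u] points_sub by blast
  obtain D \<phi> where c: "(D, \<phi>) \<in> max_atlas M" "q \<in> D" "\<phi> ` (D \<inter> S) = \<phi> ` D \<inter> Rn m" "(D \<inter> S, \<phi>) \<in> atlas N"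
    using slice_chart_at[OF q] .
  have "u (\<lambda>r. \<phi> r i) = v (\<lambda>r. \<phi> r i)" for i
    using fun_cong[OF eq, of "\<lambda>r. \<phi> r i"] smooth_near_coord[OF c(1,2)] by (simp add: push_apply)
  then show ?thesis
    using N.tangent_eqI[OF subsetD[OF N.atlas_subset_max_atlas c(4)] _ u v] q c(2) by blast
qed

end


section \<open>Tangent spaces of leaves in flat charts\<close>

lemma smooth_map_pullback:
  assumes N: "smooth_structure N" and M: "smooth_structure M" and f: "smooth_map N M f"
    and q: "q \<in> points N" and h: "smooth_near M (f q) h"
  shows "smooth_near N q (\<lambda>r. h (f r))"
proof -
  interpret N: smooth_structure N by fact
  interpret M: smooth_structure M by fact
  have cont: "continuous_map (mtop N) (mtop M) f" using f by (simp add: smooth_map_def)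
  obtain E \<psi> where cN: "(E, \<psi>) \<in> atlas N" "q \<in> E" using N.chart_at[OF q] .
  obtain D \<phi> where cM: "(D, \<phi>) \<in> atlas M" "f q \<in> D" using M.chart_at[OF M.smooth_near_imp_point[OF h]] .
  have cN': "(E, \<psi>) \<in> max_atlas N" using cN N.atlas_subset_max_atlas by blast
  have cM': "(D, \<phi>) \<in> max_atlas M" using cM M.atlas_subset_max_atlas by blast
  define U where "U = {r \<in> topspace (mtop N). f r \<in> D}"
  have U: "openin (mtop N) U" unfolding U_def
    by (rule openin_continuous_map_preimage[OF cont M.max_chart_open[OF cM']])
  have UE: "U \<inter> E = {r \<in> E. f r \<in> D}"
    using N.chartD(1)[OF cN(1)] by (auto simp: U_def N.topspace_mtop)
  have coord: "smooth_near N q (\<lambda>r. \<phi> (f r) j)" if "j < mdim M" for j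
  proof (rule N.smooth_nearI[OF cN' cN(2) N.max_chart_image_open[OF cN' U]])
    show "\<psi> q \<in> \<psi> ` (U \<inter> E)" using UE cN(2) cM(2) by blast
    show "smooth_on (mdim N) (\<psi> ` (U \<inter> E)) (\<lambda>x. \<phi> (f (inv_into E \<psi> x)) j)"
      unfolding UE using f cN(1) cM(1) that by (fastforce simp: smooth_map_def)
  qed auto
  show ?thesis
    by (rule smooth_near_pullback[OF N M cont cN' cN(2) cM' cM(2) coord h])
qed

context smooth_structure
begin

text \<open>A smooth function with countably many values is locally constant: a connected set of real numbers
  with more than one element is uncountable. Applied to a leaf in a flat chart, this shows that the
  last coordinates are locally constant in the topology of the leaf, however often the leaf returns to
  the chart.\<close>

lemma smooth_near_countable_range:
  assumes f: "smooth_near M q f" and U: "openin (mtop M) U" "q \<in> U"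
    and C: "countable C" "\<And>r. r \<in> U \<Longrightarrow> f r \<in> C"
  obtains V where "openin (mtop M) V" "q \<in> V" "\<And>r. r \<in> V \<Longrightarrow> f r = f q"
proof -
  obtain E \<psi> where c: "(E, \<psi>) \<in> max_atlas M" "q \<in> E"
    using max_chart_at[OF smooth_near_imp_point[OF f]] .
  note E = max_chartD[OF c(1)]
  obtain W where W: "openin (Euclidean_space n) W" "\<psi> q \<in> W" "W \<subseteq> \<psi> ` (U \<inter> E)"
    "smooth_on n W (f \<circ> inv_into E \<psi>)"
    using smooth_near_chart_finite[OF c, of "{()}" "\<lambda>_. f" U] f U by auto
  obtain \<delta> where \<delta>: "\<delta> > 0" "\<And>y. y \<in> Rn n \<Longrightarrow> (\<And>i. i < n \<Longrightarrow> \<bar>y i - \<psi> q i\<bar> < \<delta>) \<Longrightarrow> y \<in> W"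
    using openin_Rn_box[OF W(1,2)] by blast
  define V where "V = {r \<in> E. \<psi> r \<in> {x \<in> Rn n. \<forall>i<n. \<bar>x i - \<psi> q i\<bar> < \<delta>}}"
  have V: "openin (mtop M) V"
    unfolding V_def by (rule max_chart_preimage_open[OF c(1) openin_box])
  have qV: "q \<in> V" using c(2) E(4) \<delta>(1) by (auto simp: V_def)
  have "f r = f q" if r: "r \<in> V" for r
  proof (rule ccontr)
    assume ne: "f r \<noteq> f q"
    \<comment> \<open>the straight segment from \<open>q\<close> to \<open>r\<close> in the chart\<close>
    define \<gamma> where "\<gamma> t = (\<lambda>j. \<psi> q j + t * (\<psi> r j - \<psi> q j))" for t :: real
    have R: "\<psi> q \<in> Rn n" "\<psi> r \<in> Rn n" using r c(2) E(4) by (auto simp: V_def)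
    have \<gamma>W: "\<gamma> t \<in> W" if t: "t \<in> {0..1}" for t
    proof (rule \<delta>(2))
      show "\<gamma> t \<in> Rn n" using R by (simp add: \<gamma>_def Rn_iff)
      fix i assume i: "i < n"
      have "\<bar>t * (\<psi> r i - \<psi> q i)\<bar> \<le> 1 * \<bar>\<psi> r i - \<psi> q i\<bar>"
        unfolding abs_mult using t by (intro mult_right_mono) auto
      also have "\<dots> < \<delta>" using r i by (simp add: V_def)
      finally show "\<bar>\<gamma> t i - \<psi> q i\<bar> < \<delta>" by (simp add: \<gamma>_def)
    qed
    have c\<gamma>: "continuous_on {0..1} \<gamma>"
      unfolding \<gamma>_def by (rule continuous_on_coordinatewise_then_product) (intro continuous_intros)
    have "continuous_on {0..1} (\<lambda>t. (f \<circ> inv_into E \<psi>) (\<gamma> t))"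
      by (rule continuous_on_compose2[OF smooth_on_continuous_on[OF W(4)] c\<gamma>]) (use \<gamma>W in blast)
    then have con: "connected ((\<lambda>t. (f \<circ> inv_into E \<psi>) (\<gamma> t)) ` {0..1})"
      by (rule connected_continuous_image) simp
    have "\<gamma> 0 = \<psi> q" "\<gamma> 1 = \<psi> r" by (auto simp: \<gamma>_def)
    then have ends: "(f \<circ> inv_into E \<psi>) (\<gamma> 0) = f q" "(f \<circ> inv_into E \<psi>) (\<gamma> 1) = f r"
      using c(2) r E(2) by (auto simp: V_def)
    have "uncountable ((\<lambda>t. (f \<circ> inv_into E \<psi>) (\<gamma> t)) ` {0..1})"
    proof (rule connected_uncountable[OF con])
      show "f q \<in> (\<lambda>t. (f \<circ> inv_into E \<psi>) (\<gamma> t)) ` {0..1}" by (subst ends(1)[symmetric], rule imageI) simp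
      show "f r \<in> (\<lambda>t. (f \<circ> inv_into E \<psi>) (\<gamma> t)) ` {0..1}" by (subst ends(2)[symmetric], rule imageI) simp
    qed (use ne in simp)
    moreover have "(\<lambda>t. (f \<circ> inv_into E \<psi>) (\<gamma> t)) ` {0..1} \<subseteq> C"
    proof clarify
      fix t :: real assume "t \<in> {0..1}"
      then obtain s where "\<gamma> t = \<psi> s" "s \<in> U" "s \<in> E" using \<gamma>W W(3) by blast
      then show "(f \<circ> inv_into E \<psi>) (\<gamma> t) \<in> C" using E(2) C(2) by simp
    qed
    ultimately show False using C(1) countable_subset by blast
  qed
  then show ?thesis using that V qV by blast
qed

end

lemma sum_lessThan_truncate:
  fixes h :: "nat \<Rightarrow> real"
  shows "p \<le> n \<Longrightarrow> (\<And>i. p \<le> i \<Longrightarrow> i < n \<Longrightarrow> h i = 0) \<Longrightarrow> (\<Sum>i<n. h i) = (\<Sum>i<p. h i)"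
  by (rule sum.mono_neutral_right) auto

text \<open>The differential of the inclusion of the leaf \<open>L\<close> kills the coordinates of index at least \<open>p\<close>
  (fact \<open>vert\<close>) and is injective. So the \<open>p \<times> p\<close> matrix \<open>A\<close> of the remaining coordinates, with respect to
  a chart of \<open>L\<close>, is injective, hence invertible: every combination of the first \<open>p\<close> coordinate vectors is
  tangent to \<open>L\<close>. The case \<open>p > mdim M\<close> is excluded because \<open>A\<close> would have a zero row.\<close>

lemma
  assumes M: "smooth_structure M" and fol: "foliation M p \<F>"
    and flat: "flat_chart M p \<F> (D, \<phi>)" and q: "q \<in> D"
  shows foliation_dim_le: "p \<le> mdim M"
    and fol_tangent_flat_chart:
      "fol_tangent M \<F> q = {\<lambda>f. \<Sum>i<p. a i * coord_vec M (D, \<phi>) q i f | a. True}"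
proof -
  interpret M: smooth_structure M by fact
  have c: "(D, \<phi>) \<in> max_atlas M" using flat by (simp add: flat_chart_def)
  have qM: "q \<in> points M" using M.max_chartD(1)[OF c] q by blast
  have cover: "(\<Union>L\<in>\<F>. points L) = points M"
    and disjoint: "\<And>L L'. L \<in> \<F> \<Longrightarrow> L' \<in> \<F> \<Longrightarrow> L \<noteq> L' \<Longrightarrow> points L \<inter> points L' = {}"
    using fol by (simp_all add: foliation_def)
  obtain L where L: "L \<in> \<F>" "q \<in> points L" using cover qM by blast
  have Lfol: "smooth_manifold L" "mdim L = p" "immersion L M (\<lambda>x. x)"
    using fol L(1) by (simp_all add: foliation_def)
  have unique: "L' = L" if "L' \<in> \<F>" "q \<in> points L'" for L'
    using disjoint[OF that(1) L(1)] L(2) that(2) by blast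
  have LS: "smooth_structure L" by (rule smooth_manifold_imp_smooth_structure[OF Lfol(1)])
  interpret L: smooth_structure L by fact
  have sm: "smooth_map L M (\<lambda>x. x)" and inj: "inj_on (differential L M (\<lambda>x. x) q) (tangent_space L q)"
    using Lfol(3) L(2) by (auto simp: immersion_def)
  have cont: "continuous_map (mtop L) (mtop M) (\<lambda>x. x)" using sm by (simp add: smooth_map_def)
  have pull: "smooth_near L q h" if "smooth_near M q h" for h
    using smooth_map_pullback[OF LS M sm L(2), of h] that by simp
  define O' where "O' = {r \<in> topspace (mtop L). r \<in> D}"
  have O': "openin (mtop L) O'" "q \<in> O'"
    unfolding O'_def using openin_continuous_map_preimage[OF cont M.max_chart_open[OF c]] L(2) q
    by (auto simp: L.topspace_mtop)
  obtain C where C: "countable C"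
    "\<phi> ` (D \<inter> points L) = (\<Union>z\<in>C. {x \<in> \<phi> ` D. \<forall>i\<in>{p..<mdim M}. x i = z i})"
    using flat L(1) unfolding flat_chart_def by auto
  have vert: "v (\<lambda>r. \<phi> r i) = 0" if v: "v \<in> tangent_space L q" and i: "p \<le> i" for v i
  proof -
    \<comment> \<open>the value 0 accounts for the indices \<open>i \<ge> mdim M\<close>\<close>
    have val: "\<phi> r i \<in> insert 0 ((\<lambda>z. z i) ` C)" if "r \<in> O'" for r
    proof (cases "i < mdim M")
      case True
      have "\<phi> r \<in> \<phi> ` (D \<inter> points L)" using that by (auto simp: O'_def L.topspace_mtop)
      then obtain z where "z \<in> C" "\<forall>i\<in>{p..<mdim M}. \<phi> r i = z i" unfolding C(2) by blast
      then show ?thesis using True i by auto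
    next
      case False
      then show ?thesis using that M.max_chartD(4)[OF c] by (auto simp: O'_def Rn_iff)
    qed
    have "countable (insert 0 ((\<lambda>z. z i) ` C))" using C(1) by simp
    then obtain V where V: "openin (mtop L) V" "q \<in> V" "\<And>r. r \<in> V \<Longrightarrow> \<phi> r i = \<phi> q i"
      using L.smooth_near_countable_range[OF pull[OF M.smooth_near_coord[OF c q]] O' _ val] by blast
    have "v (\<lambda>r. \<phi> r i) = v (\<lambda>r. \<phi> q i)" by (rule L.tangent_local[OF v V])
    then show ?thesis by (simp add: L.tangent_const[OF v])
  qed
  have diff: "differential L M (\<lambda>x. x) q v = (\<lambda>h. \<Sum>j<mdim M. v (\<lambda>r. \<phi> r j) * coord_vec M (D, \<phi>) q j h)"
    if "v \<in> tangent_space L q" for v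
    using differential_tangent(2)[OF LS M cont pull that c] q by simp
  obtain E \<psi> where e: "(E, \<psi>) \<in> max_atlas L" "q \<in> E" using L.max_chart_at[OF L(2)] .
  define A where "A = Matrix.mat p p (\<lambda>(i, j). coord_vec L (E, \<psi>) q j (\<lambda>r. \<phi> r i))"
  have A: "A \<in> carrier_mat p p" by (simp add: A_def)
  define vec_of where "vec_of x = (\<lambda>f. \<Sum>j<p. x $ j * coord_vec L (E, \<psi>) q j f)" for x :: "real Matrix.vec"
  have vT: "vec_of x \<in> tangent_space L q" for x
    using L.coord_comb_tangent[OF e, of "\<lambda>j. x $ j"] by (simp add: vec_of_def Lfol(2))
  have Ax: "vec_of x (\<lambda>r. \<phi> r i) = (A *\<^sub>v x) $ i" if "x \<in> carrier_vec p" "i < p" for x i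
    using that by (simp add: vec_of_def A_def scalar_prod_def lessThan_atLeast0 mult.commute)
  have "Determinant.det A \<noteq> 0"
  proof
    assume "Determinant.det A = 0"
    then obtain x where x: "x \<in> carrier_vec p" "x \<noteq> 0\<^sub>v p" "A *\<^sub>v x = 0\<^sub>v p"
      using det_0_iff_vec_prod_zero[OF A] by blast
    have "vec_of x (\<lambda>r. \<phi> r i) = 0" for i
      using Ax[OF x(1), of i] x(3) vert[OF vT] by (cases "i < p") auto
    then have "differential L M (\<lambda>x. x) q (vec_of x) = (\<lambda>h. 0)"
      using diff[OF vT] by simp
    moreover have "differential L M (\<lambda>x. x) q (\<lambda>f. 0) = (\<lambda>h. 0)"
      by (simp add: differential_def)
    ultimately have "vec_of x = (\<lambda>f. 0)"
      using inj_onD[OF inj, of "vec_of x" "\<lambda>f. 0"] vT L.tangent_zero[OF L(2)] by simp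
    then have "x $ j = 0" if "j < p" for j
      using L.coord_comb_coord[OF e, of j "\<lambda>j. x $ j"] that
      by (simp add: vec_of_def Lfol(2) fun_eq_iff)
    then show False using x(1,2) by (auto intro: eq_vecI)
  qed
  then have "A \<in> Units (ring_mat TYPE(real) p ())"
    by (rule det_non_zero_imp_unit[OF A])
  then obtain B where B: "B \<in> carrier_mat p p" "A * B = 1\<^sub>m p"
    unfolding Units_def by (auto simp: ring_mat_simps)
  have solve: "\<exists>x\<in>carrier_vec p. \<forall>i<p. vec_of x (\<lambda>r. \<phi> r i) = a i" for a
  proof (intro bexI allI impI)
    let ?x = "B *\<^sub>v Matrix.vec p a"
    show x: "?x \<in> carrier_vec p" using B(1) by simp
    fix i assume i: "i < p"
    have "A *\<^sub>v ?x = (A * B) *\<^sub>v Matrix.vec p a"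
      using A B(1) by (simp add: assoc_mult_mat_vec)
    then show "vec_of ?x (\<lambda>r. \<phi> r i) = a i"
      using Ax[OF x i] B(2) i by simp
  qed
  show le: "p \<le> mdim M"
  proof (rule ccontr)
    assume "\<not> p \<le> mdim M"
    then have n: "mdim M < p" by simp
    obtain x where x: "vec_of x (\<lambda>r. \<phi> r (mdim M)) = 1"
      using solve[of "\<lambda>_. 1"] n by blast
    have "vec_of x (\<lambda>r. \<phi> r (mdim M)) = vec_of x (\<lambda>r. 0)"
      by (rule L.tangent_local[OF vT O']) (use M.max_chartD(4)[OF c] in \<open>auto simp: O'_def Rn_iff\<close>)
    then show False using x L.tangent_const[OF vT] by simp
  qed
  have diff_p: "differential L M (\<lambda>x. x) q v = (\<lambda>h. \<Sum>j<p. v (\<lambda>r. \<phi> r j) * coord_vec M (D, \<phi>) q j h)"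
    if "v \<in> tangent_space L q" for v
    unfolding diff[OF that] by (rule ext, rule sum_lessThan_truncate[OF le]) (simp add: vert[OF that])
  show "fol_tangent M \<F> q = {\<lambda>f. \<Sum>i<p. a i * coord_vec M (D, \<phi>) q i f | a. True}"
  proof (intro equalityI subsetI)
    fix w assume "w \<in> fol_tangent M \<F> q"
    then obtain v where "w = differential L M (\<lambda>x. x) q v" "v \<in> tangent_space L q"
      unfolding fol_tangent_def using unique by blast
    then show "w \<in> {\<lambda>f. \<Sum>i<p. a i * coord_vec M (D, \<phi>) q i f | a. True}"
      using diff_p by auto
  next
    fix w assume "w \<in> {\<lambda>f. \<Sum>i<p. a i * coord_vec M (D, \<phi>) q i f | a. True}"
    then obtain a where a: "w = (\<lambda>f. \<Sum>i<p. a i * coord_vec M (D, \<phi>) q i f)" by blast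
    obtain x where "\<forall>i<p. vec_of x (\<lambda>r. \<phi> r i) = a i" using solve[of a] by blast
    then have "w = differential L M (\<lambda>x. x) q (vec_of x)"
      unfolding diff_p[OF vT] a by (intro ext sum.cong) auto
    then show "w \<in> fol_tangent M \<F> q"
      unfolding fol_tangent_def using vT L by blast
  qed
qed


section \<open>The normal part as a Gram-Schmidt residual\<close>

text \<open>The Gram-Schmidt process without normalisation: \<open>gs_residual g e j v\<close> is the component of \<open>v\<close>
  orthogonal to \<open>e 0, \<dots>, e (j - 1)\<close>. The vector subtracted in step \<open>j\<close> is the projection onto the residual of
  \<open>e j\<close>. All operations are rational, so smooth dependence on a parameter is inherited.\<close>

primrec gs_residual :: "('a tvec \<Rightarrow> 'a tvec \<Rightarrow> real) \<Rightarrow> (nat \<Rightarrow> 'a tvec) \<Rightarrow> nat \<Rightarrow> 'a tvec \<Rightarrow> 'a tvec" where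
  "gs_residual g e 0 v = v"
| "gs_residual g e (Suc j) v = (\<lambda>f. gs_residual g e j v f -
     g (gs_residual g e j v) (gs_residual g e j (e j)) / g (gs_residual g e j (e j)) (gs_residual g e j (e j)) * gs_residual g e j (e j) f)"

text \<open>Tangent vectors are real functions, so a tangent space is a set of functions closed under linear
  combinations.\<close>

locale tvec_inner_product =
  fixes T :: "'a tvec set" and g :: "'a tvec \<Rightarrow> 'a tvec \<Rightarrow> real"
  assumes lincomb: "u \<in> T \<Longrightarrow> v \<in> T \<Longrightarrow> (\<lambda>f. a * u f + b * v f) \<in> T"
    and sym: "u \<in> T \<Longrightarrow> v \<in> T \<Longrightarrow> g u v = g v u"
    and lin: "u \<in> T \<Longrightarrow> v \<in> T \<Longrightarrow> w \<in> T \<Longrightarrow> g (\<lambda>f. a * u f + b * v f) w = a * g u w + b * g v w"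
    and pos: "v \<in> T \<Longrightarrow> v \<noteq> (\<lambda>f. 0) \<Longrightarrow> g v v > 0"
    and zero: "(\<lambda>f. 0) \<in> T"
begin

lemma sum_in: "(\<And>i::nat. i < k \<Longrightarrow> e i \<in> T) \<Longrightarrow> (\<lambda>f. \<Sum>i<k. a i * e i f) \<in> T"
proof (induction k)
  case (Suc k)
  then show ?case using lincomb[of "\<lambda>f. \<Sum>i<k. a i * e i f" "e k" 1 "a k"] by simp
qed (simp add: zero)

lemma zero_left: "w \<in> T \<Longrightarrow> g (\<lambda>f. 0) w = 0"
  using lin[OF zero zero, of w 0 0] by simp

lemma sum_left:
  "(\<And>i::nat. i < k \<Longrightarrow> e i \<in> T) \<Longrightarrow> w \<in> T \<Longrightarrow> g (\<lambda>f. \<Sum>i<k. a i * e i f) w = (\<Sum>i<k. a i * g (e i) w)"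
proof (induction k)
  case (Suc k)
  then show ?case
    using lin[of "\<lambda>f. \<Sum>i<k. a i * e i f" "e k" w 1 "a k"] sum_in[of k e a] by simp
qed (simp add: zero_left)

lemma diff_in: "u \<in> T \<Longrightarrow> v \<in> T \<Longrightarrow> (\<lambda>f. u f - v f) \<in> T"
  using lincomb[of u v 1 "-1"] by simp

lemma diff_left: "u \<in> T \<Longrightarrow> v \<in> T \<Longrightarrow> w \<in> T \<Longrightarrow> g (\<lambda>f. u f - v f) w = g u w - g v w"
  using lin[of u v w 1 "-1"] by simp

lemma gs_residual_properties:
  assumes e: "\<And>i. i < k \<Longrightarrow> e i \<in> T"
    and indep: "\<And>a. (\<lambda>f. \<Sum>i<k. a i * e i f) = (\<lambda>f. 0) \<Longrightarrow> \<forall>i<k. a i = 0"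
  shows "j \<le> k \<Longrightarrow> v \<in> T \<Longrightarrow> gs_residual g e j v \<in> T"
    and "j \<le> k \<Longrightarrow> v \<in> T \<Longrightarrow> \<exists>a. gs_residual g e j v = (\<lambda>f. v f - (\<Sum>i<j. a i * e i f))"
    and "j \<le> k \<Longrightarrow> v \<in> T \<Longrightarrow> i < j \<Longrightarrow> g (gs_residual g e j v) (e i) = 0"
    and "j < k \<Longrightarrow> gs_residual g e j (e j) \<noteq> (\<lambda>f. 0)"
proof -
  have main: "(\<forall>v\<in>T. gs_residual g e j v \<in> T \<and> (\<exists>a. gs_residual g e j v = (\<lambda>f. v f - (\<Sum>i<j. a i * e i f))) \<and>
      (\<forall>i<j. g (gs_residual g e j v) (e i) = 0)) \<and> (j < k \<longrightarrow> gs_residual g e j (e j) \<noteq> (\<lambda>f. 0))"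
    if "j \<le> k" for j
    using that
  proof (induction j)
    case 0
    have "e 0 \<noteq> (\<lambda>f. 0)" if "0 < k"
    proof
      assume "e 0 = (\<lambda>f. 0)"
      moreover have "(\<lambda>f. \<Sum>i<k. (if i = 0 then 1 else 0) * e i f) = (\<lambda>f. e 0 f)"
        using that by (simp add: if_distrib[of "\<lambda>x. x * _"] cong: if_cong)
      ultimately have "\<forall>i<k. (if i = 0 then 1 else 0::real) = 0"
        by (intro indep) simp
      then show False using that by auto
    qed
    then show ?case by (auto intro: exI[of _ "\<lambda>_. 0"])
  next
    case (Suc j)
    then have j: "j < k" by simp
    define w where "w = gs_residual g e j (e j)"
    have w: "w \<in> T" "w \<noteq> (\<lambda>f. 0)" using Suc.IH j e[OF j] by (auto simp: w_def)
    obtain b where b: "w = (\<lambda>f. e j f - (\<Sum>i<j. b i * e i f))"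
      using Suc.IH j e[OF j] unfolding w_def by fastforce
    have wpos: "g w w > 0" by (rule pos[OF w])
    have part: "gs_residual g e (Suc j) v \<in> T \<and> (\<exists>a. gs_residual g e (Suc j) v = (\<lambda>f. v f - (\<Sum>i<Suc j. a i * e i f))) \<and>
      (\<forall>i<Suc j. g (gs_residual g e (Suc j) v) (e i) = 0)" if v: "v \<in> T" for v
    proof -
      define u where "u = gs_residual g e j v"
      define c where "c = g u w / g w w"
      have u: "u \<in> T" "\<And>i. i < j \<Longrightarrow> g u (e i) = 0" using Suc.IH j v by (auto simp: u_def)
      obtain a where a: "u = (\<lambda>f. v f - (\<Sum>i<j. a i * e i f))"
        using Suc.IH j v unfolding u_def by fastforce
      have step: "gs_residual g e (Suc j) v = (\<lambda>f. 1 * u f + (- c) * w f)"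
        by (simp add: u_def c_def w_def)
      have T': "gs_residual g e (Suc j) v \<in> T" unfolding step by (rule lincomb[OF u(1) w(1)])
      have "gs_residual g e (Suc j) v = (\<lambda>f. v f - (\<Sum>i<Suc j. (if i = j then c else a i - c * b i) * e i f))"
        unfolding step by (rule ext, subst a, subst b)
          (simp add: algebra_simps sum_subtractf sum_distrib_left sum_negf)
      moreover have lt: "g (gs_residual g e (Suc j) v) (e i) = 0" if "i < j" for i
      proof -
        have "g w (e i) = 0" using Suc.IH j e[OF j] that by (auto simp: w_def)
        moreover have "e i \<in> T" using e that j by simp
        ultimately show ?thesis unfolding step lin[OF u(1) w(1) \<open>e i \<in> T\<close>] using u(2)[OF that] by simp
      qed
      moreover have "g (gs_residual g e (Suc j) v) (e j) = 0"
      proof -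
        let ?r = "gs_residual g e (Suc j) v"
        have eT: "e i \<in> T" if "i < j" for i using e that j by simp
        \<comment> \<open>\<open>w\<close> and \<open>e j\<close> differ by a combination of earlier vectors, to which the residual is orthogonal\<close>
        have "g w ?r = g (e j) ?r - (\<Sum>i<j. b i * g (e i) ?r)"
          unfolding b using diff_left[OF e[OF j] sum_in[OF eT] T'] sum_left[OF eT T'] by simp
        also have "(\<Sum>i<j. b i * g (e i) ?r) = 0"
          by (rule sum.neutral) (use lt sym[OF eT T'] in auto)
        finally have "g (e j) ?r = g w ?r" by simp
        also have "\<dots> = g ?r w" by (rule sym[OF w(1) T'])
        also have "\<dots> = 0"
          unfolding step lin[OF u(1) w(1) w(1)] using wpos by (simp add: c_def)
        finally show ?thesis using sym[OF T' e[OF j]] by simp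
      qed
      ultimately have eqs: "gs_residual g e (Suc j) v = (\<lambda>f. v f - (\<Sum>i<Suc j. (if i = j then c else a i - c * b i) * e i f))"
        and lt: "\<And>i. i < j \<Longrightarrow> g (gs_residual g e (Suc j) v) (e i) = 0" and last: "g (gs_residual g e (Suc j) v) (e j) = 0"
        by blast+
      show ?thesis
      proof (intro conjI allI impI T')
        show "\<exists>a. gs_residual g e (Suc j) v = (\<lambda>f. v f - (\<Sum>i<Suc j. a i * e i f))" 
          by (intro exI[of _ "\<lambda>i. if i = j then c else a i - c * b i"]) (rule eqs)
        show "g (gs_residual g e (Suc j) v) (e i) = 0" if "i < Suc j" for i
          by (cases "i = j") (use last lt[of i] that in \<open>auto simp del: gs_residual.simps\<close>)
      qed
    qed
    have "gs_residual g e (Suc j) (e (Suc j)) \<noteq> (\<lambda>f. 0)" if l: "Suc j < k"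
    proof
      assume z: "gs_residual g e (Suc j) (e (Suc j)) = (\<lambda>f. 0)"
      obtain a where a: "gs_residual g e (Suc j) (e (Suc j)) = (\<lambda>f. e (Suc j) f - (\<Sum>i<Suc j. a i * e i f))"
        using part[OF e[OF l]] by blast
      define a' where "a' i = (if i < Suc j then - a i else if i = Suc j then 1 else 0)" for i
      have "(\<Sum>i<k. a' i * e i f) = (\<Sum>i<Suc (Suc j). a' i * e i f)" for f
        by (rule sum_lessThan_truncate) (use l in \<open>auto simp: a'_def\<close>)
      also have "(\<Sum>i<Suc (Suc j). a' i * e i f) = e (Suc j) f - (\<Sum>i<Suc j. a i * e i f)" for f
        by (simp add: a'_def sum_negf)
      finally have "(\<lambda>f. \<Sum>i<k. a' i * e i f) = (\<lambda>f. 0)"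
        using z unfolding a by (simp add: fun_eq_iff)
      from indep[OF this] have "a' (Suc j) = 0" using l by blast
      then show False by (simp add: a'_def)
    qed
    then show ?case using part by blast
  qed
  show "j \<le> k \<Longrightarrow> v \<in> T \<Longrightarrow> gs_residual g e j v \<in> T"
    "j \<le> k \<Longrightarrow> v \<in> T \<Longrightarrow> \<exists>a. gs_residual g e j v = (\<lambda>f. v f - (\<Sum>i<j. a i * e i f))"
    "j \<le> k \<Longrightarrow> v \<in> T \<Longrightarrow> i < j \<Longrightarrow> g (gs_residual g e j v) (e i) = 0"
    using main[of j] by blast+
  show "j < k \<Longrightarrow> gs_residual g e j (e j) \<noteq> (\<lambda>f. 0)" using main[of j] by simp
qed

end

locale riemannian_foliation = smooth_structure M for M :: "'a mfd" +
  fixes p :: nat and \<F> :: "'a mfd set" and g :: "'a metric"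
  assumes fol: "foliation M p \<F>" and metric: "riemannian_metric M g"
begin

lemma inner: "q \<in> points M \<Longrightarrow> tvec_inner_product (tangent_space M q) (g q)"
  using metric unfolding riemannian_metric_def
  by unfold_locales (auto intro: tangent_lincomb tangent_zero)

lemma coord_vec_tangent:
  assumes c: "(D, \<phi>) \<in> max_atlas M" "q \<in> D" and i: "i < n"
  shows "coord_vec M (D, \<phi>) q i \<in> tangent_space M q"
proof -
  have "(\<lambda>f. \<Sum>l<n. (if l = i then 1 else 0) * coord_vec M (D, \<phi>) q l f) = coord_vec M (D, \<phi>) q i"
    using i by (simp add: if_distrib[of "\<lambda>x. x * _"] cong: if_cong)
  then show ?thesis using coord_comb_tangent[OF c, of "\<lambda>l. if l = i then 1 else 0"] by simp
qed

lemma smooth_near_metric: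
  assumes U: "openin (mtop M) U" "q \<in> U" and Y: "vector_field_on M U Y" and Z: "vector_field_on M U Z"
  shows "smooth_near M q (\<lambda>r. g r (Y r) (Z r))"
proof -
  have qM: "q \<in> points M" using U openin_subset_points by blast
  obtain D \<phi> where c: "(D, \<phi>) \<in> atlas M" "q \<in> D" using chart_at[OF qM] .
  have c': "(D, \<phi>) \<in> max_atlas M" using c atlas_subset_max_atlas by blast
  let ?c = "\<lambda>r i. coord_vec M (D, \<phi>) r i"
  note Y = Y[unfolded vector_field_on_iff[OF U(1)]] and Z = Z[unfolded vector_field_on_iff[OF U(1)]]
  have o: "openin (mtop M) (U \<inter> D)" using U(1) max_chart_open[OF c'] by (rule openin_Int)
  have gs: "smooth_near M q (\<lambda>r. g r (?c r i) (?c r j))" if "i < n" "j < n" for i j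
    using metric c that smooth_fun_on_iff[OF max_chart_open[OF c']]
    unfolding riemannian_metric_def by force
  have "smooth_near M q (\<lambda>r. \<Sum>i<n. Y r (\<lambda>s. \<phi> s i) * (\<Sum>j<n. Z r (\<lambda>s. \<phi> s j) * g r (?c r i) (?c r j)))"
    by (intro smooth_near_sum[OF qM] smooth_near_mult gs)
      (use Y Z U(2) smooth_near_coord[OF c' c(2)] in auto)
  then show ?thesis
  proof (rule smooth_near_cong[OF _ o])
    show "q \<in> U \<inter> D" using U c by blast
    fix r assume r: "r \<in> U \<inter> D"
    then have rM: "r \<in> points M" using openin_subset_points[OF U(1)] by blast
    interpret I: tvec_inner_product "tangent_space M r" "g r" by (rule inner[OF rM])
    have y: "Y r \<in> tangent_space M r" and z: "Z r \<in> tangent_space M r" using Y Z r by auto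
    have cT: "?c r i \<in> tangent_space M r" if "i < n" for i
      using coord_vec_tangent[OF c' _ that] r by blast
    have exp: "V = (\<lambda>f. \<Sum>i<n. V (\<lambda>s. \<phi> s i) * ?c r i f)" if "V \<in> tangent_space M r" for V
      using tangent_expand[OF c' _ that] r by blast
    have z': "g r (?c r i) (Z r) = (\<Sum>j<n. Z r (\<lambda>s. \<phi> s j) * g r (?c r i) (?c r j))" if "i < n" for i
    proof -
      have "g r (?c r i) (Z r) = g r (Z r) (?c r i)" by (rule I.sym[OF cT[OF that] z])
      also have "\<dots> = (\<Sum>j<n. Z r (\<lambda>s. \<phi> s j) * g r (?c r j) (?c r i))"
        by (subst exp[OF z], rule I.sum_left[OF cT cT[OF that]])
      finally show ?thesis using I.sym[OF cT cT[OF that]] by simp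
    qed
    have "g r (Y r) (Z r) = (\<Sum>i<n. Y r (\<lambda>s. \<phi> s i) * g r (?c r i) (Z r))"
      by (subst exp[OF y], rule I.sum_left[OF cT z])
    then show "(\<Sum>i<n. Y r (\<lambda>s. \<phi> s i) * (\<Sum>j<n. Z r (\<lambda>s. \<phi> s j) * g r (?c r i) (?c r j))) = g r (Y r) (Z r)"
      by (simp add: z')
  qed
qed

lemma flat_chart_at:
  assumes "q \<in> points M"
  obtains D \<phi> where "flat_chart M p \<F> (D, \<phi>)" "(D, \<phi>) \<in> max_atlas M" "q \<in> D" "p \<le> n"
proof -
  obtain c where c: "q \<in> fst c" "flat_chart M p \<F> c"
    using fol assms unfolding foliation_def by blast
  then have f: "flat_chart M p \<F> (fst c, snd c)" by simp
  then have "(fst c, snd c) \<in> max_atlas M" by (simp add: flat_chart_def)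
  then show ?thesis
    using that[OF f _ c(1)] foliation_dim_le[OF smooth_structure_axioms fol f c(1)] by blast
qed

lemma coord_vec_independent:
  assumes c: "(D, \<phi>) \<in> max_atlas M" "q \<in> D" and k: "k \<le> n"
    and z: "(\<lambda>f. \<Sum>i<k. a i * coord_vec M (D, \<phi>) q i f) = (\<lambda>f. 0)"
  shows "\<forall>i<k. a i = 0"
proof (intro allI impI)
  fix i assume i: "i < k"
  have "(\<Sum>l<n. (if l < k then a l else 0) * coord_vec M (D, \<phi>) q l (\<lambda>r. \<phi> r i))
      = (\<Sum>l<k. (if l < k then a l else 0) * coord_vec M (D, \<phi>) q l (\<lambda>r. \<phi> r i))"
    by (rule sum_lessThan_truncate[OF k]) simp
  then show "a i = 0"
    using coord_comb_coord[OF c, of i "\<lambda>l. if l < k then a l else 0"] fun_cong[OF z, of "\<lambda>r. \<phi> r i"] i k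
    by simp
qed

context
  fixes D \<phi>
  assumes flat: "flat_chart M p \<F> (D, \<phi>)" and c: "(D, \<phi>) \<in> max_atlas M" and le: "p \<le> n"
begin

abbreviation "leaf_frame q \<equiv> (\<lambda>i. coord_vec M (D, \<phi>) q i)"

lemma fol_tangent_D: "q \<in> D \<Longrightarrow> t \<in> fol_tangent M \<F> q \<longleftrightarrow> (\<exists>a. t = (\<lambda>f. \<Sum>i<p. a i * leaf_frame q i f))"
  using fol_tangent_flat_chart[OF smooth_structure_axioms fol flat] by auto

lemma point_D: "q \<in> D \<Longrightarrow> q \<in> points M"
  using max_chartD(1)[OF c] by blast

lemma gs_residual_frame:
  assumes q: "q \<in> D"
  shows "j \<le> p \<Longrightarrow> v \<in> tangent_space M q \<Longrightarrow> gs_residual (g q) (leaf_frame q) j v \<in> tangent_space M q"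
    and "j \<le> p \<Longrightarrow> v \<in> tangent_space M q \<Longrightarrow>
      \<exists>a. gs_residual (g q) (leaf_frame q) j v = (\<lambda>f. v f - (\<Sum>i<j. a i * leaf_frame q i f))"
    and "j \<le> p \<Longrightarrow> v \<in> tangent_space M q \<Longrightarrow> i < j \<Longrightarrow> g q (gs_residual (g q) (leaf_frame q) j v) (leaf_frame q i) = 0"
    and "j < p \<Longrightarrow> gs_residual (g q) (leaf_frame q) j (leaf_frame q j) \<noteq> (\<lambda>f. 0)"
proof -
  interpret I: tvec_inner_product "tangent_space M q" "g q" by (rule inner[OF point_D[OF q]])
  have e: "leaf_frame q i \<in> tangent_space M q" if "i < p" for i
    using coord_vec_tangent[OF c q] that le by simp
  have ind: "\<forall>i<p. a i = 0" if "(\<lambda>f. \<Sum>i<p. a i * leaf_frame q i f) = (\<lambda>f. 0)" for a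
    by (rule coord_vec_independent[OF c q le that])
  note P = I.gs_residual_properties[where e = "leaf_frame q" and k = p, OF e ind]
  show "j \<le> p \<Longrightarrow> v \<in> tangent_space M q \<Longrightarrow> gs_residual (g q) (leaf_frame q) j v \<in> tangent_space M q"
    "j \<le> p \<Longrightarrow> v \<in> tangent_space M q \<Longrightarrow>
      \<exists>a. gs_residual (g q) (leaf_frame q) j v = (\<lambda>f. v f - (\<Sum>i<j. a i * leaf_frame q i f))"
    "j \<le> p \<Longrightarrow> v \<in> tangent_space M q \<Longrightarrow> i < j \<Longrightarrow> g q (gs_residual (g q) (leaf_frame q) j v) (leaf_frame q i) = 0"
    "j < p \<Longrightarrow> gs_residual (g q) (leaf_frame q) j (leaf_frame q j) \<noteq> (\<lambda>f. 0)"
    using P by blast+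
qed

lemma vector_field_on_coord_vec:
  assumes U: "openin (mtop M) U" "U \<subseteq> D" and i: "i < n"
  shows "vector_field_on M U (\<lambda>r. coord_vec M (D, \<phi>) r i)"
  unfolding vector_field_on_iff[OF U(1)]
  using coord_vec_tangent[OF c _ i] smooth_near_coord_vec(1)[OF c _ _ i] U(2) by blast

lemma vector_field_on_gs_residual:
  assumes U: "openin (mtop M) U" "U \<subseteq> D"
  shows "j \<le> p \<Longrightarrow> vector_field_on M U V \<Longrightarrow> vector_field_on M U (\<lambda>r. gs_residual (g r) (leaf_frame r) j (V r))"
proof (induction j arbitrary: V)
  case (Suc j)
  let ?w = "\<lambda>r. gs_residual (g r) (leaf_frame r) j (leaf_frame r j)"
  let ?u = "\<lambda>r. gs_residual (g r) (leaf_frame r) j (V r)"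
  have w: "vector_field_on M U ?w" and u: "vector_field_on M U ?u"
    using Suc.IH[of V] Suc.IH[OF _ vector_field_on_coord_vec[OF U, of j]] Suc.prems le by simp_all
  have V: "\<forall>r\<in>U. V r \<in> tangent_space M r" using Suc.prems(2) by (simp add: vector_field_on_def)
  show ?case
    unfolding vector_field_on_iff[OF U(1)]
  proof (intro ballI conjI allI impI)
    fix r assume r: "r \<in> U"
    then show "gs_residual (g r) (leaf_frame r) (Suc j) (V r) \<in> tangent_space M r"
      using gs_residual_frame(1)[of r "Suc j" "V r"] U(2) V Suc.prems(1) by blast
    fix f assume f: "smooth_near M r f"
    have "smooth_near M r (\<lambda>s. ?u s f + (- 1) * ((g s (?u s) (?w s) * inverse (g s (?w s) (?w s))) * ?w s f))"
    proof (intro smooth_near_add smooth_near_mult smooth_near_const)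
      show "r \<in> points M" using r U(2) point_D by blast
      show "smooth_near M r (\<lambda>s. ?u s f)" "smooth_near M r (\<lambda>s. ?w s f)"
        using u w f r unfolding vector_field_on_iff[OF U(1)] by blast+
      show "smooth_near M r (\<lambda>s. g s (?u s) (?w s))" by (rule smooth_near_metric[OF U(1) r u w])
      show "smooth_near M r (\<lambda>s. inverse (g s (?w s) (?w s)))"
      proof (rule smooth_near_inverse[OF smooth_near_metric[OF U(1) r w w] U(1) r])
        fix s assume s: "s \<in> U"
        then have sD: "s \<in> D" using U(2) by blast
        have "?w s \<noteq> (\<lambda>f. 0)" using gs_residual_frame(4)[OF sD, of j] Suc.prems(1) by simp
        moreover have "?w s \<in> tangent_space M s" using w s by (simp add: vector_field_on_def)
        ultimately show "g s (?w s) (?w s) \<noteq> 0"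
          using tvec_inner_product.pos[OF inner[OF point_D[OF sD]]] by fastforce
      qed
    qed
    then show "smooth_near M r (\<lambda>s. gs_residual (g s) (leaf_frame s) (Suc j) (V s) f)"
      by (simp add: divide_inverse)
  qed
qed simp

text \<open>The residual solves the conditions that define \<^const>\<open>normal_part\<close>, and two solutions differ by a
  vector that is both tangent to the leaf and orthogonal to it.\<close>

lemma normal_part_gs_residual:
  assumes q: "q \<in> D" and v: "v \<in> tangent_space M q"
  shows "normal_part M \<F> g q v = gs_residual (g q) (leaf_frame q) p v"
    and "\<And>u. u \<in> tangent_space M q \<Longrightarrow> (\<lambda>f. v f - u f) \<in> fol_tangent M \<F> q \<Longrightarrow>
      (\<forall>t\<in>fol_tangent M \<F> q. g q u t = 0) \<Longrightarrow> u = gs_residual (g q) (leaf_frame q) p v"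
    and "(\<lambda>f. v f - gs_residual (g q) (leaf_frame q) p v f) \<in> fol_tangent M \<F> q"
    and "\<forall>t\<in>fol_tangent M \<F> q. g q (gs_residual (g q) (leaf_frame q) p v) t = 0"
proof -
  interpret I: tvec_inner_product "tangent_space M q" "g q" by (rule inner[OF point_D[OF q]])
  have e: "leaf_frame q i \<in> tangent_space M q" if "i < p" for i
    using coord_vec_tangent[OF c q] that le by simp
  let ?u = "gs_residual (g q) (leaf_frame q) p v"
  have uT: "?u \<in> tangent_space M q" by (rule gs_residual_frame(1)[OF q order_refl v])
  obtain a where a: "?u = (\<lambda>f. v f - (\<Sum>i<p. a i * leaf_frame q i f))"
    using gs_residual_frame(2)[OF q order_refl v] by blast
  show d: "(\<lambda>f. v f - ?u f) \<in> fol_tangent M \<F> q"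
    unfolding fol_tangent_D[OF q] a by (rule exI[of _ a]) simp
  show orth: "\<forall>t\<in>fol_tangent M \<F> q. g q ?u t = 0"
  proof
    fix t assume "t \<in> fol_tangent M \<F> q"
    then obtain b where t: "t = (\<lambda>f. \<Sum>i<p. b i * leaf_frame q i f)" unfolding fol_tangent_D[OF q] by blast
    have tT: "t \<in> tangent_space M q" unfolding t by (rule I.sum_in[OF e])
    have "g q ?u t = g q t ?u" by (rule I.sym[OF uT tT])
    also have "\<dots> = (\<Sum>i<p. b i * g q (leaf_frame q i) ?u)"
      unfolding t by (rule I.sum_left[OF e uT])
    also have "\<dots> = 0"
      by (rule sum.neutral) (use gs_residual_frame(3)[OF q order_refl v] I.sym[OF e uT] in auto)
    finally show "g q ?u t = 0" .
  qed
  show unique: "u = ?u" if u: "u \<in> tangent_space M q" "(\<lambda>f. v f - u f) \<in> fol_tangent M \<F> q"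
      "\<forall>t\<in>fol_tangent M \<F> q. g q u t = 0" for u
  proof (rule ccontr)
    assume ne: "u \<noteq> ?u"
    let ?d = "\<lambda>f. u f - ?u f"
    have dT: "?d \<in> tangent_space M q" by (rule I.diff_in[OF u(1) uT])
    obtain b where b: "(\<lambda>f. v f - u f) = (\<lambda>f. \<Sum>i<p. b i * leaf_frame q i f)"
      using u(2) unfolding fol_tangent_D[OF q] by blast
    have d_eq: "?d = (\<lambda>f. \<Sum>i<p. (a i - b i) * leaf_frame q i f)"
      using fun_cong[OF b] fun_cong[OF a]
      by (auto simp: fun_eq_iff left_diff_distrib sum_subtractf algebra_simps)
    from d_eq have dF: "?d \<in> fol_tangent M \<F> q"
      unfolding fol_tangent_D[OF q] by (rule exI[of _ "\<lambda>i. a i - b i"])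
    have "g q ?d ?d = g q u ?d - g q ?u ?d" by (rule I.diff_left[OF u(1) uT dT])
    also have "\<dots> = 0" using u(3) orth dF by simp
    finally have "g q ?d ?d = 0" .
    moreover have "?d \<noteq> (\<lambda>f. 0)" using ne by (auto simp: fun_eq_iff)
    ultimately show False using I.pos[OF dT] by simp
  qed
  show "normal_part M \<F> g q v = ?u"
    unfolding normal_part_def
  proof (rule the_equality)
    show "?u \<in> tangent_space M q \<and> (\<lambda>f. v f - ?u f) \<in> fol_tangent M \<F> q \<and>
        (\<forall>t\<in>fol_tangent M \<F> q. g q ?u t = 0)"
      by (intro conjI uT d orth)
  qed (elim conjE, rule unique)
qed

end

text \<open>Near \<open>q\<close>, the normal parts of \<open>Y\<close> and \<open>Z\<close> are smooth vector fields, as Gram-Schmidt residuals with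
  respect to the leaf frame of a flat chart.\<close>

lemma smooth_near_normal_metric:
  assumes q: "q \<in> points M" and Y: "vector_field M Y" and Z: "vector_field M Z"
  shows "smooth_near M q (\<lambda>r. normal_metric M \<F> g r (Y r) (Z r))"
proof -
  obtain D \<phi> where f: "flat_chart M p \<F> (D, \<phi>)" "(D, \<phi>) \<in> max_atlas M" "q \<in> D" "p \<le> n"
    using flat_chart_at[OF q] .
  note D = max_chart_open[OF f(2)]
  have sub: "vector_field_on M D V" if "vector_field M V" for V
    using that max_chartD(1)[OF f(2)] unfolding vector_field_on_iff[OF D] vector_field_on_iff[OF openin_points] by blast
  note YD = vector_field_on_gs_residual[OF f(1,2,4) D subset_refl order_refl sub[OF Y]]
    and ZD = vector_field_on_gs_residual[OF f(1,2,4) D subset_refl order_refl sub[OF Z]]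
  show ?thesis
  proof (rule smooth_near_cong[OF smooth_near_metric[OF D f(3) YD ZD] D f(3)])
    fix r assume r: "r \<in> D"
    have "Y r \<in> tangent_space M r" "Z r \<in> tangent_space M r"
      using sub[OF Y] sub[OF Z] r by (simp_all add: vector_field_on_def)
    then show "g r (gs_residual (g r) (\<lambda>i. coord_vec M (D, \<phi>) r i) p (Y r)) (gs_residual (g r) (\<lambda>i. coord_vec M (D, \<phi>) r i) p (Z r)) =
        normal_metric M \<F> g r (Y r) (Z r)"
      by (simp add: normal_metric_def normal_part_gs_residual(1)[OF f(1,2,4) r])
  qed
qed

end


section \<open>Restricting a bundle-like metric\<close>

locale foliated_submanifold = slice_submanifold M S m + riemannian_foliation M p \<F> g
  for M :: "'a mfd" and S m p \<F> g +
  assumes leaf_cover: "r \<in> S \<Longrightarrow> \<exists>L\<in>\<F>. r \<in> points L \<and> points L \<subseteq> S"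
begin

abbreviation "\<F>\<^sub>S \<equiv> restrict_foliation \<F> S"
abbreviation "g\<^sub>S \<equiv> restrict_metric N M g"

text \<open>The inclusion of a leaf into the submanifold is smooth, because functions on the submanifold
  extend locally to the ambient manifold and there the leaf is immersed. It is continuous since the
  submanifold carries the subspace topology.\<close>

lemma leaf_inclusion:
  assumes L: "L \<in> \<F>" "r \<in> points L" "points L \<subseteq> S" and v: "v \<in> tangent_space L r"
  shows "differential L N (\<lambda>x. x) r v \<in> tangent_space N r"
    and "push r (differential L N (\<lambda>x. x) r v) = differential L M (\<lambda>x. x) r v"
proof -
  have Lfol: "smooth_manifold L" "immersion L M (\<lambda>x. x)"
    using fol L(1) by (simp_all add: foliation_def)
  have LS: "smooth_structure L" by (rule smooth_manifold_imp_smooth_structure[OF Lfol(1)])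
  interpret L: smooth_structure L by fact
  have sm: "smooth_map L M (\<lambda>x. x)" using Lfol(2) by (simp add: immersion_def)
  have cont: "continuous_map (mtop L) (mtop M) (\<lambda>x. x)" using sm by (simp add: smooth_map_def)
  have contN: "continuous_map (mtop L) (mtop N) (\<lambda>x. x)"
    unfolding mtop_sub continuous_map_in_subtopology using cont L(3) by (auto simp: L.topspace_mtop)
  have pull: "smooth_near L r h" if h: "smooth_near N r h" for h
  proof -
    obtain f U where f: "smooth_near M r f" "openin (mtop M) U" "r \<in> U" "\<And>s. s \<in> U \<inter> S \<Longrightarrow> f s = h s"
      using smooth_near_extend[OF h] by blast
    have "smooth_near L r f"
      using smooth_map_pullback[OF LS smooth_structure_axioms sm L(2), of f] f(1) by simp
    then show ?thesis
    proof (rule L.smooth_near_cong)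
      show "openin (mtop L) {s \<in> topspace (mtop L). s \<in> U}"
        by (rule openin_continuous_map_preimage[OF cont f(2)])
    qed (use f(3,4) L(2,3) in \<open>auto simp: L.topspace_mtop\<close>)
  qed
  show "differential L N (\<lambda>x. x) r v \<in> tangent_space N r"
    by (rule differential_tangent(1)[OF LS smooth_structure_sub contN pull v])
  have "r \<in> S" using L by blast
  then show "push r (differential L N (\<lambda>x. x) r v) = differential L M (\<lambda>x. x) r v"
    using smooth_near_restrict by (auto simp: differential_def fun_eq_iff o_def)
qed

text \<open>By \<open>leaf_inclusion\<close>, since the leaf through \<open>r\<close> is unique and contained in \<open>S\<close>.\<close>

lemma fol_tangent_sub:
  assumes r: "r \<in> S"
  shows "t \<in> fol_tangent N \<F>\<^sub>S r \<Longrightarrow> t \<in> tangent_space N r"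
    and "t \<in> fol_tangent N \<F>\<^sub>S r \<Longrightarrow> push r t \<in> fol_tangent M \<F> r"
    and "w \<in> fol_tangent M \<F> r \<Longrightarrow> \<exists>t\<in>fol_tangent N \<F>\<^sub>S r. push r t = w"
proof -
  show "t \<in> tangent_space N r" "push r t \<in> fol_tangent M \<F> r" if t: "t \<in> fol_tangent N \<F>\<^sub>S r"
  proof -
    obtain L v where L: "L \<in> \<F>" "points L \<subseteq> S" "r \<in> points L" "v \<in> tangent_space L r"
      and tv: "t = differential L N (\<lambda>x. x) r v"
      using t by (auto simp: fol_tangent_def restrict_foliation_def)
    show "t \<in> tangent_space N r"
      unfolding tv by (rule leaf_inclusion(1)[OF L(1,3,2,4)])
    show "push r t \<in> fol_tangent M \<F> r"
      unfolding tv leaf_inclusion(2)[OF L(1,3,2,4)] fol_tangent_def using L by blast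
  qed
  show "\<exists>t\<in>fol_tangent N \<F>\<^sub>S r. push r t = w" if w: "w \<in> fol_tangent M \<F> r"
  proof -
    obtain L v where L: "L \<in> \<F>" "r \<in> points L" "v \<in> tangent_space L r"
      and wv: "w = differential L M (\<lambda>x. x) r v"
      using w by (auto simp: fol_tangent_def)
    obtain L' where L': "L' \<in> \<F>" "r \<in> points L'" "points L' \<subseteq> S" using leaf_cover[OF r] by blast
    have "L = L'"
    proof (rule ccontr)
      assume "L \<noteq> L'"
      then have "points L \<inter> points L' = {}" using fol L(1) L'(1) by (simp add: foliation_def)
      then show False using L(2) L'(2) by blast
    qed
    then have LS: "points L \<subseteq> S" using L' by simp
    show ?thesis
    proof
      show "push r (differential L N (\<lambda>x. x) r v) = w"
        unfolding wv by (rule leaf_inclusion(2)[OF L(1,2) LS L(3)])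
      show "differential L N (\<lambda>x. x) r v \<in> fol_tangent N \<F>\<^sub>S r"
        unfolding fol_tangent_def restrict_foliation_def using L LS by blast
    qed
  qed
qed

lemma push_diff: "push r (\<lambda>f. u f - v f) = (\<lambda>f. push r u f - push r v f)"
  by (auto simp: push_apply fun_eq_iff)

text \<open>Subtracting a leaf direction does not lead out of the tangent space of the submanifold. So the
  normal part taken in \<open>M\<close> is tangent to the submanifold, and there it satisfies the conditions that
  determine the normal part.\<close>

lemma normal_part_sub:
  assumes r: "r \<in> S" and v: "v \<in> tangent_space N r"
  shows "push r (normal_part N \<F>\<^sub>S g\<^sub>S r v) = normal_part M \<F> g r (push r v)"
proof -
  have rM: "r \<in> points M" using r S_subset by blast
  obtain D \<phi> where f: "flat_chart M p \<F> (D, \<phi>)" "(D, \<phi>) \<in> max_atlas M" "r \<in> D" "p \<le> n"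
    using flat_chart_at[OF rM] .
  let ?w = "push r v"
  have w: "?w \<in> tangent_space M r" by (rule push_tangent[OF v])
  let ?u = "gs_residual (g r) (\<lambda>i. coord_vec M (D, \<phi>) r i) p ?w"
  note np = normal_part_gs_residual[OF f(1,2,4,3) w]
  obtain t where t: "t \<in> fol_tangent N \<F>\<^sub>S r" "push r t = (\<lambda>f. ?w f - ?u f)"
    using fol_tangent_sub(3)[OF r np(3)] by blast
  have tT: "t \<in> tangent_space N r" by (rule fol_tangent_sub(1)[OF r t(1)])
  define u where "u = (\<lambda>f. v f - t f)"
  have uT: "u \<in> tangent_space N r"
    using N.tangent_lincomb[OF v tT, of 1 "-1"] by (simp add: u_def)
  have pu: "push r u = ?u"
    unfolding u_def push_diff t(2) by simp
  have "normal_part N \<F>\<^sub>S g\<^sub>S r v = u"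
    unfolding normal_part_def
  proof (rule the_equality)
    have "(\<lambda>f. v f - u f) = t" by (simp add: u_def)
    moreover have "\<forall>t'\<in>fol_tangent N \<F>\<^sub>S r. g\<^sub>S r u t' = 0"
      unfolding restrict_metric_def pu using np(4) fol_tangent_sub(2)[OF r] by blast
    ultimately show "u \<in> tangent_space N r \<and> (\<lambda>f. v f - u f) \<in> fol_tangent N \<F>\<^sub>S r \<and>
        (\<forall>t'\<in>fol_tangent N \<F>\<^sub>S r. g\<^sub>S r u t' = 0)"
      using uT t(1) by simp
  next
    fix u' assume u': "u' \<in> tangent_space N r \<and> (\<lambda>f. v f - u' f) \<in> fol_tangent N \<F>\<^sub>S r \<and>
        (\<forall>t'\<in>fol_tangent N \<F>\<^sub>S r. g\<^sub>S r u' t' = 0)"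
    have "push r u' = ?u"
    proof (rule np(2))
      show "push r u' \<in> tangent_space M r" using u' push_tangent by blast
      show "(\<lambda>f. ?w f - push r u' f) \<in> fol_tangent M \<F> r"
        using fol_tangent_sub(2)[OF r, of "\<lambda>f. v f - u' f"] u' unfolding push_diff by blast
      show "\<forall>t\<in>fol_tangent M \<F> r. g r (push r u') t = 0"
      proof
        fix s assume "s \<in> fol_tangent M \<F> r"
        then obtain t' where "t' \<in> fol_tangent N \<F>\<^sub>S r" "push r t' = s"
          using fol_tangent_sub(3)[OF r] by blast
        then show "g r (push r u') s = 0" using u' unfolding restrict_metric_def by blast
      qed
    qed
    then show "u' = u" using push_inj[of u' r u] u' uT pu by simp
  qed
  then show ?thesis using pu np(1) by simp
qed

lemma normal_metric_sub:
  assumes "r \<in> S" "u \<in> tangent_space N r" "v \<in> tangent_space N r"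
  shows "normal_metric N \<F>\<^sub>S g\<^sub>S r u v = normal_metric M \<F> g r (push r u) (push r v)"
proof -
  have "g\<^sub>S r a b = g r (push r a) (push r b)" for a b by (simp add: restrict_metric_def)
  then show ?thesis
    by (simp only: normal_metric_def normal_part_sub[OF assms(1,2)] normal_part_sub[OF assms(1,3)])
qed

text \<open>The components of \<open>W\<close> in the chart are smooth functions on the submanifold. Extend each of them,
  form the combination of coordinate vectors with the extended coefficients, and multiply by a bump
  function. The parameter \<open>k\<close> allows keeping a field in the span of the first \<open>k\<close> coordinate vectors; for
  a flat chart and \<open>k = p\<close> this is tangency to the leaves.\<close>

lemma extend_vector_field:
  assumes H: "Hausdorff_space (mtop M)" and W: "vector_field N W" and q: "q \<in> S" "q \<in> D"
    and c: "(D, \<phi>) \<in> max_atlas M" and k: "k \<le> n"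
    and zero: "\<And>r i. r \<in> S \<Longrightarrow> r \<in> D \<Longrightarrow> k \<le> i \<Longrightarrow> i < n \<Longrightarrow> W r (\<lambda>s. \<phi> s i) = 0"
  obtains W' V where "vector_field M W'" "openin (mtop M) V" "q \<in> V"
    "\<And>r. r \<in> V \<Longrightarrow> r \<in> S \<Longrightarrow> W' r = push r (W r)"
    "\<And>r. r \<notin> D \<Longrightarrow> W' r = (\<lambda>f. 0)"
    "\<And>r. r \<in> D \<Longrightarrow> \<exists>a. W' r = (\<lambda>f. \<Sum>i<k. a i * coord_vec M (D, \<phi>) r i f)"
proof -
  have WN: "W r \<in> tangent_space N r" if "r \<in> S" for r
    using W that by (simp add: vector_field_on_def points_sub)
  have "\<exists>f U. (\<forall>r\<in>U. smooth_near M r f) \<and> openin (mtop M) U \<and> q \<in> U \<and>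
      (\<forall>r\<in>U \<inter> S. f r = W r (\<lambda>s. \<phi> s i))" for i
  proof -
    have "smooth_near N q (\<lambda>s. \<phi> s i)"
      by (rule smooth_near_restrict[OF q(1) smooth_near_coord[OF c q(2)]])
    then have "smooth_near N q (\<lambda>r. W r (\<lambda>s. \<phi> s i))"
      using W[unfolded N.vector_field_on_iff[OF N.openin_points], unfolded points_sub] q(1) by blast
    then obtain f U where f: "smooth_near M q f" "openin (mtop M) U" "q \<in> U"
      "\<And>r. r \<in> U \<inter> S \<Longrightarrow> f r = W r (\<lambda>s. \<phi> s i)"
      using smooth_near_extend by blast
    obtain U' where U': "openin (mtop M) U'" "q \<in> U'" "\<And>r. r \<in> U' \<Longrightarrow> smooth_near M r f"
      using smooth_near_open[OF f(1)] by blast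
    show ?thesis
      by (intro exI[of _ f] exI[of _ "U \<inter> U'"]) (use f U' in \<open>auto intro: openin_Int\<close>)
  qed
  then obtain G UU where G: "\<And>i r. r \<in> UU i \<Longrightarrow> smooth_near M r (G i)"
    "\<And>i. openin (mtop M) (UU i)" "\<And>i. q \<in> UU i"
    "\<And>i r. r \<in> UU i \<Longrightarrow> r \<in> S \<Longrightarrow> G i r = W r (\<lambda>s. \<phi> s i)"
    by (metis IntI)
  define U where "U = \<Inter> (insert D (UU ` {..<k}))"
  have U: "openin (mtop M) U" unfolding U_def
    by (rule openin_Inter) (use G(2) max_chart_open[OF c] in auto)
  have qU: "q \<in> U" and UD: "U \<subseteq> D" and UU: "\<And>i. i < k \<Longrightarrow> U \<subseteq> UU i"
    using G(3) q(2) by (auto simp: U_def)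
  define W0 where "W0 r = (\<lambda>f. \<Sum>i<k. G i r * coord_vec M (D, \<phi>) r i f)" for r
  have "vector_field_on M U W0"
    unfolding vector_field_on_iff[OF U]
  proof (intro ballI conjI allI impI)
    fix r assume r: "r \<in> U"
    then have rD: "r \<in> D" and rM: "r \<in> points M" using UD max_chartD(1)[OF c] by auto
    show "W0 r \<in> tangent_space M r"
      unfolding W0_def
      by (rule tvec_inner_product.sum_in[OF inner[OF rM]]) (use coord_vec_tangent[OF c rD] k in simp)
    fix f assume f: "smooth_near M r f"
    show "smooth_near M r (\<lambda>s. W0 s f)"
      unfolding W0_def
      by (intro smooth_near_sum[OF rM] smooth_near_mult smooth_near_coord_vec(1)[OF c rD f])
        (use G(1) UU r k in auto)
  qed
  from exists_global_extension[OF H U qU this]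
  obtain W' V b where W': "vector_field M W'" "openin (mtop M) V" "q \<in> V" "V \<subseteq> U"
    "\<And>r. r \<in> V \<Longrightarrow> W' r = W0 r" "\<And>r. W' r = (if r \<in> U then (\<lambda>f. b r * W0 r f) else (\<lambda>f. 0))"
    by metis
  have "W' r = push r (W r)" if r: "r \<in> V" "r \<in> S" for r
  proof -
    have rD: "r \<in> D" and rU: "r \<in> U" using r W'(4) UD by auto
    have pT: "push r (W r) \<in> tangent_space M r" by (rule push_tangent[OF WN[OF r(2)]])
    have coord: "push r (W r) (\<lambda>s. \<phi> s i) = W r (\<lambda>s. \<phi> s i)" for i
      using smooth_near_coord[OF c rD] by (simp add: push_apply)
    have "push r (W r) f = W0 r f" for f
    proof -
      have "push r (W r) f = (\<Sum>i<n. W r (\<lambda>s. \<phi> s i) * coord_vec M (D, \<phi>) r i f)"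
        using tangent_expand[OF c rD pT, of f] by (simp add: coord)
      also have "\<dots> = (\<Sum>i<k. W r (\<lambda>s. \<phi> s i) * coord_vec M (D, \<phi>) r i f)"
        by (rule sum_lessThan_truncate[OF k]) (simp add: zero[OF r(2) rD])
      also have "\<dots> = W0 r f"
        unfolding W0_def
      proof (rule sum.cong[OF refl])
        fix i assume "i \<in> {..<k}"
        then have "r \<in> UU i" using UU rU by blast
        then show "W r (\<lambda>s. \<phi> s i) * coord_vec M (D, \<phi>) r i f = G i r * coord_vec M (D, \<phi>) r i f"
          using G(4) r(2) by simp
      qed
      finally show ?thesis .
    qed
    then show ?thesis using W'(5)[OF r(1)] by (simp add: fun_eq_iff)
  qed
  moreover have "W' r = (\<lambda>f. 0)" if "r \<notin> D" for r
    using that UD W'(6) by auto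
  moreover have "\<exists>a. W' r = (\<lambda>f. \<Sum>i<k. a i * coord_vec M (D, \<phi>) r i f)" for r
  proof (cases "r \<in> U")
    case True
    then show ?thesis
      by (intro exI[of _ "\<lambda>i. b r * G i r"]) (simp add: W'(6) W0_def sum_distrib_left mult.assoc)
  qed (use W'(6) in \<open>auto intro: exI[of _ "\<lambda>_. 0"]\<close>)
  ultimately show ?thesis using that[of W' V] W'(1-3) by blast
qed

text \<open>For a smooth function \<open>f\<close> on \<open>M\<close>, the functions \<open>Y f\<close> and \<open>Y' f\<close> agree on the submanifold near \<open>q\<close>, and
  \<open>X q\<close> only sees the values on the submanifold.\<close>

lemma push_lie_bracket:
  assumes q: "q \<in> S" and V: "openin (mtop M) V" "q \<in> V"
    and X: "vector_field N X" "vector_field M X'" "\<And>r. r \<in> V \<Longrightarrow> r \<in> S \<Longrightarrow> X' r = push r (X r)"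
    and Y: "vector_field N Y" "vector_field M Y'" "\<And>r. r \<in> V \<Longrightarrow> r \<in> S \<Longrightarrow> Y' r = push r (Y r)"
  shows "push q (lie_bracket N X Y q) = lie_bracket M X' Y' q"
proof
  fix f
  show "push q (lie_bracket N X Y q) f = lie_bracket M X' Y' q f"
  proof (cases "smooth_near M q f")
    case f: True
    obtain U where U: "openin (mtop M) U" "q \<in> U" "\<And>r. r \<in> U \<Longrightarrow> smooth_near M r f"
      using smooth_near_open[OF f] by blast
    have o: "openin (mtop N) (U \<inter> V \<inter> S)"
      by (rule openin_restrict[OF openin_Int[OF U(1) V(1)]])
    have *: "A q (\<lambda>r. B r f) = A' q (\<lambda>r. B' r f)"
      if A: "vector_field N A" "\<And>r. r \<in> V \<Longrightarrow> r \<in> S \<Longrightarrow> A' r = push r (A r)"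
        and B: "vector_field M B'" "\<And>r. r \<in> V \<Longrightarrow> r \<in> S \<Longrightarrow> B' r = push r (B r)" for A A' B B'
    proof -
      have aT: "A q \<in> tangent_space N q" using A(1) q by (simp add: vector_field_on_def points_sub)
      have "A q (\<lambda>r. B r f) = A q (\<lambda>r. B' r f)"
        by (rule N.tangent_local[OF aT o]) (use q U V B(2) in \<open>auto simp: push_apply\<close>)
      also have "smooth_near M q (\<lambda>r. B' r f)"
        using B(1) f S_subset q unfolding vector_field_on_iff[OF openin_points] by blast
      then have "A q (\<lambda>r. B' r f) = push q (A q) (\<lambda>r. B' r f)" by (simp add: push_apply)
      also have "push q (A q) = A' q" using A(2) V(2) q by simp
      finally show ?thesis .
    qed
    show ?thesis
      using *[OF X(1,3) Y(2,3)] *[OF Y(1,3) X(2,3)] f smooth_near_restrict[OF q f]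
      by (simp add: push_apply lie_bracket_def)
  qed (simp add: push_apply lie_bracket_def)
qed

text \<open>Each of the three terms of the Lie derivative on the submanifold equals the corresponding term
  for the extended fields.\<close>

lemma bundle_like_sub:
  assumes H: "Hausdorff_space (mtop M)" and bl: "bundle_like M \<F> g"
  shows "bundle_like N \<F>\<^sub>S g\<^sub>S"
  unfolding bundle_like_def
proof (intro ballI allI impI)
  fix X Y Z q
  assume X: "X \<in> fol_sections N \<F>\<^sub>S" and Y: "vector_field N Y" and Z: "vector_field N Z" and "q \<in> points N"
  then have q: "q \<in> S" by (simp add: points_sub)
  have qM: "q \<in> points M" using q S_subset by blast
  have XN: "vector_field N X" and Xfol: "\<And>r. r \<in> S \<Longrightarrow> X r \<in> fol_tangent N \<F>\<^sub>S r"
    using X by (auto simp: fol_sections_def points_sub)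
  obtain D \<phi> where f: "flat_chart M p \<F> (D, \<phi>)" "(D, \<phi>) \<in> max_atlas M" "q \<in> D" "p \<le> n"
    using flat_chart_at[OF qM] .
  \<comment> \<open>tangency to the leaves, expressed in the flat chart\<close>
  have Xzero: "X r (\<lambda>s. \<phi> s i) = 0" if r: "r \<in> S" "r \<in> D" and i: "p \<le> i" "i < n" for r i
  proof -
    have "push r (X r) \<in> fol_tangent M \<F> r" by (rule fol_tangent_sub(2)[OF r(1) Xfol[OF r(1)]])
    then obtain a where a: "push r (X r) = (\<lambda>f. \<Sum>l<p. a l * coord_vec M (D, \<phi>) r l f)"
      using fol_tangent_D[OF f(1,2,4) r(2)] by blast
    have "X r (\<lambda>s. \<phi> s i) = push r (X r) (\<lambda>s. \<phi> s i)"
      using smooth_near_coord[OF f(2) r(2)] by (simp add: push_apply)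
    also have "\<dots> = 0"
      unfolding a by (rule sum.neutral) (use i f(4) coord_vec_coord[OF f(2) r(2)] in auto)
    finally show ?thesis .
  qed
  obtain X' V1 where X': "vector_field M X'" "openin (mtop M) V1" "q \<in> V1"
    "\<And>r. r \<in> V1 \<Longrightarrow> r \<in> S \<Longrightarrow> X' r = push r (X r)" "\<And>r. r \<notin> D \<Longrightarrow> X' r = (\<lambda>f. 0)"
    "\<And>r. r \<in> D \<Longrightarrow> \<exists>a. X' r = (\<lambda>f. \<Sum>i<p. a i * coord_vec M (D, \<phi>) r i f)"
    using extend_vector_field[OF H XN q f(3,2,4) Xzero] by blast
  obtain Y' V2 where Y': "vector_field M Y'" "openin (mtop M) V2" "q \<in> V2"
    "\<And>r. r \<in> V2 \<Longrightarrow> r \<in> S \<Longrightarrow> Y' r = push r (Y r)"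
    by (rule extend_vector_field[OF H Y q f(3,2) order_refl]) auto
  obtain Z' V3 where Z': "vector_field M Z'" "openin (mtop M) V3" "q \<in> V3"
    "\<And>r. r \<in> V3 \<Longrightarrow> r \<in> S \<Longrightarrow> Z' r = push r (Z r)"
    by (rule extend_vector_field[OF H Z q f(3,2) order_refl]) auto
  define V where "V = V1 \<inter> V2 \<inter> V3"
  have V: "openin (mtop M) V" "q \<in> V" using X' Y' Z' by (auto simp: V_def openin_Int)
  have ext: "X' r = push r (X r)" "Y' r = push r (Y r)" "Z' r = push r (Z r)" if "r \<in> V" "r \<in> S" for r
    using X'(4) Y'(4) Z'(4) that by (auto simp: V_def)
  have "X' r \<in> fol_tangent M \<F> r" if r: "r \<in> points M" for r
  proof (cases "r \<in> D")
    case True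
    then show ?thesis using X'(6) fol_tangent_D[OF f(1,2,4) True] by blast
  next
    case False
    obtain D1 \<phi>1 where f1: "flat_chart M p \<F> (D1, \<phi>1)" "(D1, \<phi>1) \<in> max_atlas M" "r \<in> D1" "p \<le> n"
      using flat_chart_at[OF r] .
    show ?thesis
      unfolding X'(5)[OF False] fol_tangent_D[OF f1(1,2,4,3)] by (rule exI[of _ "\<lambda>_. 0"]) simp
  qed
  then have "X' \<in> fol_sections M \<F>" using X'(1) by (simp add: fol_sections_def)
  then have zero: "lie_derivative_metric M X' (normal_metric M \<F> g) Y' Z' q = 0"
    using bl Y'(1) Z'(1) qM unfolding bundle_like_def by blast
  have T: "W r \<in> tangent_space N r" if "vector_field N W" "r \<in> S" for W r
    using that by (simp add: vector_field_on_def points_sub)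
  let ?h = "normal_metric M \<F> g" and ?h\<^sub>S = "normal_metric N \<F>\<^sub>S g\<^sub>S"
  have "X q (\<lambda>r. ?h\<^sub>S r (Y r) (Z r)) = X q (\<lambda>r. ?h r (Y' r) (Z' r))"
    by (rule N.tangent_local[OF T[OF XN q] openin_restrict[OF V(1)]])
      (use q V(2) ext in \<open>auto simp: normal_metric_sub T[OF Y] T[OF Z]\<close>)
  also have "\<dots> = push q (X q) (\<lambda>r. ?h r (Y' r) (Z' r))"
    using smooth_near_normal_metric[OF qM Y'(1) Z'(1)] by (simp add: push_apply)
  also have "\<dots> = X' q (\<lambda>r. ?h r (Y' r) (Z' r))" using ext(1)[OF V(2) q] by simp
  finally have 1: "X q (\<lambda>r. ?h\<^sub>S r (Y r) (Z r)) = X' q (\<lambda>r. ?h r (Y' r) (Z' r))" .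
  have br: "lie_bracket N X W q \<in> tangent_space N q" if "vector_field N W" for W
    by (rule N.lie_bracket_tangent[OF N.openin_points _ XN that]) (simp add: points_sub q)
  have XY: "push q (lie_bracket N X Y q) = lie_bracket M X' Y' q"
    by (rule push_lie_bracket[OF q V XN X'(1) ext(1) Y Y'(1) ext(2)])
  have XZ: "push q (lie_bracket N X Z q) = lie_bracket M X' Z' q"
    by (rule push_lie_bracket[OF q V XN X'(1) ext(1) Z Z'(1) ext(3)])
  have 2: "?h\<^sub>S q (lie_bracket N X Y q) (Z q) = ?h q (lie_bracket M X' Y' q) (Z' q)"
    by (simp only: normal_metric_sub[OF q br[OF Y] T[OF Z q]] XY ext(3)[OF V(2) q])
  have 3: "?h\<^sub>S q (Y q) (lie_bracket N X Z q) = ?h q (Y' q) (lie_bracket M X' Z' q)"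
    by (simp only: normal_metric_sub[OF q T[OF Y q] br[OF Z]] XZ ext(2)[OF V(2) q])
  show "lie_derivative_metric N X ?h\<^sub>S Y Z q = 0"
    using zero unfolding lie_derivative_metric_def 1 2 3 .
qed

end

text \<open>A section of the restricted foliation exhibits, at each point of \<open>S\<close>, a slice chart and a leaf
  contained in \<open>S\<close>; if there is none, the condition to be shown is empty.\<close>

theorem bundle_like_submanifold:
  assumes M: "smooth_manifold M" and fol: "foliation M p \<F>" and metric: "riemannian_metric M g"
    and bl: "bundle_like M \<F> g" and m: "m \<le> mdim M"
  shows "bundle_like (submanifold M S m) (restrict_foliation \<F> S) (restrict_metric (submanifold M S m) M g)"
proof (cases "fol_sections (submanifold M S m) (restrict_foliation \<F> S) = {}")
  case True
  then show ?thesis by (simp add: bundle_like_def)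
next
  case False
  then obtain X where X: "X \<in> fol_sections (submanifold M S m) (restrict_foliation \<F> S)" by blast
  have tangent: "X r \<in> tangent_space (submanifold M S m) r"
    and fol_tangent: "X r \<in> fol_tangent (submanifold M S m) (restrict_foliation \<F> S) r" if "r \<in> S" for r
    using X that by (auto simp: fol_sections_def vector_field_on_def submanifold_def)
  interpret smooth_structure M by (rule smooth_manifold_imp_smooth_structure[OF M])
  interpret foliated_submanifold M S m p \<F> g
  proof
    show "m \<le> mdim M" "foliation M p \<F>" "riemannian_metric M g" by fact+
    show "\<exists>D \<phi>. (D, \<phi>) \<in> max_atlas M \<and> r \<in> D \<and> \<phi> ` (D \<inter> S) = \<phi> ` D \<inter> Rn m" if "r \<in> S" for r
      using tangent[OF that] by (auto simp: tangent_space_def submanifold_def)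
    show "\<exists>L\<in>\<F>. r \<in> points L \<and> points L \<subseteq> S" if "r \<in> S" for r
      using fol_tangent[OF that] by (auto simp: fol_tangent_def restrict_foliation_def)
  qed
  show ?thesis
    by (rule bundle_like_sub) (use M bl in \<open>simp_all add: smooth_manifold_def\<close>)
qed

theorem lemma4p13:
  fixes M :: "'a mfd" and \<F> :: "'a mfd set" and p k :: nat
    and g :: "'a metric" and \<omega> :: "nat \<Rightarrow> 'a form" and x\<^sub>0 :: 'a
    and ori nori :: "'a \<Rightarrow> 'a tvec list set" and y :: "(nat \<Rightarrow> real) set" and F :: "'a set"
  assumes "smooth_manifold M" and "compact_space (mtop M)" and "connected_space (mtop M)"
    and "orientation M ori"
    and "foliation M p \<F>" and "transverse_orientation M p \<F> nori"
    and "riemannian_metric M g" and "bundle_like M \<F> g"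
    and "\<And>i. i < k \<Longrightarrow> basic_harmonic M \<F> g 1 (\<omega> i)"
    and "basic_H1_rat_basis M \<F> k \<omega>"
    and "x\<^sub>0 \<in> points M"
    and "submersion M (albanese M k \<omega>) (albanese_map M k \<omega> x\<^sub>0)"
    and "y \<in> points (albanese M k \<omega>)"
    and "F = {x \<in> points M. albanese_map M k \<omega> x\<^sub>0 x = y}"
  shows "bundle_like (submanifold M F (mdim M - k)) (restrict_foliation \<F> F)
           (restrict_metric (submanifold M F (mdim M - k)) M g)"
  by (rule bundle_like_submanifold[OF assms(1,5,7,8)]) simp

end
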